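(* $\#\Sigma_0 \subsetneq$ FO-uniform $\#\mathrm{AC}^0$.
   Context: Structures: a finite $\sigma$-structure has universe $\{0,\dots,n-1\}$, $n\ge1$; built-in $\le$ (usual order), $\min=0$, $\mathrm{BIT}(i,j)$ iff the $i$-th bit of $j$ is $1$. $\mathrm{enc}_\sigma(\mathcal{A})$ is the standard binary encoding (non-built-in relations as $0/1$ truth values of all tuples in lexicographic order, non-built-in constants in binary of length $\lceil\log_2 n\rceil$; built-ins not encoded). $\#\Sigma_0$: $f:\{0,1\}^*\to\mathbb{N}$ is in $\#\Sigma_0$ if there are a vocabulary $\sigma$ containing built-in $\le,\mathrm{BIT},\min$ and a quantifier-free formula $\varphi(F_1,\dots,F_k,x_1,\dots,x_\ell)$ with free function variables $F_i$ of arity $a_i$ (usable in terms) and free individual variables $x_j$ such that for every $\sigma$-structure $\mathcal{A}$, $f(\mathrm{enc}_\sigma(\mathcal{A}))$ is the number of tuples $(f_1,\dots,f_k,c_1,\dots,c_\ell)$ with $f_i:\mathrm{dom}(\mathcal{A})^{a_i}\to\mathrm{dom}(\mathcal{A})$, $c_j\in\mathrm{dom}(\mathcal{A})$ and $\mathcal{A}\models\varphi(\bar f,\bar c)$. FO-uniform $\#\mathrm{AC}^0$: a Boolean circuit is a DAG with $\wedge$-, $\vee$-gates, constants, (possibly negated) input bits and one output gate; viewed as a structure over $\tau_{\mathrm{circ}}=(E^2,G_\wedge^1,G_\vee^1,B^1,r^1)$ ($E(x,y)$: $y$ child of $x$; gate types; $B(x)$: $x$ is a true leaf; $r(x)$: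 $x$ is the output). A string $w$, $|w|=n$, is the structure $\mathcal{A}_w$ with universe $\{0,\dots,n-1\}$, $\le$, BIT and unary $S$ ($S(x)$ iff bit $x$ of $w$ is $1$). A circuit family $(C_n)$ is FO-uniform if a first-order interpretation (universe defined by a formula with $k$ free variables as a set of $k$-tuples, relations by formulas) maps each $\mathcal{A}_w$ to $C_{|w|}$ (leaves evaluated on $w$). A proof tree of $C$ on $w$: a subtree of the tree-unfolding of $C$ containing the output gate, exactly one child of each included $\vee$-gate, all children of each included $\wedge$-gate, and only true leaves. $f\in$ FO-uniform $\#\mathrm{AC}^0$ iff there is an FO-uniform family of constant depth and polynomial size with $f(w)$ equal to the number of proof trees of $C_{|w|}$ on $w$.
   Formalization: Functions in #Σ₀ are additionally required to be 0 on nonempty words that encode no σ-structure (if left arbitrary there, the inclusion fails by counting); a vocabulary without relation symbols is encoded as if it had one always-false unary relation. *)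

theory Defs
  imports Complex_Main "HOL-Library.FuncSet"
begin

section \<open>Vocabularies, structures and their encoding\<close>

text \<open>
  The built-in symbols (order, BIT, min, equality) are part of every vocabulary and are
  interpreted by the logic itself; a vocabulary lists only the symbols that are not built-in.
\<close>

record vocab =
  rel_ars :: "nat list"  \<comment> \<open>arities of the relation symbols\<close>
  num_csts :: nat  \<comment> \<open>number of constant symbols\<close>

definition wf_vocab :: "vocab \<Rightarrow> bool" where
  "wf_vocab \<sigma> \<longleftrightarrow> (\<forall>a\<in>set (rel_ars \<sigma>). a \<ge> 1)"

text \<open>The universe of a structure is the initial segment \<open>{..<usize A}\<close>.\<close>

record struc =
  usize :: nat
  rel_of :: "nat \<Rightarrow> nat list \<Rightarrow> bool"
  cst_of :: "nat \<Rightarrow> nat"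

definition STRUC :: "vocab \<Rightarrow> struc set" where
  "STRUC \<sigma> = {A. usize A \<ge> 1 \<and> (\<forall>j<num_csts \<sigma>. cst_of A j < usize A)}"

definition tuples :: "nat \<Rightarrow> nat \<Rightarrow> nat list set" where
  "tuples n a = {xs. length xs = a \<and> set xs \<subseteq> {..<n}}"

definition bin_digits :: "nat \<Rightarrow> nat \<Rightarrow> bool list" where
  "bin_digits L c = map (bit c) (rev [0..<L])"  \<comment> \<open>most significant digit first\<close>

text \<open>
  \<open>product_lists (replicate a [0..<n])\<close> enumerates all \<open>a\<close>-tuples in lexicographic order.
  As is usual for this encoding, a vocabulary without relation symbols is treated as if it had one
  unary relation symbol that is always false; otherwise the size of the structure could not be
  recovered from its encoding (the encoding might even be empty).
\<close>

definition enc :: "vocab \<Rightarrow> struc \<Rightarrow> bool list" where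
  "enc \<sigma> A =
     (if rel_ars \<sigma> = [] then replicate (usize A) False
      else concat (map (\<lambda>i. map (rel_of A i) (product_lists (replicate (rel_ars \<sigma> ! i) [0..<usize A])))
                       [0..<length (rel_ars \<sigma>)]))
     @ concat (map (\<lambda>j. bin_digits (nat \<lceil>log 2 (real (usize A))\<rceil>) (cst_of A j)) [0..<num_csts \<sigma>])"


section \<open>First-order formulas with free function variables\<close>

datatype trm =
    Var nat
  | Cst nat
  | MinT
  | FunVar nat "trm list"

datatype fml =
    Rel nat "trm list"
  | Eql trm trm
  | Leq trm trm
  | BIT trm trm
  | Neg fml
  | Conj fml fml
  | Disj fml fml
  | Ex nat fml
  | All nat fml

fun tvars :: "trm \<Rightarrow> nat set" where
  "tvars (Var x) = {x}"
| "tvars (Cst j) = {}"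
| "tvars MinT = {}"
| "tvars (FunVar i ts) = (\<Union>t\<in>set ts. tvars t)"

fun fvars :: "fml \<Rightarrow> nat set" where
  "fvars (Rel R ts) = (\<Union>t\<in>set ts. tvars t)"
| "fvars (Eql s t) = tvars s \<union> tvars t"
| "fvars (Leq s t) = tvars s \<union> tvars t"
| "fvars (BIT s t) = tvars s \<union> tvars t"
| "fvars (Neg \<phi>) = fvars \<phi>"
| "fvars (Conj \<phi> \<psi>) = fvars \<phi> \<union> fvars \<psi>"
| "fvars (Disj \<phi> \<psi>) = fvars \<phi> \<union> fvars \<psi>"
| "fvars (Ex x \<phi>) = fvars \<phi> - {x}"
| "fvars (All x \<phi>) = fvars \<phi> - {x}"

fun quantifier_free :: "fml \<Rightarrow> bool" where
  "quantifier_free (Rel R ts) = True"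
| "quantifier_free (Eql s t) = True"
| "quantifier_free (Leq s t) = True"
| "quantifier_free (BIT s t) = True"
| "quantifier_free (Neg \<phi>) = quantifier_free \<phi>"
| "quantifier_free (Conj \<phi> \<psi>) = (quantifier_free \<phi> \<and> quantifier_free \<psi>)"
| "quantifier_free (Disj \<phi> \<psi>) = (quantifier_free \<phi> \<and> quantifier_free \<psi>)"
| "quantifier_free (Ex x \<phi>) = False"
| "quantifier_free (All x \<phi>) = False"

text \<open>Well-formedness over a vocabulary and a list \<open>ars\<close> of arities of the function variables.\<close>

fun wf_trm :: "vocab \<Rightarrow> nat list \<Rightarrow> trm \<Rightarrow> bool" where
  "wf_trm \<sigma> ars (Var x) = True"
| "wf_trm \<sigma> ars (Cst j) = (j < num_csts \<sigma>)"
| "wf_trm \<sigma> ars MinT = True"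
| "wf_trm \<sigma> ars (FunVar i ts) =
     (i < length ars \<and> length ts = ars ! i \<and> (\<forall>t\<in>set ts. wf_trm \<sigma> ars t))"

fun wf_fml :: "vocab \<Rightarrow> nat list \<Rightarrow> fml \<Rightarrow> bool" where
  "wf_fml \<sigma> ars (Rel R ts) =
     (R < length (rel_ars \<sigma>) \<and> length ts = rel_ars \<sigma> ! R \<and> (\<forall>t\<in>set ts. wf_trm \<sigma> ars t))"
| "wf_fml \<sigma> ars (Eql s t) = (wf_trm \<sigma> ars s \<and> wf_trm \<sigma> ars t)"
| "wf_fml \<sigma> ars (Leq s t) = (wf_trm \<sigma> ars s \<and> wf_trm \<sigma> ars t)"
| "wf_fml \<sigma> ars (BIT s t) = (wf_trm \<sigma> ars s \<and> wf_trm \<sigma> ars t)"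
| "wf_fml \<sigma> ars (Neg \<phi>) = wf_fml \<sigma> ars \<phi>"
| "wf_fml \<sigma> ars (Conj \<phi> \<psi>) = (wf_fml \<sigma> ars \<phi> \<and> wf_fml \<sigma> ars \<psi>)"
| "wf_fml \<sigma> ars (Disj \<phi> \<psi>) = (wf_fml \<sigma> ars \<phi> \<and> wf_fml \<sigma> ars \<psi>)"
| "wf_fml \<sigma> ars (Ex x \<phi>) = wf_fml \<sigma> ars \<phi>"
| "wf_fml \<sigma> ars (All x \<phi>) = wf_fml \<sigma> ars \<phi>"

fun eval_trm :: "struc \<Rightarrow> (nat list \<Rightarrow> nat) list \<Rightarrow> (nat \<Rightarrow> nat) \<Rightarrow> trm \<Rightarrow> nat" where
  "eval_trm A fs v (Var x) = v x"
| "eval_trm A fs v (Cst j) = cst_of A j"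
| "eval_trm A fs v MinT = 0"
| "eval_trm A fs v (FunVar i ts) = (fs ! i) (map (eval_trm A fs v) ts)"

fun sat :: "struc \<Rightarrow> (nat list \<Rightarrow> nat) list \<Rightarrow> (nat \<Rightarrow> nat) \<Rightarrow> fml \<Rightarrow> bool" where
  "sat A fs v (Rel R ts) = rel_of A R (map (eval_trm A fs v) ts)"
| "sat A fs v (Eql s t) = (eval_trm A fs v s = eval_trm A fs v t)"
| "sat A fs v (Leq s t) = (eval_trm A fs v s \<le> eval_trm A fs v t)"
| "sat A fs v (BIT s t) = bit (eval_trm A fs v t) (eval_trm A fs v s)"
| "sat A fs v (Neg \<phi>) = (\<not> sat A fs v \<phi>)"
| "sat A fs v (Conj \<phi> \<psi>) = (sat A fs v \<phi> \<and> sat A fs v \<psi>)"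
| "sat A fs v (Disj \<phi> \<psi>) = (sat A fs v \<phi> \<or> sat A fs v \<psi>)"
| "sat A fs v (Ex x \<phi>) = (\<exists>d<usize A. sat A fs (v(x := d)) \<phi>)"
| "sat A fs v (All x \<phi>) = (\<forall>d<usize A. sat A fs (v(x := d)) \<phi>)"


section \<open>The class \<open>#\<Sigma>\<^sub>0\<close>\<close>

text \<open>
  A function of arity \<open>a\<close> on the universe is represented extensionally, by a map on tuples that is
  \<open>undefined\<close> outside \<open>tuples n a\<close>, so that each function is counted once.
\<close>

definition sat_count :: "struc \<Rightarrow> nat list \<Rightarrow> nat \<Rightarrow> fml \<Rightarrow> nat" where
  "sat_count A ars l \<phi> = card {(fs, cs).
     length fs = length ars \<and>
     (\<forall>i<length ars. fs ! i \<in> tuples (usize A) (ars ! i) \<rightarrow>\<^sub>E {..<usize A}) \<and>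
     cs \<in> tuples (usize A) l \<and>
     sat A fs ((!) cs) \<phi>}"

text \<open>
  The value is \<open>0\<close> on nonempty words outside the
  range of \<open>enc \<sigma>\<close>. Were it left arbitrary there, the class would contain uncomputable functions.
  The empty word never encodes a structure, and the value on it is unconstrained, just as the
  circuit for inputs of length \<open>0\<close> is not constrained by uniformity below.
\<close>

definition sharp_Sigma0 :: "(bool list \<Rightarrow> nat) set" where
  "sharp_Sigma0 = {f. \<exists>\<sigma> ars l \<phi>.
     wf_vocab \<sigma> \<and> wf_fml \<sigma> ars \<phi> \<and> quantifier_free \<phi> \<and> fvars \<phi> \<subseteq> {..<l} \<and>
     (\<forall>A\<in>STRUC \<sigma>. f (enc \<sigma> A) = sat_count A ars l \<phi>) \<and>
     (\<forall>w. w \<noteq> [] \<and> w \<notin> enc \<sigma> ` STRUC \<sigma> \<longrightarrow> f w = 0)}"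


section \<open>Boolean circuits and proof trees\<close>

datatype gate = And | Or | Const bool | Input nat | NegInput nat

record 'g circuit =
  gates :: "'g set"
  children :: "('g \<times> 'g) set"  \<comment> \<open>\<open>(x, y)\<close> if \<open>y\<close> is a child of \<open>x\<close>\<close>
  label :: "'g \<Rightarrow> gate"
  out_gate :: 'g

definition wf_circuit :: "nat \<Rightarrow> 'g circuit \<Rightarrow> bool" where
  "wf_circuit n C \<longleftrightarrow>
     finite (gates C) \<and> children C \<subseteq> gates C \<times> gates C \<and> acyclic (children C) \<and>
     out_gate C \<in> gates C \<and>
     (\<forall>g\<in>gates C. label C g \<notin> {And, Or} \<longrightarrow> children C `` {g} = {}) \<and>
     (\<forall>g\<in>gates C. \<forall>i. label C g \<in> {Input i, NegInput i} \<longrightarrow> i < n)"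

fun true_label :: "bool list \<Rightarrow> gate \<Rightarrow> bool" where
  "true_label w And = False"
| "true_label w Or = False"
| "true_label w (Const b) = b"
| "true_label w (Input i) = w ! i"
| "true_label w (NegInput i) = (\<not> w ! i)"

text \<open>
  The nodes of the tree unfolding are the paths starting at the output gate; the children of a
  node \<open>p\<close> are the paths \<open>p @ [y]\<close>.
\<close>

definition tree_unfolding :: "'g circuit \<Rightarrow> 'g list set" where
  "tree_unfolding C = {p. p \<noteq> [] \<and> hd p = out_gate C \<and> successively (\<lambda>x y. (x, y) \<in> children C) p}"

definition proof_tree :: "'g circuit \<Rightarrow> bool list \<Rightarrow> 'g list set \<Rightarrow> bool" where
  "proof_tree C w T \<longleftrightarrow>
     T \<subseteq> tree_unfolding C \<and> [out_gate C] \<in> T \<and>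
     (\<forall>p y. p \<noteq> [] \<and> p @ [y] \<in> T \<longrightarrow> p \<in> T) \<and>
     (\<forall>p\<in>T. case label C (last p) of
         And \<Rightarrow> (\<forall>y. (last p, y) \<in> children C \<longrightarrow> p @ [y] \<in> T)
       | Or \<Rightarrow> (\<exists>!y. p @ [y] \<in> T)
       | g \<Rightarrow> true_label w g)"

definition num_proof_trees :: "'g circuit \<Rightarrow> bool list \<Rightarrow> nat" where
  "num_proof_trees C w = card {T. proof_tree C w T}"

definition circuit_size :: "'g circuit \<Rightarrow> nat" where
  "circuit_size C = card (gates C)"

definition circuit_depth :: "'g circuit \<Rightarrow> nat" where
  "circuit_depth C = Max ((\<lambda>p. length p - 1) ` tree_unfolding C)"


section \<open>First-order uniformity\<close>

definition string_vocab :: vocab where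
  "string_vocab = \<lparr>rel_ars = [1], num_csts = 0\<rparr>"

definition string_struc :: "bool list \<Rightarrow> struc" where
  "string_struc w = \<lparr>usize = length w, rel_of = (\<lambda>_ xs. w ! hd xs), cst_of = (\<lambda>_. 0)\<rparr>"

text \<open>Structures over the vocabulary \<open>(E, G\<^sub>\<and>, G\<^sub>\<or>, B, r)\<close> of circuits.\<close>

record 'g circ_struc =
  cUniv :: "'g set"
  cE :: "('g \<times> 'g) set"
  cAnd :: "'g set"
  cOr :: "'g set"
  cB :: "'g set"
  cR :: "'g set"

definition circuit_struc :: "'g circuit \<Rightarrow> bool list \<Rightarrow> 'g circ_struc" where
  "circuit_struc C w =
     \<lparr>cUniv = gates C,
      cE = children C,
      cAnd = {g \<in> gates C. label C g = And},
      cOr = {g \<in> gates C. label C g = Or},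
      cB = {g \<in> gates C. true_label w (label C g)},
      cR = {out_gate C}\<rparr>"

record interp =
  dim :: nat
  fmlU :: fml
  fmlE :: fml
  fmlAnd :: fml
  fmlOr :: fml
  fmlB :: fml
  fmlR :: fml

definition wf_interp :: "vocab \<Rightarrow> interp \<Rightarrow> bool" where
  "wf_interp \<sigma> I \<longleftrightarrow>
     (\<forall>\<phi>\<in>{fmlU I, fmlAnd I, fmlOr I, fmlB I, fmlR I}. wf_fml \<sigma> [] \<phi> \<and> fvars \<phi> \<subseteq> {..<dim I}) \<and>
     wf_fml \<sigma> [] (fmlE I) \<and> fvars (fmlE I) \<subseteq> {..<2 * dim I}"

definition interp_univ :: "interp \<Rightarrow> struc \<Rightarrow> nat list set" where
  "interp_univ I A = {x \<in> tuples (usize A) (dim I). sat A [] ((!) x) (fmlU I)}"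

definition interpret_struc :: "interp \<Rightarrow> struc \<Rightarrow> nat list circ_struc" where
  "interpret_struc I A =
     \<lparr>cUniv = interp_univ I A,
      cE = {(x, y) \<in> interp_univ I A \<times> interp_univ I A. sat A [] ((!) (x @ y)) (fmlE I)},
      cAnd = {x \<in> interp_univ I A. sat A [] ((!) x) (fmlAnd I)},
      cOr = {x \<in> interp_univ I A. sat A [] ((!) x) (fmlOr I)},
      cB = {x \<in> interp_univ I A. sat A [] ((!) x) (fmlB I)},
      cR = {x \<in> interp_univ I A. sat A [] ((!) x) (fmlR I)}\<rparr>"

text \<open>
  The structure defined by an interpretation has tuples as elements, so the gates of a uniform
  family are taken to be tuples. The interpretation sees the input word only to determine which
  leaves are true: the circuit itself depends on the length of the word. There is no structure
  for the empty word.
\<close>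

definition fo_uniform :: "(nat \<Rightarrow> nat list circuit) \<Rightarrow> bool" where
  "fo_uniform C \<longleftrightarrow> (\<exists>I. wf_interp string_vocab I \<and>
     (\<forall>w. w \<noteq> [] \<longrightarrow> interpret_struc I (string_struc w) = circuit_struc (C (length w)) w))"

definition fo_uniform_sharp_AC0 :: "(bool list \<Rightarrow> nat) set" where
  "fo_uniform_sharp_AC0 = {f. \<exists>C.
     (\<forall>n. wf_circuit n (C n)) \<and>
     fo_uniform C \<and>
     (\<exists>d. \<forall>n. circuit_depth (C n) \<le> d) \<and>
     (\<exists>c e. \<forall>n. circuit_size (C n) \<le> c * n ^ e + c) \<and>
     (\<forall>w. f w = num_proof_trees (C (length w)) w)}"

end

theory Submission
  imports Defs
begin

text \<open>
  Inclusion. Over a structure of size \<open>m\<close>, a quantifier-free formula with fixed individual variables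
  reads only a constant number of function values. The circuit is an \<open>Or\<close> over all guesses of the
  values of all terms (with relation atoms counted as terms); the \<open>And\<close> gate of a guess checks the
  input bits on which the guess relies and multiplies by \<open>m\<close> for every function value it leaves open.
  Uniformity requires the positions in the encoding, which are polynomials in \<open>m\<close> and the elements
  of the tuples, to be first-order definable, hence addition and multiplication must be defined
  from order and BIT. Addition is carry look-ahead. For multiplication, a number codes a sequence of
  very small numbers; two levels of such codes define the result of iterating a definable step on
  \<open>O(log n)\<close>-bounded states \<open>O(log n)\<close> times, which suffices to count the ones in a column of the
  schoolbook scheme and then to propagate the carries.

  Strictness. The function that is 1 on words without zeros and 0 otherwise is computed by a single
  \<open>And\<close> gate. If a quantifier-free formula counted it, a witness on a large all-ones structure would
  ignore some tuple, and would survive after that tuple is deleted.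
\<close>

section \<open>First-order definability over strings\<close>

text \<open>Guessing all term values splits correctness in two. Consistency of the guess and truth
  of the formula depend on \<open>m\<close> only, so they decide whether the gate exists; agreement
  with relations and constants depends on the word and is left to input literals. Each satisfying
  assignment induces exactly one guess, so the \<open>Or\<close> adds disjoint counts; the
  assignments inducing a given guess form a product, which an \<open>And\<close> counts. Codes are
  nested because a number below \<open>n\<close> has only about \<open>log n\<close> bits, too few
  for \<open>log n\<close> states of \<open>log log n\<close> bits each. For large \<open>n\<close>
  it has room for \<open>sqrt (log n)\<close> of them, and nesting squares this number. Gates of a
  uniform family are tuples over the word. A word of length 1 therefore allows a single gate and is
  treated apart, as is length 0, where uniformity demands nothing. The circuit sees the input
  length, not the size \<open>m\<close>; the length determines \<open>m\<close> because encodings of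
  larger structures are strictly longer.\<close>

lemma finite_tvars: "finite (tvars t)"
  by (induction t) auto

lemma finite_fvars: "finite (fvars \<phi>)"
  by (induction \<phi>) (auto simp: finite_tvars)

lemma eval_trm_cong:
  "(\<And>x. x \<in> tvars t \<Longrightarrow> v x = v' x) \<Longrightarrow> eval_trm A fs v t = eval_trm A fs v' t"
proof (induction t)
  case (FunVar i ts)
  then have "map (eval_trm A fs v) ts = map (eval_trm A fs v') ts" by auto
  then show ?case by (metis eval_trm.simps(4))
qed auto

lemma sat_cong:
  "(\<And>x. x \<in> fvars \<phi> \<Longrightarrow> v x = v' x) \<Longrightarrow> sat A fs v \<phi> = sat A fs v' \<phi>"
proof (induction \<phi> arbitrary: v v')
  case (Rel R ts)
  then have "map (eval_trm A fs v) ts = map (eval_trm A fs v') ts"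
    by (auto intro!: eval_trm_cong)
  then show ?case by (metis sat.simps(1))
next
  case (Eql s t)
  then show ?case using eval_trm_cong[of s v v' A fs] eval_trm_cong[of t v v' A fs] by simp
next
  case (Leq s t)
  then show ?case using eval_trm_cong[of s v v' A fs] eval_trm_cong[of t v v' A fs] by simp
next
  case (BIT s t)
  then show ?case using eval_trm_cong[of s v v' A fs] eval_trm_cong[of t v v' A fs] by simp
next
  case (Neg \<phi>)
  then show ?case by (metis fvars.simps(5) sat.simps(5))
next
  case (Conj \<phi>1 \<phi>2)
  then show ?case by (metis UnI1 UnI2 fvars.simps(6) sat.simps(6))
next
  case (Disj \<phi>1 \<phi>2)
  then show ?case by (metis UnI1 UnI2 fvars.simps(7) sat.simps(7))
next
  case (Ex x \<phi>)
  have "sat A fs (v(x := d)) \<phi> = sat A fs (v'(x := d)) \<phi>" for d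
    by (rule Ex.IH) (use Ex.prems in auto)
  then show ?case by simp
next
  case (All x \<phi>)
  have "sat A fs (v(x := d)) \<phi> = sat A fs (v'(x := d)) \<phi>" for d
    by (rule All.IH) (use All.prems in auto)
  then show ?case by simp
qed

section \<open>Capture-avoiding renaming of variables\<close>

fun rename_trm :: "(nat \<Rightarrow> nat) \<Rightarrow> trm \<Rightarrow> trm" where
  "rename_trm \<rho> (Var x) = Var (\<rho> x)"
| "rename_trm \<rho> (Cst j) = Cst j"
| "rename_trm \<rho> MinT = MinT"
| "rename_trm \<rho> (FunVar i ts) = FunVar i (map (rename_trm \<rho>) ts)"

text \<open>The inserted \<open>0\<close> provides for formulas without free variables, where
  \<open>Max\<close> would meet the empty set.\<close>

definition fresh :: "nat set \<Rightarrow> nat" where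
  "fresh X = Suc (Max (insert 0 X))"

lemma fresh_notin: "finite X \<Longrightarrow> fresh X \<notin> X"
  unfolding fresh_def by (metis Max_ge Suc_n_not_le_n finite_insert insertCI)

text \<open>The renaming need not be injective, so each bound variable is replaced by one outside
  the image of the free variables of the body.\<close>

fun rename :: "(nat \<Rightarrow> nat) \<Rightarrow> fml \<Rightarrow> fml" where
  "rename \<rho> (Rel R ts) = Rel R (map (rename_trm \<rho>) ts)"
| "rename \<rho> (Eql s t) = Eql (rename_trm \<rho> s) (rename_trm \<rho> t)"
| "rename \<rho> (Leq s t) = Leq (rename_trm \<rho> s) (rename_trm \<rho> t)"
| "rename \<rho> (BIT s t) = BIT (rename_trm \<rho> s) (rename_trm \<rho> t)"
| "rename \<rho> (Neg \<phi>) = Neg (rename \<rho> \<phi>)"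
| "rename \<rho> (Conj \<phi> \<psi>) = Conj (rename \<rho> \<phi>) (rename \<rho> \<psi>)"
| "rename \<rho> (Disj \<phi> \<psi>) = Disj (rename \<rho> \<phi>) (rename \<rho> \<psi>)"
| "rename \<rho> (Ex x \<phi>) = (let z = fresh (\<rho> ` fvars \<phi>) in Ex z (rename (\<rho>(x := z)) \<phi>))"
| "rename \<rho> (All x \<phi>) = (let z = fresh (\<rho> ` fvars \<phi>) in All z (rename (\<rho>(x := z)) \<phi>))"

lemma eval_rename_trm: "eval_trm A fs v (rename_trm \<rho> t) = eval_trm A fs (\<lambda>i. v (\<rho> i)) t"
proof (induction t)
  case (FunVar i ts)
  then have "map (eval_trm A fs v \<circ> rename_trm \<rho>) ts = map (eval_trm A fs (\<lambda>i. v (\<rho> i))) ts"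
    by auto
  then show ?case by (metis (no_types) eval_trm.simps(4) rename_trm.simps(4) map_map)
qed auto

lemma tvars_rename_trm: "tvars (rename_trm \<rho> t) = \<rho> ` tvars t"
  by (induction t) auto

lemma wf_rename_trm: "wf_trm \<sigma> ars (rename_trm \<rho> t) = wf_trm \<sigma> ars t"
  by (induction t) auto

lemma wf_rename: "wf_fml \<sigma> ars (rename \<rho> \<phi>) = wf_fml \<sigma> ars \<phi>"
  by (induction \<phi> arbitrary: \<rho>) (auto simp: wf_rename_trm Let_def)

lemma fvars_rename: "fvars (rename \<rho> \<phi>) \<subseteq> \<rho> ` fvars \<phi>"
proof (induction \<phi> arbitrary: \<rho>)
  case (Ex x \<phi>)
  define z where "z = fresh (\<rho> ` fvars \<phi>)"
  have "fvars (rename (\<rho>(x := z)) \<phi>) \<subseteq> insert z (\<rho> ` (fvars \<phi> - {x}))"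
    using Ex.IH[of "\<rho>(x := z)"] by fastforce
  then show ?case by (auto simp: Let_def simp flip: z_def)
next
  case (All x \<phi>)
  define z where "z = fresh (\<rho> ` fvars \<phi>)"
  have "fvars (rename (\<rho>(x := z)) \<phi>) \<subseteq> insert z (\<rho> ` (fvars \<phi> - {x}))"
    using All.IH[of "\<rho>(x := z)"] by fastforce
  then show ?case by (auto simp: Let_def simp flip: z_def)
qed (simp_all add: tvars_rename_trm image_Un image_UN; blast)+

lemma sat_rename: "sat A fs v (rename \<rho> \<phi>) = sat A fs (\<lambda>i. v (\<rho> i)) \<phi>"
proof (induction \<phi> arbitrary: v \<rho>)
  case (Rel R ts)
  then show ?case by (simp add: eval_rename_trm comp_def)
next
  case (Ex x \<phi>)
  define z where "z = fresh (\<rho> ` fvars \<phi>)"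
  have z: "z \<notin> \<rho> ` fvars \<phi>" unfolding z_def by (simp add: fresh_notin finite_fvars)
  have "sat A fs (v(z := d)) (rename (\<rho>(x := z)) \<phi>) = sat A fs ((\<lambda>i. v (\<rho> i))(x := d)) \<phi>" for d
    unfolding Ex.IH by (rule sat_cong) (use z in auto)
  then show ?case by (simp add: Let_def flip: z_def)
next
  case (All x \<phi>)
  define z where "z = fresh (\<rho> ` fvars \<phi>)"
  have z: "z \<notin> \<rho> ` fvars \<phi>" unfolding z_def by (simp add: fresh_notin finite_fvars)
  have "sat A fs (v(z := d)) (rename (\<rho>(x := z)) \<phi>) = sat A fs ((\<lambda>i. v (\<rho> i))(x := d)) \<phi>" for d
    unfolding All.IH by (rule sat_cong) (use z in auto)
  then show ?case by (simp add: Let_def flip: z_def)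
qed (auto simp: eval_rename_trm)

text \<open>Definability is stated for predicates, so that the closure rules below replace the
  writing of formulas. All values of the total assignment lie in the universe; free variables are
  not bounded until \<open>fo_formula\<close>.\<close>

definition fo :: "(bool list \<Rightarrow> (nat \<Rightarrow> nat) \<Rightarrow> bool) \<Rightarrow> bool" where
  "fo P \<longleftrightarrow> (\<exists>\<phi>. wf_fml string_vocab [] \<phi> \<and>
     (\<forall>w v. w \<noteq> [] \<and> (\<forall>i. v i < length w) \<longrightarrow> sat (string_struc w) [] v \<phi> = P w v))"

lemma foI:
  assumes "wf_fml string_vocab [] \<phi>"
    "\<And>w v. w \<noteq> [] \<Longrightarrow> (\<And>i. v i < length w) \<Longrightarrow> sat (string_struc w) [] v \<phi> = P w v"
  shows "fo P"
  using assms unfolding fo_def by blast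

lemma foE:
  assumes "fo P"
  obtains \<phi> where "wf_fml string_vocab [] \<phi>"
    "\<And>w v. w \<noteq> [] \<Longrightarrow> (\<And>i. v i < length w) \<Longrightarrow> sat (string_struc w) [] v \<phi> = P w v"
  using assms unfolding fo_def by blast

lemma fo_cong:
  assumes "fo Q" "\<And>w v. w \<noteq> [] \<Longrightarrow> (\<And>i. v i < length w) \<Longrightarrow> P w v \<longleftrightarrow> Q w v"
  shows "fo P"
  using assms(1) by (rule foE) (auto intro!: foI simp: assms(2))

lemma fo_le: "fo (\<lambda>w v. v i \<le> v j)"
  by (rule foI[of "Leq (Var i) (Var j)"]) auto

lemma fo_eq_var: "fo (\<lambda>w v. v i = v j)"
  by (rule foI[of "Eql (Var i) (Var j)"]) auto

lemma fo_bit: "fo (\<lambda>w v. bit (v i) (v j))"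
  by (rule foI[of "BIT (Var j) (Var i)"]) auto

lemma fo_nth: "fo (\<lambda>w v. w ! v i)"
  by (rule foI[of "Rel 0 [Var i]"]) (auto simp: string_vocab_def string_struc_def)

lemma fo_zero: "fo (\<lambda>w v. v i = 0)"
  by (rule foI[of "Eql (Var i) MinT"]) auto

lemma fo_not: "fo P \<Longrightarrow> fo (\<lambda>w v. \<not> P w v)"
  by (erule foE) (rule foI[of "Neg \<phi>" for \<phi>], auto)

lemma fo_conj:
  assumes "fo P" "fo Q" shows "fo (\<lambda>w v. P w v \<and> Q w v)"
proof -
  obtain \<phi> where \<phi>: "wf_fml string_vocab [] \<phi>"
    "\<And>w v. w \<noteq> [] \<Longrightarrow> (\<And>i. v i < length w) \<Longrightarrow> sat (string_struc w) [] v \<phi> = P w v"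
    using assms(1) unfolding fo_def by blast
  obtain \<psi> where \<psi>: "wf_fml string_vocab [] \<psi>"
    "\<And>w v. w \<noteq> [] \<Longrightarrow> (\<And>i. v i < length w) \<Longrightarrow> sat (string_struc w) [] v \<psi> = Q w v"
    using assms(2) unfolding fo_def by blast
  show ?thesis by (rule foI[of "Conj \<phi> \<psi>"]) (auto simp: \<phi> \<psi>)
qed

lemma fo_disj:
  assumes "fo P" "fo Q" shows "fo (\<lambda>w v. P w v \<or> Q w v)"
proof -
  have "fo (\<lambda>w v. \<not> (\<not> P w v \<and> \<not> Q w v))" by (intro fo_not fo_conj assms)
  then show ?thesis by (rule fo_cong) auto
qed

lemma fo_imp:
  assumes "fo P" "fo Q" shows "fo (\<lambda>w v. P w v \<longrightarrow> Q w v)"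
proof -
  have "fo (\<lambda>w v. \<not> P w v \<or> Q w v)" by (intro fo_not fo_disj assms)
  then show ?thesis by (rule fo_cong) auto
qed

lemma fo_iff:
  assumes "fo P" "fo Q" shows "fo (\<lambda>w v. P w v \<longleftrightarrow> Q w v)"
proof -
  have "fo (\<lambda>w v. (P w v \<longrightarrow> Q w v) \<and> (Q w v \<longrightarrow> P w v))" by (intro fo_imp fo_conj assms)
  then show ?thesis by (rule fo_cong) auto
qed

lemma fo_const: "fo (\<lambda>w v. c)"
proof (cases c)
  case True
  then show ?thesis by (intro foI[of "Eql MinT MinT"]) auto
next
  case False
  then show ?thesis by (intro foI[of "Neg (Eql MinT MinT)"]) auto
qed

lemma fo_subst:
  assumes "fo P" shows "fo (\<lambda>w v. P w (\<lambda>i. v (\<rho> i)))"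
proof -
  obtain \<phi> where "wf_fml string_vocab [] \<phi>"
    "\<And>w v. w \<noteq> [] \<Longrightarrow> (\<And>i. v i < length w) \<Longrightarrow> sat (string_struc w) [] v \<phi> = P w v"
    using assms unfolding fo_def by blast
  then show ?thesis by (intro foI[of "rename \<rho> \<phi>"]) (auto simp: wf_rename sat_rename)
qed

text \<open>
  Quantifiers are handled in de Bruijn style: the bound variable becomes variable \<open>0\<close> and all
  others are shifted, so that the following rule applies by plain higher-order matching.
\<close>

lemma fo_ex:
  assumes "fo (\<lambda>w v. P w (\<lambda>i. v (Suc i)) (v 0))"
  shows "fo (\<lambda>w v. \<exists>d<length w. P w v d)"
proof -
  obtain \<phi> where \<phi>: "wf_fml string_vocab [] \<phi>"
    "\<And>w v. w \<noteq> [] \<Longrightarrow> (\<And>i. v i < length w) \<Longrightarrow>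
       sat (string_struc w) [] v \<phi> = P w (\<lambda>i. v (Suc i)) (v 0)"
    using assms unfolding fo_def by blast
  define z where "z = fresh (fvars \<phi>)"
  define \<rho> where "\<rho> = case_nat z id"
  \<comment> \<open>\<open>\<rho>\<close> sends \<open>0\<close> to \<open>z\<close> and
    \<open>Suc i\<close> to \<open>i\<close>. The variable \<open>Suc z\<close> would also be sent
    to \<open>z\<close> and read the quantified value, so it must not occur.\<close>
  have z: "Suc z \<notin> fvars \<phi>"
    unfolding z_def fresh_def
    by (metis Max_ge Suc_n_not_le_n finite_fvars finite_insert insertCI le_SucI)
  show ?thesis
  proof (rule foI[of "Ex z (rename \<rho> \<phi>)"])
    fix w :: "bool list" and v :: "nat \<Rightarrow> nat"
    assume w: "w \<noteq> []" and v: "\<And>i. v i < length w"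
    have "sat (string_struc w) [] (v(z := d)) (rename \<rho> \<phi>) = P w v d" if d: "d < length w" for d
    proof -
      have "sat (string_struc w) [] (v(z := d)) (rename \<rho> \<phi>) =
            sat (string_struc w) [] (case_nat d v) \<phi>"
        unfolding sat_rename by (rule sat_cong) (use z in \<open>auto simp: \<rho>_def split: nat.split\<close>)
      also have "\<dots> = P w v d"
        using \<phi>(2)[of w "case_nat d v"] w v d by (simp split: nat.split)
      finally show ?thesis .
    qed
    then show "sat (string_struc w) [] v (Ex z (rename \<rho> \<phi>)) = (\<exists>d<length w. P w v d)"
      by (auto simp: string_struc_def)
  qed (simp add: wf_rename \<phi>)
qed

lemma fo_all:
  assumes "fo (\<lambda>w v. P w (\<lambda>i. v (Suc i)) (v 0))"
  shows "fo (\<lambda>w v. \<forall>d<length w. P w v d)"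
proof -
  have "fo (\<lambda>w v. \<not> (\<exists>d<length w. \<not> P w v d))" by (intro fo_not fo_ex assms)
  then show ?thesis by (rule fo_cong) auto
qed

lemma fo_less: "fo (\<lambda>w v. v i < v j)"
proof -
  have "fo (\<lambda>w v. \<not> v j \<le> v i)" by (intro fo_not fo_le)
  then show ?thesis by (rule fo_cong) auto
qed

lemma fo_finite_ex:
  assumes "\<And>a. a < (N::nat) \<Longrightarrow> fo (P a)"
  shows "fo (\<lambda>w v. \<exists>a<N. P a w v)"
  using assms
proof (induction N)
  case 0
  show ?case by (rule fo_cong[OF fo_const[of False]]) auto
next
  case (Suc N)
  then have "fo (\<lambda>w v. (\<exists>a<N. P a w v) \<or> P N w v)" by (intro fo_disj) auto
  then show ?case by (rule fo_cong) (auto simp: less_Suc_eq)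
qed

lemma fo_finite_all:
  assumes "\<And>a. a < (N::nat) \<Longrightarrow> fo (P a)"
  shows "fo (\<lambda>w v. \<forall>a<N. P a w v)"
proof -
  have "fo (\<lambda>w v. \<not> (\<exists>a<N. \<not> P a w v))" by (intro fo_not fo_finite_ex assms)
  then show ?thesis by (rule fo_cong) auto
qed

lemma fo_Ball:
  assumes "finite X" "\<And>a. a \<in> X \<Longrightarrow> fo (P a)"
  shows "fo (\<lambda>w v. \<forall>a\<in>X. P a w v)"
  using assms
proof (induction X)
  case empty
  show ?case by (rule fo_cong[OF fo_const[of True]]) auto
next
  case (insert x X)
  then have "fo (\<lambda>w v. P x w v \<and> (\<forall>a\<in>X. P a w v))" by (intro fo_conj) auto
  then show ?case by (rule fo_cong) auto
qed

lemma fo_Bex: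
  fixes X :: "'a set"
  assumes "finite X" "\<And>a. a \<in> X \<Longrightarrow> fo (P a)"
  shows "fo (\<lambda>w v. \<exists>a\<in>X. P a w v)"
proof -
  have "fo (\<lambda>w v. \<not> (\<forall>a\<in>X. \<not> P a w v))"
    by (intro fo_not fo_Ball assms)
  then show ?thesis by (rule fo_cong) auto
qed

lemmas fo_intros = fo_ex fo_all fo_conj fo_disj fo_imp fo_iff fo_not
  fo_le fo_less fo_eq_var fo_bit fo_nth fo_zero fo_const

text \<open>The way back from definability to syntax. The formula obtained for \<open>P\<close> may
  mention variables from \<open>D\<close> on; since \<open>P\<close> does not depend on them, all
  can be renamed to variable \<open>0\<close>.\<close>

lemma fo_formula:
  assumes "fo P" "D > 0"
    and local: "\<And>w v v'. (\<And>i. i < D \<Longrightarrow> v i = v' i) \<Longrightarrow> P w v = P w v'"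
  obtains \<phi> where "wf_fml string_vocab [] \<phi>" "fvars \<phi> \<subseteq> {..<D}"
    "\<And>w x. w \<noteq> [] \<Longrightarrow> x \<in> tuples (length w) D \<Longrightarrow>
       sat (string_struc w) [] ((!) x) \<phi> = P w ((!) x)"
proof -
  obtain \<phi> where \<phi>: "wf_fml string_vocab [] \<phi>"
    "\<And>w v. w \<noteq> [] \<Longrightarrow> (\<And>i. v i < length w) \<Longrightarrow> sat (string_struc w) [] v \<phi> = P w v"
    using assms(1) unfolding fo_def by blast
  define \<rho> where "\<rho> = (\<lambda>i. if i < D then i else 0)"
  show ?thesis
  proof (rule that[of "rename \<rho> \<phi>"])
    show "wf_fml string_vocab [] (rename \<rho> \<phi>)" by (simp add: wf_rename \<phi>)
    show "fvars (rename \<rho> \<phi>) \<subseteq> {..<D}"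
    proof -
      have "\<rho> i < D" for i using \<open>D > 0\<close> by (simp add: \<rho>_def)
      then show ?thesis using fvars_rename[of \<rho> \<phi>] by blast
    qed
    fix w :: "bool list" and x assume "w \<noteq> []" and x: "x \<in> tuples (length w) D"
    then have "x ! \<rho> i < length w" for i
      using \<open>D > 0\<close> nth_mem[of "\<rho> i" x] unfolding tuples_def \<rho>_def by fastforce
    then have "sat (string_struc w) [] (\<lambda>i. x ! \<rho> i) \<phi> = P w (\<lambda>i. x ! \<rho> i)"
      by (intro \<phi>(2) \<open>w \<noteq> []\<close>)
    also have "\<dots> = P w ((!) x)" by (rule local) (auto simp: \<rho>_def)
    finally show "sat (string_struc w) [] ((!) x) (rename \<rho> \<phi>) = P w ((!) x)"
      by (simp add: sat_rename)
  qed
qed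

section \<open>Addition is definable from order and BIT\<close>

lemma fo_Suc: "fo (\<lambda>w v. v j = Suc (v i))"
proof -
  have "fo (\<lambda>w v. v i < v j \<and> (\<forall>d<length w. d \<le> v i \<or> v j \<le> d))"
    by (intro fo_intros)
  then show ?thesis
  proof (rule fo_cong)
    fix w :: "bool list" and v :: "nat \<Rightarrow> nat"
    assume v: "\<And>i. v i < length w"
    show "v j = Suc (v i) \<longleftrightarrow> v i < v j \<and> (\<forall>d<length w. d \<le> v i \<or> v j \<le> d)"
    proof
      assume "v i < v j \<and> (\<forall>d<length w. d \<le> v i \<or> v j \<le> d)"
      moreover from this have "Suc (v i) < length w" using v[of j] by linarith
      ultimately show "v j = Suc (v i)" by (meson Suc_leI le_antisym not_less_eq_eq order_refl)
    qed auto
  qed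
qed

lemma fo_eq_const: "fo (\<lambda>w v. v i = (k::nat))"
proof (induction k arbitrary: i)
  case 0
  show ?case by (rule fo_zero)
next
  case (Suc k)
  have "fo (\<lambda>w v. \<exists>d<length w. d = k \<and> v i = Suc d)"
    by (intro fo_intros Suc fo_Suc)
  then show ?case
  proof (rule fo_cong)
    fix w :: "bool list" and v :: "nat \<Rightarrow> nat"
    assume v: "\<And>i. v i < length w"
    show "v i = Suc k \<longleftrightarrow> (\<exists>d<length w. d = k \<and> v i = Suc d)" using v[of i] by auto
  qed
qed

text \<open>The carry into position \<open>i\<close> in look-ahead form: generated at
  \<open>j\<close> and propagated through all positions in between. Unlike the recursion
  \<open>carry_Suc\<close>, this is first-order.\<close>

definition carry :: "nat \<Rightarrow> nat \<Rightarrow> nat \<Rightarrow> bool" where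
  "carry x y i \<longleftrightarrow> (\<exists>j<i. bit x j \<and> bit y j \<and> (\<forall>k<i. j < k \<longrightarrow> bit x k \<or> bit y k))"

lemma carry_Suc: "carry x y (Suc i) \<longleftrightarrow> bit x i \<and> bit y i \<or> (bit x i \<or> bit y i) \<and> carry x y i"
  unfolding carry_def by (auto simp: less_Suc_eq)

lemma mod_Suc_power: "(x::nat) mod 2 ^ Suc i = x mod 2 ^ i + (if bit x i then 2 ^ i else 0)"
proof -
  have "x mod (2 ^ i * 2) = 2 ^ i * (x div 2 ^ i mod 2) + x mod 2 ^ i"
    by (rule mod_mult2_eq)
  then show ?thesis by (auto simp: bit_iff_odd mult.commute odd_iff_mod_2_eq_one)
qed

lemma add_mod_power_less: "x mod 2 ^ i + y mod 2 ^ i < 2 * (2 ^ i :: nat)"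
proof -
  have "x mod 2 ^ i < 2 ^ i" "y mod 2 ^ i < (2 ^ i :: nat)" by simp_all
  then show ?thesis by linarith
qed

text \<open>By induction: the generate-or-propagate recursion \<open>carry_Suc\<close> matches
  splitting off the top bit of each remainder.\<close>

lemma carry_iff: "carry x y i \<longleftrightarrow> x mod 2 ^ i + y mod 2 ^ i \<ge> 2 ^ i"
proof (induction i)
  case 0
  show ?case by (simp add: carry_def)
next
  case (Suc i)
  show ?case unfolding carry_Suc Suc mod_Suc_power
    using add_mod_power_less[of x i y]
    by (cases "bit x i"; cases "bit y i") simp_all
qed

text \<open>Division by \<open>2 ^ i\<close> turns the sum into the two quotients plus the overflow
  of the remainders, which is \<open>0\<close> or \<open>1\<close>; the bit is the parity of
  this.\<close>

lemma bit_add_iff: "bit (x + y :: nat) i \<longleftrightarrow> ((bit x i \<longleftrightarrow> bit y i) \<longleftrightarrow> carry x y i)"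
proof -
  have "(x + y) div 2 ^ i = x div 2 ^ i + y div 2 ^ i + (x mod 2 ^ i + y mod 2 ^ i) div 2 ^ i"
    by (rule div_add1_eq)
  also have "(x mod 2 ^ i + y mod 2 ^ i) div 2 ^ i = of_bool (carry x y i)"
  proof (cases "carry x y i")
    case True
    then show ?thesis using add_mod_power_less[of x i y] unfolding carry_iff
      by (subst div_nat_eqI[of _ 1]) simp_all
  next
    case False
    then show ?thesis unfolding carry_iff by simp
  qed
  finally show ?thesis by (auto simp: bit_iff_odd)
qed

lemma nat_bit_imp_less: "bit (x::nat) i \<Longrightarrow> i < x"
  by (metis bit_iff_odd div_less even_zero less_exp less_trans not_less_iff_gr_or_eq)

lemma nat_bit_eqI_bounded:
  assumes "x < 2 ^ N" "y < 2 ^ N" "\<And>i. i < N \<Longrightarrow> bit (x::nat) i = bit y i"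
  shows "x = y"
proof (rule bit_eqI)
  fix i
  show "bit x i = bit y i"
  proof (cases "i < N")
    case False
    then have "(2::nat) ^ N \<le> 2 ^ i" by simp
    then have "x < 2 ^ i" "y < 2 ^ i" using assms(1,2) by linarith+
    then show ?thesis by (simp add: bit_iff_odd)
  qed (rule assms)
qed

lemma fo_add_var: "fo (\<lambda>w v. v i + v j = v k)"
proof -
  have "fo (\<lambda>w v. \<forall>d<length w. bit (v k) d \<longleftrightarrow> ((bit (v i) d \<longleftrightarrow> bit (v j) d) \<longleftrightarrow>
          (\<exists>e<length w. e < d \<and> bit (v i) e \<and> bit (v j) e \<and>
            (\<forall>c<length w. c < d \<longrightarrow> e < c \<longrightarrow> bit (v i) c \<or> bit (v j) c))))"
    by (intro fo_intros)
  then show ?thesis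
  proof (rule fo_cong)
    fix w :: "bool list" and v :: "nat \<Rightarrow> nat"
    assume v: "\<And>i. v i < length w"
    have carry: "(\<exists>e<length w. e < d \<and> bit (v i) e \<and> bit (v j) e \<and>
            (\<forall>c<length w. c < d \<longrightarrow> e < c \<longrightarrow> bit (v i) c \<or> bit (v j) c)) = carry (v i) (v j) d"
      if "d < length w" for d
      using that unfolding carry_def by (meson less_trans)
    \<comment> \<open>A sum of two elements is below \<open>2 * length w\<close>. By this bound it
      has no one-bits at positions outside the universe, so comparing the bits at
      \<open>d < length w\<close> suffices.\<close>
    have "2 * n \<le> 2 ^ n" if "n \<ge> 1" for n :: nat
      using that by (induction n rule: nat_induct_at_least) auto
    from this[of "length w"] have "2 * length w \<le> 2 ^ length w"
      using v[of i] by linarith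
    then have bounds: "v i + v j < 2 ^ length w" "v k < 2 ^ length w"
      using v[of i] v[of j] v[of k] by linarith+
    show "v i + v j = v k \<longleftrightarrow> (\<forall>d<length w. bit (v k) d \<longleftrightarrow> ((bit (v i) d \<longleftrightarrow> bit (v j) d) \<longleftrightarrow>
          (\<exists>e<length w. e < d \<and> bit (v i) e \<and> bit (v j) e \<and>
            (\<forall>c<length w. c < d \<longrightarrow> e < c \<longrightarrow> bit (v i) c \<or> bit (v j) c))))"
      (is "_ \<longleftrightarrow> ?R")
    proof -
      have "?R \<longleftrightarrow> (\<forall>d<length w. bit (v i + v j) d = bit (v k) d)"
        by (auto simp: carry bit_add_iff)
      then show ?thesis using nat_bit_eqI_bounded[OF bounds] by auto
    qed
  qed
qed

section \<open>Multiplication is definable from order and BIT\<close>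

lemma ex_nat_with_bits: "\<exists>x::nat. x < 2 ^ L \<and> (\<forall>i. bit x i \<longleftrightarrow> i < L \<and> P i)"
proof (induction L)
  case (Suc L)
  then obtain x :: nat where x: "x < 2 ^ L" "\<And>i. bit x i \<longleftrightarrow> i < L \<and> P i" by blast
  define y where "y = (if P L then set_bit L x else x)"
  have y: "bit y i \<longleftrightarrow> i < Suc L \<and> P i" for i
    by (auto simp: y_def x bit_set_bit_iff less_Suc_eq)
  have "take_bit (Suc L) y = y"
    by (rule bit_eqI) (simp add: bit_take_bit_iff y)
  then have "y < 2 ^ Suc L" using take_bit_nat_less_exp[of "Suc L" y] by simp
  then show ?case using y by (intro exI[of _ y]) simp
qed simp

definition field :: "nat \<Rightarrow> nat \<Rightarrow> nat \<Rightarrow> nat" where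
  "field q A p = take_bit q (drop_bit p A)"

lemma bit_field: "bit (field q A p) i \<longleftrightarrow> i < q \<and> bit A (p + i)"
  by (simp add: field_def bit_take_bit_iff bit_drop_bit_eq)

lemma field_le: "field q A p \<le> A"
  unfolding field_def
  by (metis div_le_dividend drop_bit_eq_div order_trans take_bit_nat_less_eq_self)

lemma fo_field: "fo (\<lambda>w v. v a = field (v q) (v A) (v p))"
proof -
  have "fo (\<lambda>w v. \<forall>i<length w. bit (v a) i \<longleftrightarrow> i < v q \<and> (\<exists>k<length w. v p + i = k \<and> bit (v A) k))"
    by (intro fo_intros fo_add_var)
  then show ?thesis
  proof (rule fo_cong)
    fix w :: "bool list" and v :: "nat \<Rightarrow> nat"
    assume v: "\<And>i. v i < length w"
    \<comment> \<open>When \<open>v p + i\<close> leaves the universe, \<open>v A\<close> has no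
      one-bit there, so bounding \<open>k\<close> loses nothing.\<close>
    have A: "k < length w" if "bit (v A) k" for k
      using nat_bit_imp_less[OF that] v[of A] by linarith
    have *: "i < length w" if "bit (v a) i" for i
      using nat_bit_imp_less[OF that] v[of a] by linarith
    show "v a = field (v q) (v A) (v p) \<longleftrightarrow>
      (\<forall>i<length w. bit (v a) i \<longleftrightarrow> i < v q \<and> (\<exists>k<length w. v p + i = k \<and> bit (v A) k))"
    proof
      assume "v a = field (v q) (v A) (v p)"
      then show "\<forall>i<length w. bit (v a) i \<longleftrightarrow> i < v q \<and> (\<exists>k<length w. v p + i = k \<and> bit (v A) k)"
        using A by (auto simp: bit_field)
    next
      assume R: "\<forall>i<length w. bit (v a) i \<longleftrightarrow> i < v q \<and> (\<exists>k<length w. v p + i = k \<and> bit (v A) k)"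
      show "v a = field (v q) (v A) (v p)"
      proof (rule bit_eqI)
        fix i
        show "bit (v a) i = bit (field (v q) (v A) (v p)) i"
          using R A[of "v p + i"] *[of i] by (cases "i < length w") (auto simp: bit_field)
      qed
    qed
  qed
qed

text \<open>
  A number below \<open>n\<close> codes a set of about \<open>log n\<close> positions. A sequence of pairs of very small
  numbers is stored in the fields of \<open>A\<close> and \<open>B\<close> that start at the positions marked in \<open>M\<close>;
  in this way, existential quantification over short sequences becomes first-order.
\<close>

definition chain ::
  "nat \<Rightarrow> (nat \<Rightarrow> nat \<Rightarrow> nat \<Rightarrow> nat \<Rightarrow> bool) \<Rightarrow> nat \<Rightarrow> nat \<Rightarrow> nat \<Rightarrow> nat \<Rightarrow> bool" where
  "chain n R t s t' s' \<longleftrightarrow> (\<exists>q<n. \<exists>M<n. \<exists>A<n. \<exists>B<n.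
     (\<exists>z<n. z = 0 \<and> bit M z \<and> t = field q A z \<and> s = field q B z) \<and>
     (\<exists>p<n. bit M p \<and> t' = field q A p \<and> s' = field q B p) \<and>
     (\<forall>p<n. \<forall>p'<n. bit M p \<and> bit M p' \<and> p < p' \<and> (\<forall>r<n. p < r \<and> r < p' \<longrightarrow> \<not> bit M r) \<longrightarrow>
       (\<exists>a<n. \<exists>b<n. \<exists>c<n. \<exists>d<n. a = field q A p \<and> b = field q B p \<and>
          c = field q A p' \<and> d = field q B p' \<and> R a b c d)))"

lemma fo_chain:
  assumes "\<And>\<rho> a b c d. fo (\<lambda>w v. R w (\<lambda>i. v (\<rho> i)) (v a) (v b) (v c) (v d))"
  shows "fo (\<lambda>w v. chain (length w) (R w v) (v a) (v b) (v c) (v d))"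
  unfolding chain_def by (intro fo_intros fo_field assms)

text \<open>Codes with any spacing of the marks are acceptable: a marked position other than
  \<open>0\<close> is reached by one step from the greatest mark below it, which exists because
  \<open>0\<close> is marked.\<close>

lemma chain_sound:
  assumes "chain n R t s t' s'"
  shows "(\<lambda>(a, b) (c, d). R a b c d)\<^sup>*\<^sup>* (t, s) (t', s')"
proof -
  let ?S = "\<lambda>(a, b) (c, d). R a b c d"
  obtain q M A B p where M: "M < n" "A < n" "B < n" "bit M 0"
    and ts: "t = field q A 0" "s = field q B 0"
    and p: "bit M p" "t' = field q A p" "s' = field q B p"
    and step: "\<And>p p'. \<lbrakk>p < n; p' < n; bit M p; bit M p'; p < p'; \<And>r. r < n \<Longrightarrow> p < r \<Longrightarrow> r < p' \<Longrightarrow> \<not> bit M r\<rbrakk>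
      \<Longrightarrow> R (field q A p) (field q B p) (field q A p') (field q B p')"
    using assms unfolding chain_def by metis
  have "?S\<^sup>*\<^sup>* (t, s) (field q A p, field q B p)" if "bit M p" for p
    using that
  proof (induction p rule: less_induct)
    case (less p)
    show ?case
    proof (cases "p = 0")
      case False
      define r where "r = Max {r. r < p \<and> bit M r}"
      have fin: "finite {r. r < p \<and> bit M r}" by simp
      have "r \<in> {r. r < p \<and> bit M r}"
        unfolding r_def by (rule Max_in[OF fin]) (use False M in auto)
      moreover have "\<not> bit M k" if "r < k" "k < p" for k
        using that Max_ge[OF fin, of k] unfolding r_def by (auto simp: not_le[symmetric])
      moreover have "p < n" using nat_bit_imp_less[OF less.prems] M by simp
      ultimately have "R (field q A r) (field q B r) (field q A p) (field q B p)"
        by (intro step) (use less.prems in auto)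
      moreover have "?S\<^sup>*\<^sup>* (t, s) (field q A r, field q B r)"
        using less.IH \<open>r \<in> _\<close> by simp
      ultimately show ?thesis by (auto intro: rtranclp.rtrancl_into_rtrancl)
    qed (simp add: ts)
  qed
  then show ?thesis using p by simp
qed

text \<open>The marks are the multiples of \<open>q\<close> up to \<open>k * q\<close>, so the codes
  take \<open>(k + 1) * q\<close> bits, which must fit into the \<open>L\<close> bits available
  below \<open>n\<close>.\<close>

lemma chain_complete:
  assumes step: "\<And>i. i < k \<Longrightarrow> R (\<tau> i) (\<nu> i) (\<tau> (Suc i)) (\<nu> (Suc i))"
    and small: "\<And>i. i \<le> k \<Longrightarrow> \<tau> i < 2 ^ q \<and> \<nu> i < 2 ^ q"
    and q: "q \<ge> 1" "(k + 1) * q \<le> L" "2 ^ L \<le> n"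
  shows "chain n R (\<tau> 0) (\<nu> 0) (\<tau> k) (\<nu> k)"
proof -
  let ?N = "(k + 1) * q"
  have N: "2 ^ ?N \<le> n" using q by (meson le_trans one_le_numeral power_increasing)
  have below_n: "x < n" if "x < 2 ^ ?N" for x using N that by linarith
  \<comment> \<open>One number stores all \<open>k + 1\<close> values: its bit \<open>i\<close> is
    bit \<open>i mod q\<close> of the value with index \<open>i div q\<close>.\<close>
  have field: "\<exists>A<n. \<forall>j\<le>k. field q A (j * q) = f j"
    if f: "\<And>j. j \<le> k \<Longrightarrow> f j < 2 ^ q" for f :: "nat \<Rightarrow> nat"
  proof -
    obtain A :: nat where A: "A < 2 ^ ?N" "\<And>i. bit A i \<longleftrightarrow> i < ?N \<and> bit (f (i div q)) (i mod q)"
      using ex_nat_with_bits[of ?N "\<lambda>i. bit (f (i div q)) (i mod q)"] by blast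
    have "field q A (j * q) = f j" if j: "j \<le> k" for j
    proof (rule bit_eqI)
      fix i
      have "take_bit q (f j) = f j" using f[OF j] by (simp add: take_bit_nat_eq_self)
      then have *: "bit (f j) i \<Longrightarrow> i < q" by (metis bit_take_bit_iff)
      have "j * q + i < ?N" if "i < q"
      proof -
        have "j * q + i < (j + 1) * q" using that by simp
        also have "\<dots> \<le> ?N" using j by (intro mult_le_mono1) simp
        finally show ?thesis .
      qed
      then show "bit (field q A (j * q)) i = bit (f j) i"
        using * by (auto simp: bit_field A)
    qed
    then show ?thesis using A(1) below_n by blast
  qed
  obtain M :: nat where M: "M < 2 ^ ?N" "\<And>i. bit M i \<longleftrightarrow> i < ?N \<and> q dvd i"
    using ex_nat_with_bits[of ?N "\<lambda>i. q dvd i"] by blast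
  obtain A where A: "A < n" "\<And>j. j \<le> k \<Longrightarrow> field q A (j * q) = \<tau> j"
    using field[of \<tau>] small by auto
  obtain B where B: "B < n" "\<And>j. j \<le> k \<Longrightarrow> field q B (j * q) = \<nu> j"
    using field[of \<nu>] small by auto
  have "q < 2 ^ ?N"
    by (rule le_less_trans[OF _ less_exp]) simp
  then have qn: "q < n" by (rule below_n)
  have "0 < n" using qn by simp
  have mark: "bit M (j * q) \<longleftrightarrow> j \<le> k" for j using q(1) 
    using mult_less_cancel2[of j q "k + 1"] by (auto simp: M simp del: mult_less_cancel2)
  have "k * q < n" using nat_bit_imp_less[of M "k * q"] mark M(1) below_n by force
  have first: "\<exists>z<n. z = 0 \<and> bit M z \<and> \<tau> 0 = field q A z \<and> \<nu> 0 = field q B z"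
    using A(2)[of 0] B(2)[of 0] mark[of 0] \<open>0 < n\<close> by auto
  have last: "\<exists>p<n. bit M p \<and> \<tau> k = field q A p \<and> \<nu> k = field q B p"
    using A(2)[of k] B(2)[of k] mark[of k] \<open>k * q < n\<close> by auto
  have consecutive: "\<exists>a<n. \<exists>b<n. \<exists>c<n. \<exists>d<n. a = field q A p \<and> b = field q B p \<and>
      c = field q A p' \<and> d = field q B p' \<and> R a b c d"
    if p: "p < n" "p' < n"
      and pp: "bit M p \<and> bit M p' \<and> p < p' \<and> (\<forall>r<n. p < r \<and> r < p' \<longrightarrow> \<not> bit M r)" for p p'
  proof -
    obtain j j' where j: "p = j * q" "p' = j' * q"
      using pp M(2) by (metis dvd_div_mult_self)
    have jk: "j \<le> k" "j' \<le> k" "j < j'" using pp mark j by auto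
    have "j' = Suc j"
    proof (rule ccontr)
      assume "j' \<noteq> Suc j"
      then have "Suc j < j'" using jk by simp
      then have "Suc j * q < p'" "p < Suc j * q"
        unfolding j using q(1) by (simp_all only: mult_less_cancel2) auto
      moreover have "bit M (Suc j * q)" using mark[of "Suc j"] jk by simp
      ultimately show False using pp p by (meson less_trans)
    qed
    then have "R (field q A p) (field q B p) (field q A p') (field q B p')"
      using step[of j] jk A(2) B(2) j by (simp del: mult_Suc)
    moreover have "field q A r < n" "field q B r < n" for r
      using field_le[of q A r] field_le[of q B r] A(1) B(1) by auto
    ultimately show ?thesis by blast
  qed
  show ?thesis
    unfolding chain_def
    by (rule exI[of _ q], rule conjI[OF qn], rule exI[of _ M], rule conjI[OF below_n[OF M(1)]],
        rule exI[of _ A], rule conjI[OF A(1)], rule exI[of _ B], rule conjI[OF B(1)],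
        rule conjI[OF first], rule conjI[OF last], intro allI impI, rule consecutive)
qed

text \<open>The pairs hold the step number and the state; the step number makes the total number of
  basic steps exactly \<open>T\<close>. The quantified \<open>z\<close> stands for the constant
  \<open>0\<close>, because \<open>fo_chain\<close> takes variables only.\<close>

definition iterate :: "nat \<Rightarrow> (nat \<Rightarrow> nat \<Rightarrow> nat \<Rightarrow> bool) \<Rightarrow> nat \<Rightarrow> nat \<Rightarrow> bool" where
  "iterate n \<delta> T c \<longleftrightarrow>
     (\<exists>z<n. z = 0 \<and> chain n (chain n (\<lambda>t s t' s'. t' = Suc t \<and> \<delta> t s s')) z z T c)"

lemma fo_iterate:
  assumes "\<And>\<rho> a b c. fo (\<lambda>w v. \<delta> w (\<lambda>i. v (\<rho> i)) (v a) (v b) (v c))"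
  shows "fo (\<lambda>w v. iterate (length w) (\<delta> w v) (v a) (v b))"
  unfolding iterate_def by (intro fo_intros fo_chain fo_Suc assms)

text \<open>A step of the outer chain lies in the reflexive transitive closure of the basic step,
  and this closure is idempotent, so nesting reaches nothing new.\<close>

lemma iterate_sound:
  assumes "iterate n \<delta> T c"
  obtains \<sigma> where "\<sigma> 0 = 0" "\<sigma> T = c" "\<And>t. t < T \<Longrightarrow> \<delta> t (\<sigma> t) (\<sigma> (Suc t))"
proof -
  let ?R = "\<lambda>t s t' s'. t' = Suc t \<and> \<delta> t s s'"
  let ?S = "\<lambda>(a, b) (c, d). ?R a b c d"
  have "(\<lambda>(a, b) (c, d). chain n ?R a b c d)\<^sup>*\<^sup>* (0, 0) (T, c)"
    using assms chain_sound unfolding iterate_def by blast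
  moreover have "(\<lambda>(a, b) (c, d). chain n ?R a b c d) \<le> ?S\<^sup>*\<^sup>*"
    using chain_sound by fastforce
  ultimately have "?S\<^sup>*\<^sup>* (0, 0) (T, c)"
    by (metis (no_types, lifting) rtranclp_idemp rtranclp_mono rev_predicate2D)
  then have "\<exists>\<sigma>. \<sigma> 0 = 0 \<and> \<sigma> T = c \<and> (\<forall>t<T. \<delta> t (\<sigma> t) (\<sigma> (Suc t)))"
  proof (induction rule: rtranclp_induct2)
    case refl
    show ?case by (rule exI[of _ "\<lambda>_. 0"]) simp
  next
    case (step t s t' s')
    then obtain \<sigma> where "\<sigma> 0 = 0" "\<sigma> t = s" "\<forall>u<t. \<delta> u (\<sigma> u) (\<sigma> (Suc u))" by blast
    with step(2) show ?case
      by (intro exI[of _ "\<sigma>(t' := s')"]) (auto simp: less_Suc_eq)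
  qed
  then show ?thesis using that by blast
qed

text \<open>The \<open>T\<close> steps are cut into \<open>K\<close> blocks of at most
  \<open>K\<close> steps. Each block is an inner chain, and the outer chain visits the block
  boundaries.\<close>

lemma iterate_complete:
  assumes "\<sigma> 0 = 0" and step: "\<And>t. t < T \<Longrightarrow> \<delta> t (\<sigma> t) (\<sigma> (Suc t))"
    and small: "T < 2 ^ q" "\<And>t. t \<le> T \<Longrightarrow> \<sigma> t < 2 ^ q"
    and q: "q \<ge> 1" "(K + 1) * q \<le> L" "2 ^ L \<le> n" "T \<le> K * K"
  shows "iterate n \<delta> T (\<sigma> T)"
proof -
  let ?R = "\<lambda>t s t' s'. t' = Suc t \<and> \<delta> t s s'"
  have short: "chain n ?R a (\<sigma> a) b (\<sigma> b)" if "a \<le> b" "b \<le> T" "b - a \<le> K" for a b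
  proof -
    have "(b - a + 1) * q \<le> (K + 1) * q" using that by (intro mult_le_mono1) simp
    then have "(b - a + 1) * q \<le> L" using q by linarith
    then have "chain n ?R (a + 0) (\<sigma> (a + 0)) (a + (b - a)) (\<sigma> (a + (b - a)))"
      using that small q step
      by (intro chain_complete[where \<tau> = "\<lambda>i. a + i" and \<nu> = "\<lambda>i. \<sigma> (a + i)" and q = q and L = L])
        (auto intro: le_less_trans)
    then show ?thesis using that by simp
  qed
  \<comment> \<open>Block boundaries, capped at \<open>T\<close>: the last blocks may be shorter or
    empty.\<close>
  define \<tau> where "\<tau> = (\<lambda>i. min (i * K) T)"
  have "chain n (chain n ?R) (\<tau> 0) (\<sigma> (\<tau> 0)) (\<tau> K) (\<sigma> (\<tau> K))"
  proof (rule chain_complete)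
    fix i assume "i < K"
    show "chain n ?R (\<tau> i) (\<sigma> (\<tau> i)) (\<tau> (Suc i)) (\<sigma> (\<tau> (Suc i)))"
      by (rule short) (auto simp: \<tau>_def)
  next
    fix i
    show "\<tau> i < 2 ^ q \<and> \<sigma> (\<tau> i) < 2 ^ q"
      using small by (auto simp: \<tau>_def min_def)
  qed (rule q)+
  moreover have "\<tau> 0 = 0" "\<tau> K = T" using q by (auto simp: \<tau>_def)
  moreover have "0 < n" using q(3) by (meson less_le_trans zero_less_numeral zero_less_power)
  ultimately show ?thesis unfolding iterate_def using assms(1) by auto
qed

section \<open>Columns and carries of schoolbook multiplication\<close>

definition column :: "nat \<Rightarrow> nat \<Rightarrow> nat \<Rightarrow> nat" where
  "column x y j = (\<Sum>t\<le>j. of_bool (bit x t \<and> bit y (j - t)))"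

lemma column_le: "column x y j \<le> Suc j"
proof -
  have "column x y j \<le> (\<Sum>t\<le>j. 1)" unfolding column_def by (rule sum_mono) auto
  then show ?thesis by simp
qed

lemma binary_expansion: "(x::nat) mod 2 ^ N = (\<Sum>i<N. of_bool (bit x i) * 2 ^ i)"
  by (induction N) (auto simp: mod_Suc_power simp del: power_Suc)

lemma mult_eq_columns:
  assumes "\<And>i j. bit x i \<Longrightarrow> bit y j \<Longrightarrow> i + j < T"
  shows "x * y = (\<Sum>t<T. column x y t * 2 ^ t)"
proof -
  \<comment> \<open>Large enough for the binary expansions of both factors and for the square of
    side \<open>N\<close> to contain the triangle \<open>i + j < T\<close>, outside of which all
    terms vanish.\<close>
  define N where "N = x + y + T"
  have exp: "u = (\<Sum>i<N. of_bool (bit u i) * 2 ^ i)" if "u \<le> N" for u :: nat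
    using binary_expansion[of u N] le_less_trans[OF that less_exp] by simp
  let ?f = "\<lambda>(i, j). of_bool (bit x i \<and> bit y j) * 2 ^ (i + j) :: nat"
  have "x * y = (\<Sum>i<N. of_bool (bit x i) * 2 ^ i) * (\<Sum>j<N. of_bool (bit y j) * 2 ^ j)"
    using exp[of x] exp[of y] by (simp add: N_def)
  also have "\<dots> = sum ?f ({..<N} \<times> {..<N})"
    unfolding sum_product sum.cartesian_product
    by (intro sum.cong refl) (auto simp: power_add)
  also have "\<dots> = sum ?f {(i, j). i + j < T}"
  proof (rule sum.mono_neutral_right)
    show "{(i, j). i + j < T} \<subseteq> {..<N} \<times> {..<N}" by (auto simp: N_def)
  qed (use assms in auto)
  also have "\<dots> = (\<Sum>t<T. \<Sum>i\<le>t. ?f (i, t - i))" 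
    using sum.triangle_reindex[of "\<lambda>i j. of_bool (bit x i \<and> bit y j) * 2 ^ (i + j) :: nat" T] by simp
  also have "\<dots> = (\<Sum>t<T. column x y t * 2 ^ t)"
    unfolding column_def sum_distrib_right by (intro sum.cong) auto
  finally show ?thesis .
qed

text \<open>The state is the number of ones met so far in column \<open>j\<close>. The position
  \<open>u\<close> is \<open>j - t\<close>, expressed by addition.\<close>

definition count_step :: "nat \<Rightarrow> nat \<Rightarrow> nat \<Rightarrow> nat \<Rightarrow> nat \<Rightarrow> nat \<Rightarrow> nat \<Rightarrow> bool" where
  "count_step n x y j =
     (\<lambda>t s s'. if bit x t \<and> (\<exists>u<n. t + u = j \<and> bit y u) then s' = Suc s else s' = s)"

definition count_column :: "nat \<Rightarrow> nat \<Rightarrow> nat \<Rightarrow> nat \<Rightarrow> nat \<Rightarrow> bool" where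
  "count_column n x y j c \<longleftrightarrow> (\<exists>T<n. T = Suc j \<and>
     iterate n (count_step n x y j) T c)"

lemma fo_if: "fo P \<Longrightarrow> fo Q \<Longrightarrow> fo R \<Longrightarrow> fo (\<lambda>w v. if P w v then Q w v else R w v)"
  unfolding if_bool_eq_conj by (intro fo_conj fo_imp fo_not)

lemma fo_count_column: "fo (\<lambda>w v. count_column (length w) (v a) (v b) (v c) (v d))"
  unfolding count_column_def count_step_def by (intro fo_intros fo_iterate fo_if fo_Suc fo_add_var)

lemma count_step_iff:
  assumes "x < n" "y < n" "t \<le> j"
  shows "count_step n x y j t s s' \<longleftrightarrow>
    s' = s + of_bool (bit x t \<and> bit y (j - t))"
proof -
  have "u < n" if "bit y u" for u using nat_bit_imp_less[OF that] assms by simp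
  then have "(\<exists>u<n. t + u = j \<and> bit y u) \<longleftrightarrow> bit y (j - t)"
    using assms(3) by (metis add_diff_cancel_left' le_add_diff_inverse)
  then show ?thesis by (auto simp: count_step_def)
qed

lemma count_column_sound:
  assumes "count_column n x y j c" "x < n" "y < n"
  shows "c = column x y j"
proof -
  obtain \<sigma> where \<sigma>: "\<sigma> 0 = 0" "\<sigma> (Suc j) = c"
    "\<And>t. t < Suc j \<Longrightarrow> \<sigma> (Suc t) = \<sigma> t + of_bool (bit x t \<and> bit y (j - t))"
    using assms(1) unfolding count_column_def
    by (elim exE conjE) (erule iterate_sound, simp add: count_step_iff[OF assms(2,3)])
  have "\<sigma> t = (\<Sum>u<t. of_bool (bit x u \<and> bit y (j - u)))" if "t \<le> Suc j" for t
    using that by (induction t) (auto simp: \<sigma>)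
  from this[of "Suc j"] show ?thesis using \<sigma>(2) by (simp add: column_def lessThan_Suc_atMost)
qed

text \<open>Partial counts never exceed the number of steps, hence are at most \<open>B\<close> and
  fit into fields of width \<open>q\<close>.\<close>

lemma count_column_complete:
  assumes "x < n" "y < n" "j < B" "B < 2 ^ q" "B < n"
    and q: "q \<ge> 1" "(K + 1) * q \<le> L" "2 ^ L \<le> n" "B \<le> K * K"
  shows "count_column n x y j (column x y j)"
proof -
  define \<sigma> :: "nat \<Rightarrow> nat" where "\<sigma> = (\<lambda>t. \<Sum>u<t. of_bool (bit x u \<and> bit y (j - u)))"
  have "\<sigma> t \<le> (\<Sum>u<t. 1)" for t unfolding \<sigma>_def by (rule sum_mono) auto
  then have le: "\<sigma> t \<le> t" for t by simp
  have "iterate n (count_step n x y j)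
    (Suc j) (\<sigma> (Suc j))"
  proof (rule iterate_complete)
    fix t assume "t < Suc j"
    then show "count_step n x y j t (\<sigma> t) (\<sigma> (Suc t))"
      using count_step_iff[OF assms(1,2), of t j "\<sigma> t" "\<sigma> (Suc t)"]
      by (simp add: \<sigma>_def sum.lessThan_Suc del: sum_of_bool_eq)
  next
    fix t assume "t \<le> Suc j"
    then show "\<sigma> t < 2 ^ q" using le[of t] assms(3,4) by linarith
  qed (use assms in \<open>auto simp: \<sigma>_def\<close>)
  moreover have "\<sigma> (Suc j) = column x y j"
    by (simp add: \<sigma>_def column_def lessThan_Suc_atMost)
  ultimately show ?thesis unfolding count_column_def using assms(3,5) by auto
qed

text \<open>This is \<open>s + c = 2 * s' + of_bool (bit z t)\<close> with names for the
  intermediate sums. The product \<open>z\<close> is given and only checked digit by digit.\<close>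

definition carry_step :: "nat \<Rightarrow> nat \<Rightarrow> nat \<Rightarrow> nat \<Rightarrow> nat \<Rightarrow> nat \<Rightarrow> nat \<Rightarrow> bool" where
  "carry_step n x y z = (\<lambda>t s s'. \<exists>c<n. \<exists>u<n. \<exists>h<n. count_column n x y t c \<and> s + c = u \<and> s' + s' = h \<and>
       (if bit z t then u = Suc h else u = h))"

text \<open>Schoolbook multiplication: the state of the iteration is the carry into the current column.\<close>

definition school_mult :: "nat \<Rightarrow> nat \<Rightarrow> nat \<Rightarrow> nat \<Rightarrow> bool" where
  "school_mult n x y z \<longleftrightarrow> (\<exists>T<n. \<exists>e<n. e = 0 \<and>
     (\<forall>i<n. \<forall>j<n. bit x i \<and> bit y j \<longrightarrow> (\<exists>u<n. i + j = u \<and> u < T)) \<and>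
     (\<forall>i<n. bit z i \<longrightarrow> i < T) \<and>
     iterate n (carry_step n x y z) T e)"

lemma fo_school_mult: "fo (\<lambda>w v. school_mult (length w) (v a) (v b) (v c))"
  unfolding school_mult_def carry_step_def
  by (intro fo_intros fo_iterate fo_if fo_count_column fo_Suc fo_add_var)

lemma school_mult_sound:
  assumes "school_mult n x y z" "x < n" "y < n" "z < n"
  shows "x * y = z"
proof -
  obtain T where T: "\<And>i j. \<lbrakk>i < n; j < n; bit x i; bit y j\<rbrakk> \<Longrightarrow> i + j < T"
      "\<And>i. i < n \<Longrightarrow> bit z i \<Longrightarrow> i < T"
    and it: "iterate n (carry_step n x y z) T 0"
    using assms(1) unfolding school_mult_def by blast
  obtain \<sigma> where \<sigma>: "\<sigma> 0 = 0" "\<sigma> T = 0" and step: "\<And>t. t < T \<Longrightarrow> carry_step n x y z t (\<sigma> t) (\<sigma> (Suc t))"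
    using it by (rule iterate_sound) (rule that)
  have rec: "\<sigma> t + column x y t = 2 * \<sigma> (Suc t) + of_bool (bit z t)" if "t < T" for t
    using step[OF that] count_column_sound[OF _ assms(2,3)]
    by (auto simp: carry_step_def split: if_splits)
  \<comment> \<open>The columns below \<open>t\<close> amount to the low bits of \<open>z\<close>
    plus the carry at weight \<open>2 ^ t\<close>. At \<open>t = T\<close> the carry is
    \<open>0\<close> and the product remains.\<close>
  have inv: "(\<Sum>u<t. column x y u * 2 ^ u) = z mod 2 ^ t + \<sigma> t * 2 ^ t" if "t \<le> T" for t
    using that
  proof (induction t)
    case (Suc t)
    then have "(\<Sum>u<Suc t. column x y u * 2 ^ u) = z mod 2 ^ t + (\<sigma> t + column x y t) * 2 ^ t"
      by (simp add: algebra_simps)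
    also have "\<dots> = z mod 2 ^ Suc t + \<sigma> (Suc t) * 2 ^ Suc t"
      using rec[of t] Suc.prems unfolding mod_Suc_power by (simp add: algebra_simps)
    finally show ?case .
  qed (simp add: \<sigma>)
  have bits: "i < n" if "bit u i" "u < n" for u i :: nat
    using nat_bit_imp_less[OF that(1)] that(2) by simp
  have "x * y = (\<Sum>t<T. column x y t * 2 ^ t)"
    by (rule mult_eq_columns) (use T(1) bits assms in blast)
  also have "\<dots> = z mod 2 ^ T" using inv[of T] \<sigma> by simp
  also have "\<dots> = take_bit T z" by (simp add: take_bit_eq_mod)
  also have "\<dots> = z" using T(2) bits[of z] assms(4) by (intro bit_eqI) (auto simp: bit_take_bit_iff)
  finally show ?thesis .
qed

text \<open>\<open>L\<close> is the binary logarithm of \<open>n\<close>, rounded down. A product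
  below \<open>n\<close> has bits up to position \<open>L\<close> only, so \<open>Suc L\<close>
  columns suffice; \<open>2 * L + 3 < n\<close> keeps the sum of a carry and a column inside the
  universe.\<close>

lemma school_mult_complete:
  assumes xyz: "x * y = z" "x < n" "y < n" "z < n"
    and n: "2 ^ L \<le> n" "n < 2 ^ Suc L"
    and q: "q \<ge> 1" "(K + 1) * q \<le> L" "Suc L < 2 ^ q" "Suc L \<le> K * K" and L: "2 * L + 3 < n"
  shows "school_mult n x y z"
proof -
  define T where "T = Suc L"
  have bits: "i + j < T" if "bit x i" "bit y j" for i j
  proof -
    have "2 ^ i \<le> x" "2 ^ j \<le> y"
      using that by (metis bit_iff_odd div_less even_zero not_le)+
    then have "2 ^ i * 2 ^ j \<le> x * y" by (rule mult_le_mono)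
    then have "2 ^ (i + j) < (2::nat) ^ Suc L" using xyz n by (simp add: power_add)
    then show ?thesis unfolding T_def by (rule power_less_imp_less_exp[of "2::nat", rotated]) simp
  qed
  define P where "P = (\<lambda>t. \<Sum>u<t. column x y u * 2 ^ u)"
  have PT: "P T = z" using mult_eq_columns[OF bits] xyz(1) by (simp add: P_def)
  \<comment> \<open>The true carry into column \<open>t\<close>: what the lower columns contribute
    from weight \<open>2 ^ t\<close> on.\<close>
  define \<sigma> where "\<sigma> = (\<lambda>t. P t div 2 ^ t)"
  have rec: "\<sigma> t + column x y t = 2 * \<sigma> (Suc t) + of_bool (bit z t)" if "t < T" for t
  proof -
    \<comment> \<open>The columns beyond \<open>t\<close> contribute a multiple of
      \<open>2 ^ Suc t\<close>, so bit \<open>t\<close> of \<open>z\<close> is already that of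
      \<open>P (Suc t)\<close>.\<close>
    have "z = P (Suc t) + (\<Sum>u\<in>{Suc t..<T}. column x y u * 2 ^ u)"
      using that unfolding PT[symmetric] P_def lessThan_atLeast0
      by (subst sum.atLeastLessThan_concat) auto
    moreover have "2 ^ Suc t dvd (\<Sum>u\<in>{Suc t..<T}. column x y u * 2 ^ u)"
      by (intro dvd_sum dvd_mult le_imp_power_dvd) auto
    ultimately obtain r where r: "z = P (Suc t) + 2 ^ Suc t * r" by (metis dvd_def)
    have "z div 2 ^ t = P (Suc t) div 2 ^ t + 2 * r"
    proof -
      have "z = P (Suc t) + 2 * r * 2 ^ t" using r by simp
      then show ?thesis by (metis add.commute div_mult_self1 power_eq_0_iff zero_neq_numeral)
    qed
    then have bit: "bit z t = odd (P (Suc t) div 2 ^ t)" by (simp add: bit_iff_odd)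
    have next_carry: "\<sigma> (Suc t) = P (Suc t) div 2 ^ t div 2"
      unfolding \<sigma>_def power_Suc2 by (rule div_mult2_eq)
    have "\<sigma> t + column x y t = P (Suc t) div 2 ^ t" by (simp add: P_def \<sigma>_def)
    also have "X = 2 * (X div 2) + of_bool (odd X)" for X :: nat
      by (cases "even X") simp_all
    finally show ?thesis unfolding bit next_carry .
  qed
  \<comment> \<open>Column \<open>t\<close> has at most \<open>t + 1\<close> ones, so halving keeps
    the carry linear in \<open>t\<close>. This is what makes the states small enough for the
    fields.\<close>
  have \<sigma>_le: "\<sigma> t \<le> t" if "t \<le> T" for t
    using that
  proof (induction t)
    case 0
    show ?case by (simp add: \<sigma>_def P_def)
  next
    case (Suc t)
    then show ?case using rec[of t] column_le[of x y t] by auto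
  qed
  have "\<sigma> T = 0" 
    unfolding \<sigma>_def PT unfolding T_def using xyz n by (intro div_less) linarith
  have "iterate n (carry_step n x y z) T (\<sigma> T)"
  proof (rule iterate_complete[where q = q and K = K and L = L])
    fix t assume t: "t < T"
    have "count_column n x y t (column x y t)"
      by (rule count_column_complete[where B = T and q = q and K = K and L = L])
        (use xyz n q L t in \<open>auto simp: T_def\<close>)
    moreover have "\<sigma> t + column x y t < n" "column x y t < n"
      using \<sigma>_le[of t] column_le[of x y t] t L by (auto simp: T_def)
    moreover have "\<sigma> (Suc t) + \<sigma> (Suc t) < n" using rec[OF t] calculation(2) by simp
    ultimately show "carry_step n x y z t (\<sigma> t) (\<sigma> (Suc t))"
      unfolding carry_step_def using rec[OF t] by (intro exI[of _ "column x y t"] exI conjI) auto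
  next
    fix t assume "t \<le> T"
    then show "\<sigma> t < 2 ^ q" using \<sigma>_le[of t] q by (simp add: T_def)
  qed (use q n in \<open>auto simp: T_def \<sigma>_def P_def\<close>)
  moreover have "i < T" if "bit z i" for i
  proof -
    have "2 ^ i \<le> z" using that by (metis bit_iff_odd div_less even_zero not_le)
    then have "2 ^ i < (2::nat) ^ Suc L" using xyz n by linarith
    then show ?thesis unfolding T_def by (rule power_less_imp_less_exp[of "2::nat", rotated]) simp
  qed
  moreover have "T < n" using L by (simp add: T_def)
  moreover have "\<exists>u<n. i + j = u \<and> u < T" if "bit x i \<and> bit y j" for i j
    using bits[of i j] that \<open>T < n\<close> by auto
  ultimately show ?thesis
    unfolding school_mult_def \<open>\<sigma> T = 0\<close>
    by (intro exI[of _ T] exI[of _ 0]) auto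
qed

text \<open>States up to \<open>Suc L\<close> need a width \<open>q\<close> of about
  \<open>log L\<close>, and \<open>K * K\<close> has to reach \<open>Suc L\<close>, so
  \<open>K\<close> is of the order of \<open>sqrt L\<close>; then \<open>(K + 1) * q\<close> is
  eventually below \<open>L\<close>. The witness is \<open>K = 2 * 2 ^ (q div 2)\<close>.\<close>

lemma field_widths_exist:
  assumes "L \<ge> 2 ^ 11"
  obtains q K :: nat where "q \<ge> 1" "(K + 1) * q \<le> L" "Suc L < 2 ^ q" "Suc L \<le> K * K"
proof -
  obtain r where r: "2 ^ r \<le> Suc L" "Suc L < 2 ^ (r + 1)"
    using ex_power_ivl1[of 2 "Suc L"] by auto
  define q where "q = r + 1"
  define u where "u = q div 2"
  have "(2::nat) ^ 11 < 2 ^ (r + 1)" using assms r by linarith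
  then have "11 < r + 1" by (rule power_less_imp_less_exp[of "2::nat", rotated]) simp
  \<comment> \<open>\<open>6\<close> is the least \<open>u\<close> with
    \<open>F u * 2 + 2 \<le> 4 ^ u\<close>; the threshold \<open>2 ^ 11\<close> for \<open>L\<close>
    is the one that yields it.\<close>
  then have "u \<ge> 6" by (simp add: u_def q_def)
  define F :: "nat \<Rightarrow> nat" where "F = (\<lambda>u. (2 * 2 ^ u + 1) * (2 * u + 1))"
  from \<open>u \<ge> 6\<close> have ineq: "F u * 2 + 2 \<le> 4 ^ u"
  proof (induction u rule: nat_induct_at_least)
    case (Suc u)
    have "F (Suc u) \<le> (2 * (2 * 2 ^ u + 1)) * (2 * (2 * u + 1))"
      unfolding F_def using Suc.hyps by (intro mult_le_mono) auto
    also have "\<dots> = 4 * F u" by (simp add: F_def)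
    finally show ?case using Suc.IH by simp
  qed (simp add: F_def)
  have q: "2 * u \<le> q" "q \<le> 2 * u + 1" by (auto simp: u_def)
  have "(4::nat) ^ u = 2 ^ (2 * u)" by (simp add: power_mult)
  also have "\<dots> \<le> 2 ^ q" using q by (intro power_increasing) auto
  finally have "F u * 2 + 2 \<le> 2 ^ q" using ineq by linarith
  \<comment> \<open>Halved, the inequality reads \<open>F u + 1 \<le> 2 ^ r\<close>, and
    \<open>2 ^ r \<le> Suc L\<close>.\<close>
  then have "F u \<le> L" using r by (simp add: q_def)
  moreover have "(2 * 2 ^ u + 1) * q \<le> F u" unfolding F_def using q by (intro mult_le_mono2)
  ultimately have "(2 * 2 ^ u + 1) * q \<le> L" by linarith
  moreover have "Suc L \<le> 2 * 2 ^ u * (2 * 2 ^ u)"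
  proof -
    have "Suc L \<le> 2 ^ q" using r by (simp add: q_def)
    also have "\<dots> \<le> 2 ^ (2 * u + 2)" using q by (intro power_increasing) auto
    also have "\<dots> = 2 ^ (2 * u) * 4" by (simp add: power_add)
    also have "(2::nat) ^ (2 * u) = 2 ^ u * 2 ^ u" by (simp only: mult_2 power_add)
    also have "2 ^ u * 2 ^ u * 4 = 2 * 2 ^ u * (2 * 2 ^ u :: nat)" by simp
    finally show ?thesis .
  qed
  ultimately show ?thesis using that[of q "2 * 2 ^ u"] r by (simp add: q_def)
qed

lemma fo_length_less: "fo (\<lambda>w v. length w < N)"
proof (cases N)
  case (Suc k)
  have "fo (\<lambda>w v. \<not> (\<exists>d<length w. d = k))" by (intro fo_intros fo_eq_const)
  then show ?thesis by (rule fo_cong) (auto simp: Suc)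
qed (auto intro!: fo_cong[OF fo_const[of False]])

lemma fo_mult_var: "fo (\<lambda>w v. v i * v j = v k)"
proof -
  obtain c :: nat where c: "c = 2 ^ 11" by blast
  \<comment> \<open>A universe of at least \<open>N\<close> elements has
    \<open>L \<ge> 2 ^ 11\<close>, as \<open>field_widths_exist\<close> demands. The smaller ones
    are covered by a finite multiplication table.\<close>
  define N :: nat where "N = 2 ^ c"
  have "fo (\<lambda>w v. if length w < N
      then \<exists>a<N. \<exists>b<N. v i = a \<and> v j = b \<and> v k = a * b
      else school_mult (length w) (v i) (v j) (v k))"
    by (intro fo_if fo_length_less fo_school_mult fo_finite_ex fo_conj fo_eq_const)
  then show ?thesis
  proof (rule fo_cong)
    fix w :: "bool list" and v :: "nat \<Rightarrow> nat"
    assume v: "\<And>i. v i < length w"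
    show "v i * v j = v k \<longleftrightarrow> (if length w < N
      then \<exists>a<N. \<exists>b<N. v i = a \<and> v j = b \<and> v k = a * b
      else school_mult (length w) (v i) (v j) (v k))"
    proof (cases "length w < N")
      case True
      then show ?thesis using v[of i] v[of j] by auto
    next
      case False
      have "1 \<le> length w" using v[of i] by simp
      then obtain L where L: "2 ^ L \<le> length w" "length w < 2 ^ Suc L"
        using ex_power_ivl1[of 2 "length w"] by auto
      have "(2::nat) ^ c < 2 ^ Suc L" using False L(2) unfolding N_def by linarith
      then have "c < Suc L" by (rule power_less_imp_less_exp[of "2::nat", rotated]) simp
      then have L11: "2 ^ 11 \<le> L" by (simp add: c)
      then have "4 \<le> L" by simp
      then have "2 * L + 3 < 2 ^ L"
        by (induction L rule: nat_induct_at_least) simp_all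
      then have "2 * L + 3 < length w" using L by linarith
      then have "school_mult (length w) (v i) (v j) (v k)" if "v i * v j = v k"
        using school_mult_complete[OF that v v v L] field_widths_exist[OF L11] by metis
      then show ?thesis using False school_mult_sound[OF _ v v v] by auto
    qed
  qed
qed

text \<open>
  A numerical term may take values beyond the universe; being definable means that its graph is
  definable for the values up to and including the length of the word.
\<close>

definition fo_term :: "(bool list \<Rightarrow> (nat \<Rightarrow> nat) \<Rightarrow> nat) \<Rightarrow> bool" where
  "fo_term f \<longleftrightarrow> fo (\<lambda>w v. f w (\<lambda>i. v (Suc i)) = v 0) \<and> fo (\<lambda>w v. f w v = length w)"

lemma fo_term_subst:
  assumes "fo_term f" shows "fo (\<lambda>w v. f w (\<lambda>i. v (\<rho> i)) = v a)"
proof -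
  have "fo (\<lambda>w v. f w (\<lambda>i. v (Suc i)) = v 0)" using assms unfolding fo_term_def by blast
  from fo_subst[OF this, of "case_nat a \<rho>"] show ?thesis by simp
qed

lemma fo_term_eq_var: "fo_term f \<Longrightarrow> fo (\<lambda>w v. f w v = v a)"
  using fo_term_subst[of f "\<lambda>i. i" a] by simp

lemma fo_term_eq_length: "fo_term f \<Longrightarrow> fo (\<lambda>w v. f w v = length w)"
  unfolding fo_term_def by blast

lemma fo_var_eq_term: "fo_term f \<Longrightarrow> fo (\<lambda>w v. v a = f w v)"
  using fo_term_eq_var[of f a] by (simp add: eq_commute)

lemma fo_term_shift: "fo_term f \<Longrightarrow> fo_term (\<lambda>w v. f w (\<lambda>i. v (\<rho> i)))"
  unfolding fo_term_def
  using fo_term_subst[of f "\<lambda>i. Suc (\<rho> i)" 0] fo_subst[OF fo_term_eq_length, of f \<rho>]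
  unfolding fo_term_def by simp

text \<open>Nothing is known about values beyond the length, so equality is definable only together
  with the bound.\<close>

lemma fo_term_eq_term:
  assumes "fo_term f" "fo_term g"
  shows "fo (\<lambda>w v. f w v = g w v \<and> g w v \<le> length w)"
proof -
  have "fo (\<lambda>w v. (\<exists>d<length w. f w v = d \<and> g w v = d) \<or> (f w v = length w \<and> g w v = length w))"
    by (intro fo_intros fo_term_subst fo_term_eq_length assms)
  then show ?thesis by (rule fo_cong) (auto simp: le_less)
qed

lemma fo_length_eq: "fo (\<lambda>w v. length w = k)"
proof -
  have "fo (\<lambda>w v. length w < Suc k \<and> \<not> length w < k)" by (intro fo_intros fo_length_less)
  then show ?thesis by (rule fo_cong) auto
qed

lemma fo_term_var: "fo_term (\<lambda>w v. v i)"
  unfolding fo_term_def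
proof (intro conjI fo_intros)
  show "fo (\<lambda>w v. v i = length w)" by (rule fo_cong[OF fo_const[of False]]) (auto simp: nat_neq_iff)
qed

lemma fo_term_const: "fo_term (\<lambda>w v. k)"
  unfolding fo_term_def
proof
  show "fo (\<lambda>w v. k = v 0)" by (rule fo_cong[OF fo_eq_const[of 0 k]]) auto
  show "fo (\<lambda>w v. k = length w)" by (rule fo_cong[OF fo_length_eq[of k]]) auto
qed

lemma fo_last: "fo (\<lambda>w v. Suc (v i) = length w)"
proof -
  have "fo (\<lambda>w v. \<forall>d<length w. d \<le> v i)" by (intro fo_intros)
  then show ?thesis
  proof (rule fo_cong)
    fix w :: "bool list" and v :: "nat \<Rightarrow> nat"
    assume v: "\<And>i. v i < length w"
    show "(Suc (v i) = length w) = (\<forall>d<length w. d \<le> v i)"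
    proof
      assume "\<forall>d<length w. d \<le> v i"
      then have "\<not> Suc (v i) < length w" by (metis Suc_n_not_le_n)
      then show "Suc (v i) = length w" using v[of i] by simp
    qed auto
  qed
qed

text \<open>The length is not an element. One unit is taken off the first summand, and the remaining
  sum has to be the last element.\<close>

lemma fo_add_var_length: "fo (\<lambda>w v. v i + v j = length w)"
proof -
  have "fo (\<lambda>w v. \<exists>a<length w. \<exists>e<length w. v i = Suc a \<and> a + v j = e \<and> Suc e = length w)"
    by (intro fo_intros fo_Suc fo_add_var fo_last)
  then show ?thesis
  proof (rule fo_cong)
    fix w :: "bool list" and v :: "nat \<Rightarrow> nat"
    assume v: "\<And>i. v i < length w"
    show "(v i + v j = length w) =
      (\<exists>a<length w. \<exists>e<length w. v i = Suc a \<and> a + v j = e \<and> Suc e = length w)"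
      using v[of i] v[of j] by (cases "v i") auto
  qed
qed

text \<open>Splitting off one copy of \<open>v i\<close> leaves a product inside the universe and a
  sum of the kind treated by \<open>fo_add_var_length\<close>.\<close>

lemma fo_mult_var_length: "fo (\<lambda>w v. v i * v j = length w)"
proof -
  have "fo (\<lambda>w v. \<exists>a<length w. \<exists>e<length w. v j = Suc a \<and> v i * a = e \<and> v i + e = length w)"
    by (intro fo_intros fo_Suc fo_mult_var fo_add_var_length)
  then show ?thesis
  proof (rule fo_cong)
    fix w :: "bool list" and v :: "nat \<Rightarrow> nat"
    assume v: "\<And>i. v i < length w"
    show "(v i * v j = length w) =
      (\<exists>a<length w. \<exists>e<length w. v j = Suc a \<and> v i * a = e \<and> v i + e = length w)"
      using v[of i] v[of j] by (cases "v j"; cases "v i") auto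
  qed
qed

lemma fo_term_add:
  assumes f: "fo_term f" and g: "fo_term g"
  shows "fo_term (\<lambda>w v. f w v + g w v)"
  unfolding fo_term_def
proof
  have "fo (\<lambda>w v. \<exists>a<length w. \<exists>b<length w. f w (\<lambda>i. v (Suc i)) = a \<and> g w (\<lambda>i. v (Suc i)) = b \<and> a + b = v 0)"
    by (intro fo_intros fo_add_var fo_term_subst fo_term_shift[OF f] fo_term_shift[OF g])
  then show "fo (\<lambda>w v. f w (\<lambda>i. v (Suc i)) + g w (\<lambda>i. v (Suc i)) = v 0)"
    by (rule fo_cong) (metis le_add1 le_add2 le_less_trans)
  \<comment> \<open>A summand equal to the length lies outside the universe, so the two cases where
    the other summand is \<open>0\<close> are listed separately.\<close>
  have "fo (\<lambda>w v. (\<exists>z<length w. z = 0 \<and> f w v = length w \<and> g w v = z) \<or>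
      (\<exists>z<length w. z = 0 \<and> f w v = z \<and> g w v = length w) \<or>
      (\<exists>a<length w. \<exists>b<length w. f w v = a \<and> g w v = b \<and> a + b = length w))"
    by (intro fo_intros fo_add_var_length fo_term_subst fo_term_eq_length f g
        fo_term_shift[OF f] fo_term_shift[OF g])
  then show "fo (\<lambda>w v. f w v + g w v = length w)"
  proof (rule fo_cong)
    fix w :: "bool list" and v :: "nat \<Rightarrow> nat"
    assume "w \<noteq> []"
    then show "(f w v + g w v = length w) = ((\<exists>z<length w. z = 0 \<and> f w v = length w \<and> g w v = z) \<or>
      (\<exists>z<length w. z = 0 \<and> f w v = z \<and> g w v = length w) \<or>
      (\<exists>a<length w. \<exists>b<length w. f w v = a \<and> g w v = b \<and> a + b = length w))"
      by (cases "f w v = 0"; cases "g w v = 0") auto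
  qed
qed

lemma fo_term_mult:
  assumes f: "fo_term f" and g: "fo_term g"
  shows "fo_term (\<lambda>w v. f w v * g w v)"
  unfolding fo_term_def
proof
  have "fo (\<lambda>w v. (\<exists>z<length w. z = 0 \<and> v 0 = z \<and> (f w (\<lambda>i. v (Suc i)) = z \<or> g w (\<lambda>i. v (Suc i)) = z)) \<or>
     (\<exists>a<length w. \<exists>b<length w. f w (\<lambda>i. v (Suc i)) = a \<and> g w (\<lambda>i. v (Suc i)) = b \<and> a * b = v 0))"
    by (intro fo_intros fo_mult_var fo_term_subst fo_term_shift[OF f] fo_term_shift[OF g])
  then show "fo (\<lambda>w v. f w (\<lambda>i. v (Suc i)) * g w (\<lambda>i. v (Suc i)) = v 0)"
  proof (rule fo_cong)
    fix w :: "bool list" and v :: "nat \<Rightarrow> nat"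
    assume v: "\<And>i. v i < length w"
    have "a < length w" if "a * b = v 0" "0 < b" for a b
      using that v[of 0] by (metis le_less_trans mult.right_neutral mult_le_mono2 Suc_leI One_nat_def)
    then have *: "a < length w \<and> b < length w" if "a * b = v 0" "v 0 \<noteq> 0" for a b
      using that by (metis mult.commute mult_0_right neq0_conv)
    show "(f w (\<lambda>i. v (Suc i)) * g w (\<lambda>i. v (Suc i)) = v 0) \<longleftrightarrow>
     (\<exists>z<length w. z = 0 \<and> v 0 = z \<and> (f w (\<lambda>i. v (Suc i)) = z \<or> g w (\<lambda>i. v (Suc i)) = z)) \<or>
     (\<exists>a<length w. \<exists>b<length w. f w (\<lambda>i. v (Suc i)) = a \<and> g w (\<lambda>i. v (Suc i)) = b \<and> a * b = v 0)"
      using *[of "f w (\<lambda>i. v (Suc i))" "g w (\<lambda>i. v (Suc i))"] v[of 0]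
      by (cases "v 0 = 0") auto
  qed
  have "fo (\<lambda>w v. (length w = 1 \<and> f w v = length w \<and> g w v = length w) \<or>
      (\<exists>z<length w. z = 1 \<and> f w v = length w \<and> g w v = z) \<or>
      (\<exists>z<length w. z = 1 \<and> f w v = z \<and> g w v = length w) \<or>
      (\<exists>a<length w. \<exists>b<length w. f w v = a \<and> g w v = b \<and> a * b = length w))"
    by (intro fo_intros fo_length_eq fo_eq_const fo_mult_var_length fo_term_subst
        fo_term_eq_length f g fo_term_shift[OF f] fo_term_shift[OF g])
  then show "fo (\<lambda>w v. f w v * g w v = length w)"
  proof (rule fo_cong)
    fix w :: "bool list" and v :: "nat \<Rightarrow> nat"
    assume "w \<noteq> []"
    then have w: "1 \<le> length w" by (simp add: Suc_leI)
    have *: "a = 1 \<and> b = length w \<or> a = length w \<and> b = 1 \<or> a < length w \<and> b < length w"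
      if "a * b = length w" for a b
    proof (cases "a \<le> 1 \<or> b \<le> 1")
      case True
      then show ?thesis using that w by (auto simp: le_Suc_eq)
    next
      case False
      then show ?thesis using n_less_n_mult_m[of a b] n_less_m_mult_n[of b a] that by simp
    qed
    show "(f w v * g w v = length w) \<longleftrightarrow> (length w = 1 \<and> f w v = length w \<and> g w v = length w) \<or>
      (\<exists>z<length w. z = 1 \<and> f w v = length w \<and> g w v = z) \<or>
      (\<exists>z<length w. z = 1 \<and> f w v = z \<and> g w v = length w) \<or>
      (\<exists>a<length w. \<exists>b<length w. f w v = a \<and> g w v = b \<and> a * b = length w)"
      using *[of "f w v" "g w v"] w by (cases "length w = 1") auto
  qed
qed

lemma fo_term_Suc: "fo_term f \<Longrightarrow> fo_term (\<lambda>w v. Suc (f w v))"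
  using fo_term_add[OF _ fo_term_const[of 1], of f] by simp

lemma fo_term_power: "fo_term f \<Longrightarrow> fo_term (\<lambda>w v. f w v ^ k)"
  by (induction k) (auto intro: fo_term_const[of 1, simplified] fo_term_mult)

lemma fo_term_sum:
  assumes "\<And>i. i < k \<Longrightarrow> fo_term (f i)"
  shows "fo_term (\<lambda>w v. \<Sum>i<(k::nat). f i w v)"
  using assms by (induction k) (auto intro: fo_term_const fo_term_add)

lemmas fo_term_intros = fo_term_var fo_term_const fo_term_Suc fo_term_add fo_term_mult
  fo_term_power fo_term_sum


section \<open>Counting proof trees\<close>

definition trees_at :: "'g circuit \<Rightarrow> bool list \<Rightarrow> 'g \<Rightarrow> 'g list set set" where
  "trees_at C w g = {T. proof_tree (C\<lparr>out_gate := g\<rparr>) w T}"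

text \<open>Inverse to cutting a tree at its root: \<open>Y\<close> is the set of children taken,
  and \<open>F\<close> supplies the tree below each of them.\<close>

definition join_trees :: "'g \<Rightarrow> 'g set \<Rightarrow> ('g \<Rightarrow> 'g list set) \<Rightarrow> 'g list set" where
  "join_trees g Y F = insert [g] (\<Union>y\<in>Y. (#) g ` F y)"

definition subtree :: "'g \<Rightarrow> 'g list set \<Rightarrow> 'g \<Rightarrow> 'g list set" where
  "subtree g T y = {q. g # q \<in> T \<and> q \<noteq> [] \<and> hd q = y}"

text \<open>The condition on a proof tree at its root only; everything else is inherited by the
  subtrees.\<close>

definition admissible :: "'g circuit \<Rightarrow> bool list \<Rightarrow> 'g \<Rightarrow> 'g set \<Rightarrow> bool" where
  "admissible C w g Y \<longleftrightarrow> Y \<subseteq> children C `` {g} \<and>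
     (case label C g of
        And \<Rightarrow> children C `` {g} \<subseteq> Y
      | Or \<Rightarrow> \<exists>!y. y \<in> Y
      | l \<Rightarrow> true_label w l)"

lemma trees_at_iff:
  "T \<in> trees_at C w g \<longleftrightarrow>
     (\<forall>p\<in>T. p \<noteq> [] \<and> hd p = g \<and> successively (\<lambda>x y. (x, y) \<in> children C) p) \<and> [g] \<in> T \<and>
     (\<forall>p y. p \<noteq> [] \<and> p @ [y] \<in> T \<longrightarrow> p \<in> T) \<and>
     (\<forall>p\<in>T. case label C (last p) of
         And \<Rightarrow> (\<forall>y. (last p, y) \<in> children C \<longrightarrow> p @ [y] \<in> T)
       | Or \<Rightarrow> (\<exists>!y. p @ [y] \<in> T)
       | g \<Rightarrow> true_label w g)"
  by (simp add: trees_at_def proof_tree_def tree_unfolding_def subset_eq cong: gate.case_cong)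

lemma trees_atD:
  assumes T: "T \<in> trees_at C w g"
  shows "[g] \<in> T"
    "p \<in> T \<Longrightarrow> p \<noteq> [] \<and> hd p = g \<and> successively (\<lambda>x y. (x, y) \<in> children C) p"
    "p \<noteq> [] \<Longrightarrow> p @ [y] \<in> T \<Longrightarrow> p \<in> T"
    "p \<in> T \<Longrightarrow> (case label C (last p) of
         And \<Rightarrow> (\<forall>y. (last p, y) \<in> children C \<longrightarrow> p @ [y] \<in> T)
       | Or \<Rightarrow> (\<exists>!y. p @ [y] \<in> T)
       | g \<Rightarrow> true_label w g)"
  using T unfolding trees_at_iff by blast+

lemma trees_atI:
  assumes "[g] \<in> T"
    "\<And>p. p \<in> T \<Longrightarrow> p \<noteq> [] \<and> hd p = g \<and> successively (\<lambda>x y. (x, y) \<in> children C) p"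
    "\<And>p y. p \<noteq> [] \<Longrightarrow> p @ [y] \<in> T \<Longrightarrow> p \<in> T"
    "\<And>p. p \<in> T \<Longrightarrow> (case label C (last p) of
         And \<Rightarrow> (\<forall>y. (last p, y) \<in> children C \<longrightarrow> p @ [y] \<in> T)
       | Or \<Rightarrow> (\<exists>!y. p @ [y] \<in> T)
       | g \<Rightarrow> true_label w g)"
  shows "T \<in> trees_at C w g"
  unfolding trees_at_iff using assms by blast

lemma trees_at_prefix:
  assumes "T \<in> trees_at C w g" "p \<noteq> []" "p @ q \<in> T"
  shows "p \<in> T"
  using assms(3)
proof (induction q rule: rev_induct)
  case (snoc y q)
  then show ?case using trees_atD(3)[OF assms(1), of "p @ q" y] assms(2) by simp
qed simp

lemma join_trees_in:
  assumes Y: "admissible C w g Y" and F: "\<And>y. y \<in> Y \<Longrightarrow> F y \<in> trees_at C w y"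
  shows "join_trees g Y F \<in> trees_at C w g"
proof -
  let ?T = "join_trees g Y F"
  have hd: "q \<noteq> [] \<and> hd q = y" if "y \<in> Y" "q \<in> F y" for y q
    using trees_atD(2)[OF F[OF that(1)] that(2)] by simp
  \<comment> \<open>A path below the root belongs to the tree named by its second gate, so each
    condition on the joined tree reduces to one on a single \<open>F y\<close>.\<close>
  have mem: "g # q \<in> ?T \<longleftrightarrow> q = [] \<or> hd q \<in> Y \<and> q \<in> F (hd q)" for q
    using hd unfolding join_trees_def by auto
  have mem1: "[g, y] \<in> ?T \<longleftrightarrow> y \<in> Y" for y
    using mem[of "[y]"] trees_atD(1)[OF F, of y] by auto
  have cons: "\<exists>q. p = g # q" if "p \<in> ?T" for p using that unfolding join_trees_def by auto
  show ?thesis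
  proof (rule trees_atI)
    show "[g] \<in> ?T" by (simp add: join_trees_def)
    fix p assume p: "p \<in> ?T"
    then obtain q where q: "p = g # q" using cons by blast
    show "p \<noteq> [] \<and> hd p = g \<and> successively (\<lambda>x y. (x, y) \<in> children C) p"
    proof (cases "q = []")
      case False
      then have hq: "hd q \<in> Y" "q \<in> F (hd q)" using p q mem by auto
      then have "successively (\<lambda>x y. (x, y) \<in> children C) q" "(g, hd q) \<in> children C"
        using trees_atD(2)[OF F[OF hq(1)] hq(2)] Y by (auto simp: admissible_def)
      then show ?thesis using False q by (cases q) auto
    qed (simp add: q)
    show "case label C (last p) of
         And \<Rightarrow> (\<forall>y. (last p, y) \<in> children C \<longrightarrow> p @ [y] \<in> ?T)
       | Or \<Rightarrow> (\<exists>!y. p @ [y] \<in> ?T)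
       | g \<Rightarrow> true_label w g"
    proof (cases "q = []")
      case True
      then show ?thesis using Y q mem1 by (auto simp: admissible_def split: gate.splits)
    next
      case False
      then have hq: "hd q \<in> Y" "q \<in> F (hd q)" using p q mem by auto
      have "p @ [z] \<in> ?T \<longleftrightarrow> q @ [z] \<in> F (hd q)" for z
        using mem[of "q @ [z]"] q False hq by auto
      moreover have "last p = last q" using False q by simp
      ultimately show ?thesis
        using trees_atD(4)[OF F[OF hq(1)] hq(2)] by (simp split: gate.splits)
    qed
  next
    fix p y assume p: "p \<noteq> []" "p @ [y] \<in> ?T"
    then obtain q where q: "p = g # q" using cons by (metis append_is_Nil_conv hd_append2 list.exhaust_sel list.sel(1))
    show "p \<in> ?T"
    proof (cases "q = []")
      case False
      then have hq: "hd q \<in> Y" "q @ [y] \<in> F (hd q)" using p(2) q mem[of "q @ [y]"] by auto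
      then show ?thesis using trees_atD(3)[OF F[OF hq(1)] False hq(2)] q mem[of q] by simp
    qed (simp add: q mem)
  qed
qed

lemma subtree_join_trees:
  assumes F: "\<And>y. y \<in> Y \<Longrightarrow> F y \<in> trees_at C w y" and "y \<in> Y"
  shows "subtree g (join_trees g Y F) y = F y"
proof -
  have "q \<noteq> [] \<and> hd q = y" if "y \<in> Y" "q \<in> F y" for y q
    using trees_atD(2)[OF F[OF that(1)] that(2)] by simp
  then show ?thesis using \<open>y \<in> Y\<close> unfolding subtree_def join_trees_def by auto
qed

text \<open>With \<open>join_trees_in\<close>, proof trees at \<open>g\<close> correspond to an
  admissible \<open>Y\<close> together with a proof tree at each of its members.\<close>

lemma tree_decomposition:
  assumes T: "T \<in> trees_at C w g"
  defines "Y \<equiv> {y. [g, y] \<in> T}"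
  shows "admissible C w g Y" "\<And>y. y \<in> Y \<Longrightarrow> subtree g T y \<in> trees_at C w y"
    "T = join_trees g Y (subtree g T)"
proof -
  show "admissible C w g Y"
    unfolding admissible_def
  proof
    show "Y \<subseteq> children C `` {g}" unfolding Y_def using trees_atD(2)[OF T] by fastforce
    show "case label C g of
        And \<Rightarrow> children C `` {g} \<subseteq> Y
      | Or \<Rightarrow> \<exists>!y. y \<in> Y
      | l \<Rightarrow> true_label w l"
      using trees_atD(4)[OF T trees_atD(1)[OF T]] unfolding Y_def
      by (simp split: gate.splits) blast
  qed
  have mem: "q \<in> subtree g T y \<longleftrightarrow> g # q \<in> T" if "q \<noteq> []" "hd q = y" for q y
    using that by (simp add: subtree_def)
  show "subtree g T y \<in> trees_at C w y" if y: "y \<in> Y" for y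
  proof (rule trees_atI)
    show "[y] \<in> subtree g T y" using y by (simp add: subtree_def Y_def)
    fix p assume p: "p \<in> subtree g T y"
    then have gp: "g # p \<in> T" "p \<noteq> []" "hd p = y" by (auto simp: subtree_def)
    then show "p \<noteq> [] \<and> hd p = y \<and> successively (\<lambda>x y. (x, y) \<in> children C) p"
      using trees_atD(2)[OF T gp(1)] by (cases p) auto
    have "p @ [z] \<in> subtree g T y \<longleftrightarrow> (g # p) @ [z] \<in> T" for z
      using mem[of "p @ [z]" y] gp by simp
    then show "case label C (last p) of
         And \<Rightarrow> (\<forall>z. (last p, z) \<in> children C \<longrightarrow> p @ [z] \<in> subtree g T y)
       | Or \<Rightarrow> (\<exists>!z. p @ [z] \<in> subtree g T y)
       | g \<Rightarrow> true_label w g"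
      using trees_atD(4)[OF T gp(1)] gp(2) by (simp split: gate.splits)
  next
    fix p z assume "p \<noteq> []" "p @ [z] \<in> subtree g T y"
    then show "p \<in> subtree g T y"
      using trees_atD(3)[OF T, of "g # p" z] by (auto simp: subtree_def)
  qed
  show "T = join_trees g Y (subtree g T)"
  proof (intro equalityI subsetI)
    fix p assume p: "p \<in> T"
    then obtain q where q: "p = g # q" using trees_atD(2)[OF T] by (metis list.collapse)
    show "p \<in> join_trees g Y (subtree g T)"
    proof (cases "q = []")
      case False
      then have "[g, hd q] \<in> T"
        using trees_at_prefix[OF T, of "[g, hd q]" "tl q"] p q by simp
      then show ?thesis using False p q unfolding join_trees_def Y_def subtree_def by auto
    qed (simp add: q join_trees_def)
  qed (use trees_atD(1)[OF T] in \<open>auto simp: join_trees_def subtree_def\<close>)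
qed

text \<open>Here \<open>Y\<close> must be the set of all children. The extensional product makes the
  family of subtrees unique.\<close>

lemma trees_at_And:
  assumes "label C g = And" "finite (children C `` {g})"
  shows "bij_betw (join_trees g (children C `` {g})) (\<Pi>\<^sub>E y\<in>children C `` {g}. trees_at C w y)
    (trees_at C w g)"
proof -
  let ?Y = "children C `` {g}"
  have adm: "admissible C w g Y \<longleftrightarrow> Y = ?Y" for Y using assms by (auto simp: admissible_def)
  show ?thesis unfolding bij_betw_def
  proof
    show "inj_on (join_trees g ?Y) (\<Pi>\<^sub>E y\<in>?Y. trees_at C w y)"
    proof (rule inj_onI)
      fix F F' assume F: "F \<in> (\<Pi>\<^sub>E y\<in>?Y. trees_at C w y)" "F' \<in> (\<Pi>\<^sub>E y\<in>?Y. trees_at C w y)"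
        and eq: "join_trees g ?Y F = join_trees g ?Y F'"
      show "F = F'"
      proof (rule PiE_ext[OF F])
        fix y assume "y \<in> ?Y"
        then show "F y = F' y"
          using subtree_join_trees[of ?Y F C w y g] subtree_join_trees[of ?Y F' C w y g] eq F
          by (simp add: PiE_mem)
      qed
    qed
    show "join_trees g ?Y ` (\<Pi>\<^sub>E y\<in>?Y. trees_at C w y) = trees_at C w g"
    proof (intro equalityI subsetI)
      fix T assume T: "T \<in> trees_at C w g"
      note dec = tree_decomposition[OF T]
      have Y: "{y. [g, y] \<in> T} = ?Y" using dec(1) adm by simp
      have "T = join_trees g ?Y (restrict (subtree g T) ?Y)"
        using dec(3) unfolding Y by (simp add: join_trees_def)
      moreover have "restrict (subtree g T) ?Y \<in> (\<Pi>\<^sub>E y\<in>?Y. trees_at C w y)"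
        using dec(2) unfolding Y by auto
      ultimately show "T \<in> join_trees g ?Y ` (\<Pi>\<^sub>E y\<in>?Y. trees_at C w y)" by blast
    qed (auto intro!: join_trees_in simp: adm)
  qed
qed

lemma trees_at_Or:
  assumes "label C g = Or"
  shows "trees_at C w g = (\<Union>y\<in>children C `` {g}. (\<lambda>T. join_trees g {y} (\<lambda>_. T)) ` trees_at C w y)"
proof (intro equalityI subsetI)
  fix T assume T: "T \<in> trees_at C w g"
  note dec = tree_decomposition[OF T]
  obtain y where Y: "{y. [g, y] \<in> T} = {y}" using dec(1) assms unfolding admissible_def by auto
  then have y: "y \<in> children C `` {g}" using dec(1) by (auto simp: admissible_def)
  have "T = join_trees g {y} (\<lambda>_. subtree g T y)"
    using dec(3) unfolding Y by (simp add: join_trees_def)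
  moreover have "subtree g T y \<in> trees_at C w y" using dec(2) unfolding Y by simp
  ultimately show "T \<in> (\<Union>y\<in>children C `` {g}. (\<lambda>T. join_trees g {y} (\<lambda>_. T)) ` trees_at C w y)"
    using y by blast
qed (use assms in \<open>auto intro!: join_trees_in simp: admissible_def\<close>)

lemma trees_at_leaf:
  assumes "label C g \<notin> {And, Or}" "children C `` {g} = {}"
  shows "trees_at C w g = (if true_label w (label C g) then {{[g]}} else {})"
proof -
  have adm: "admissible C w g Y \<longleftrightarrow> Y = {} \<and> true_label w (label C g)" for Y
    using assms by (auto simp: admissible_def split: gate.splits)
  show ?thesis
  proof (cases "true_label w (label C g)")
    case True
    have "T = {[g]}" if "T \<in> trees_at C w g" for T
      using tree_decomposition[OF that] adm by (auto simp: join_trees_def)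
    moreover have "{[g]} \<in> trees_at C w g"
      using join_trees_in[of C w g "{}" undefined] adm True by (simp add: join_trees_def)
    ultimately have "trees_at C w g = {{[g]}}" by blast
    then show ?thesis using True by simp
  next
    case False
    then show ?thesis using tree_decomposition(1) adm by fastforce
  qed
qed

section \<open>Arithmetic evaluation of circuits along a rank\<close>

definition ranked :: "'g circuit \<Rightarrow> ('g \<Rightarrow> nat) \<Rightarrow> bool" where
  "ranked C rk \<longleftrightarrow> (\<forall>(x, y)\<in>children C. rk y < rk x)"

text \<open>\<open>And\<close> multiplies because the subtrees are chosen independently;
  \<open>Or\<close> adds because a tree records the chosen child \<open>y\<close> in its path
  \<open>[g, y]\<close>.\<close>

lemma trees_at_rec:
  assumes wf: "wf_circuit n C" and g: "g \<in> gates C"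
    and fin_sub: "\<And>y. y \<in> children C `` {g} \<Longrightarrow> finite (trees_at C w y)"
  shows "finite (trees_at C w g) \<and> card (trees_at C w g) = (case label C g of
        And \<Rightarrow> \<Prod>y\<in>children C `` {g}. card (trees_at C w y)
      | Or \<Rightarrow> \<Sum>y\<in>children C `` {g}. card (trees_at C w y)
      | l \<Rightarrow> of_bool (true_label w l))" (is "_ \<and> _ = ?R")
proof -
  let ?Y = "children C `` {g}"
  have "?Y \<subseteq> gates C" using wf unfolding wf_circuit_def by auto
  then have fin: "finite ?Y" using wf unfolding wf_circuit_def by (meson finite_subset)
  consider "label C g = And" | "label C g = Or" | "label C g \<notin> {And, Or}" by blast
  then show ?thesis
  proof cases
    case 1
    note bij = trees_at_And[OF 1 fin, of w]
    have "finite (\<Pi>\<^sub>E y\<in>?Y. trees_at C w y)" using fin fin_sub by (intro finite_PiE) auto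
    moreover have "card (\<Pi>\<^sub>E y\<in>?Y. trees_at C w y) = ?R"
      using 1 by (simp add: card_PiE[OF fin])
    ultimately show ?thesis using bij_betw_finite[OF bij] bij_betw_same_card[OF bij] by simp
  next
    case 2
    let ?J = "\<lambda>y T. join_trees g {y} (\<lambda>_. T)"
    have sub: "subtree g (?J y T) y = T" if "T \<in> trees_at C w y" for y T
      using subtree_join_trees[of "{y}" "\<lambda>_. T" C w y g] that by simp
    have inj: "inj_on (?J y) (trees_at C w y)" for y by (rule inj_onI) (metis sub)
    have disj: "?J y ` trees_at C w y \<inter> ?J z ` trees_at C w z = {}" if "y \<noteq> z" for y z
    proof -
      have "?J y T \<noteq> ?J z T'" if "T \<in> trees_at C w y" "T' \<in> trees_at C w z" for T T'
      proof
        assume "?J y T = ?J z T'"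
        then have "[g, y] \<in> ?J z T'" using trees_atD(1)[OF that(1)] by (auto simp: join_trees_def)
        then have "[y] \<in> T'" by (auto simp: join_trees_def)
        then show False using trees_atD(2)[OF that(2)] \<open>y \<noteq> z\<close> by force
      qed
      then show ?thesis by auto
    qed
    have "card (trees_at C w g) = (\<Sum>y\<in>?Y. card (?J y ` trees_at C w y))"
      unfolding trees_at_Or[OF 2] by (rule card_UN_disjoint) (use fin fin_sub disj in auto)
    also have "\<dots> = ?R" using 2 by (simp add: card_image[OF inj])
    finally show ?thesis unfolding trees_at_Or[OF 2] using fin fin_sub by auto
  next
    case 3
    then have "?Y = {}" using wf g unfolding wf_circuit_def by blast
    then show ?thesis
      using 3 trees_at_leaf[OF 3, of w] by (auto split: gate.splits)
  qed
qed

lemma finite_trees_at: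
  assumes wf: "wf_circuit n C" and rk: "ranked C rk" and "g \<in> gates C"
  shows "finite (trees_at C w g)"
  using \<open>g \<in> gates C\<close>
proof (induction "rk g" arbitrary: g rule: less_induct)
  case less
  have "finite (trees_at C w y)" if "y \<in> children C `` {g}" for y
    using less.hyps[of y] rk wf that unfolding ranked_def wf_circuit_def by auto
  then show ?case using trees_at_rec[OF wf less.prems] by blast
qed

lemma card_trees_at:
  assumes wf: "wf_circuit n C" and rk: "ranked C rk" and "g \<in> gates C"
    and val: "\<And>g. g \<in> gates C \<Longrightarrow> val g = (case label C g of
        And \<Rightarrow> \<Prod>y\<in>children C `` {g}. val y
      | Or \<Rightarrow> \<Sum>y\<in>children C `` {g}. val y
      | l \<Rightarrow> of_bool (true_label w l))"
  shows "card (trees_at C w g) = val g"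
  using \<open>g \<in> gates C\<close>
proof (induction "rk g" arbitrary: g rule: less_induct)
  case less
  let ?Y = "children C `` {g}"
  have Y: "?Y \<subseteq> gates C" using wf unfolding wf_circuit_def by auto
  have IH: "card (trees_at C w y) = val y" if "y \<in> ?Y" for y
    using less.hyps[of y] rk Y that unfolding ranked_def by auto
  have "card (trees_at C w g) = (case label C g of
        And \<Rightarrow> \<Prod>y\<in>?Y. card (trees_at C w y)
      | Or \<Rightarrow> \<Sum>y\<in>?Y. card (trees_at C w y)
      | l \<Rightarrow> of_bool (true_label w l))"
    using trees_at_rec[OF wf less.prems] finite_trees_at[OF wf rk] Y by blast
  also have "\<dots> = val g"
    unfolding val[OF less.prems]
    using prod.cong[OF refl IH, of ?Y] sum.cong[OF refl IH, of ?Y] by (simp cong: gate.case_cong)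
  finally show ?case .
qed

text \<open>By induction on the rank the recursion has only one solution, so it suffices to exhibit
  a closed form \<open>val\<close> for the number of trees at every gate.\<close>

lemma num_proof_trees_eq_value:
  assumes "wf_circuit n C" "ranked C rk"
    and "\<And>g. g \<in> gates C \<Longrightarrow> val g = (case label C g of
        And \<Rightarrow> \<Prod>y\<in>children C `` {g}. val y
      | Or \<Rightarrow> \<Sum>y\<in>children C `` {g}. val y
      | l \<Rightarrow> of_bool (true_label w l))"
  shows "num_proof_trees C w = val (out_gate C)"
  using card_trees_at[OF assms(1,2) _ assms(3), of "out_gate C"] assms(1)
  unfolding trees_at_def num_proof_trees_def wf_circuit_def by simp

lemma ranked_acyclic:
  assumes "ranked C rk" shows "acyclic (children C)"
proof -
  have "(children C)\<inverse> \<subseteq> measure rk" using assms by (auto simp: ranked_def)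
  then have "wf ((children C)\<inverse>)" by (rule wf_subset[OF wf_measure])
  then show ?thesis using wf_acyclic acyclic_converse by blast
qed

lemma ranked_path_length:
  assumes "ranked C rk" "successively (\<lambda>x y. (x, y) \<in> children C) p" "p \<noteq> []"
  shows "length p - 1 \<le> rk (hd p)"
  using assms(2,3)
proof (induction p)
  case (Cons x p)
  show ?case
  proof (cases p)
    case (Cons y q)
    then have "rk y < rk x" using assms(1) Cons.prems by (auto simp: ranked_def)
    moreover have "length p - 1 \<le> rk y" using Cons.IH Cons.prems Cons by simp
    ultimately show ?thesis using Cons by simp
  qed simp
qed simp

lemma ranked_circuit_depth:
  assumes "ranked C rk" shows "circuit_depth C \<le> rk (out_gate C)"
proof -
  have *: "length p - 1 \<le> rk (out_gate C)" if "p \<in> tree_unfolding C" for p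
    using ranked_path_length[OF assms, of p] that by (simp add: tree_unfolding_def)
  have "(\<lambda>p. length p - 1) ` tree_unfolding C \<subseteq> {..rk (out_gate C)}"
    by (rule image_subsetI, rule atMost_iff[THEN iffD2], rule *)
  then have "finite ((\<lambda>p. length p - 1) ` tree_unfolding C)" by (rule finite_subset) simp
  moreover have "tree_unfolding C \<noteq> {}" unfolding tree_unfolding_def
    by (auto intro!: exI[of _ "[out_gate C]"])
  ultimately show ?thesis unfolding circuit_depth_def using *
    by (intro Max.boundedI) blast+
qed

section \<open>Transport of a circuit along an injection of its gates\<close>

definition map_circuit :: "('g \<Rightarrow> 'h) \<Rightarrow> 'g circuit \<Rightarrow> 'h circuit" where
  "map_circuit h C =
     \<lparr>gates = h ` gates C,
      children = map_prod h h ` children C,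
      label = (\<lambda>x. label C (inv_into (gates C) h x)),
      out_gate = h (out_gate C)\<rparr>"

lemma map_circuit_simps [simp]:
  "gates (map_circuit h C) = h ` gates C"
  "children (map_circuit h C) = map_prod h h ` children C"
  "out_gate (map_circuit h C) = h (out_gate C)"
  by (simp_all add: map_circuit_def)

context
  fixes h :: "'g \<Rightarrow> 'h" and C :: "'g circuit" and n :: nat
  assumes inj: "inj_on h (gates C)" and wf: "wf_circuit n C"
begin

lemma label_map_circuit: "g \<in> gates C \<Longrightarrow> label (map_circuit h C) (h g) = label C g"
  using inj by (simp add: map_circuit_def)

lemma children_image_map_circuit:
  assumes "g \<in> gates C"
  shows "(map_prod h h ` children C) `` {h g} = h ` (children C `` {g})"
proof (intro equalityI subsetI)
  fix y assume "y \<in> (map_prod h h ` children C) `` {h g}"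
  then obtain x' y' where xy: "(x', y') \<in> children C" "h g = h x'" "y = h y'" by auto
  then have "x' \<in> gates C" using wf by (auto simp: wf_circuit_def)
  then have "g = x'" using inj assms xy by (auto dest: inj_onD)
  then show "y \<in> h ` (children C `` {g})" using xy by auto
qed force

lemma ranked_map_circuit:
  assumes "ranked C rk"
  shows "ranked (map_circuit h C) (\<lambda>x. rk (inv_into (gates C) h x))"
  unfolding ranked_def
proof (clarsimp, goal_cases)
  case (1 x y)
  then have "x \<in> gates C" "y \<in> gates C" using wf by (auto simp: wf_circuit_def)
  then show ?case using assms 1 inj by (auto simp: ranked_def)
qed

lemma wf_map_circuit:
  assumes "ranked C rk" shows "wf_circuit n (map_circuit h C)"
  unfolding wf_circuit_def
proof (intro conjI ballI)
  show "acyclic (children (map_circuit h C))"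
    using ranked_acyclic[OF ranked_map_circuit[OF assms]] .
  fix x assume "x \<in> gates (map_circuit h C)"
  then obtain g where g: "g \<in> gates C" "x = h g" by auto
  then show "label (map_circuit h C) x \<notin> {And, Or} \<longrightarrow> children (map_circuit h C) `` {x} = {}"
    using wf by (simp add: children_image_map_circuit label_map_circuit wf_circuit_def)
  show "\<forall>i. label (map_circuit h C) x \<in> {Input i, NegInput i} \<longrightarrow> i < n"
    using wf g by (simp add: label_map_circuit wf_circuit_def)
qed (use wf in \<open>auto simp: wf_circuit_def\<close>)

text \<open>The counts of the original circuit, read at the preimages, solve the recursion of the
  image because \<open>h\<close> is injective on each set of children.\<close>

lemma num_proof_trees_map_circuit:
  assumes "ranked C rk"
  shows "num_proof_trees (map_circuit h C) w = num_proof_trees C w"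
proof -
  have C: "children C `` {g} \<subseteq> gates C" for g using wf by (auto simp: wf_circuit_def)
  have inj': "inj_on h (children C `` {g})" for g using inj C by (rule inj_on_subset)
  define val where "val g = card (trees_at C w g)" for g
  have val: "val g = (case label C g of
        And \<Rightarrow> \<Prod>y\<in>children C `` {g}. val y
      | Or \<Rightarrow> \<Sum>y\<in>children C `` {g}. val y
      | l \<Rightarrow> of_bool (true_label w l))" if "g \<in> gates C" for g
    using trees_at_rec[OF wf that] finite_trees_at[OF wf assms] C unfolding val_def by blast
  define val' where "val' x = val (inv_into (gates C) h x)" for x
  have val': "val' (h g) = val g" if "g \<in> gates C" for g using that inj by (simp add: val'_def)
  have "num_proof_trees (map_circuit h C) w = val' (out_gate (map_circuit h C))"
  proof (rule num_proof_trees_eq_value[OF wf_map_circuit ranked_map_circuit])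
    fix x assume "x \<in> gates (map_circuit h C)"
    then obtain g where g: "g \<in> gates C" "x = h g" by auto
    have "(\<Prod>y\<in>h ` (children C `` {g}). val' y) = (\<Prod>y\<in>children C `` {g}. val y)"
      "(\<Sum>y\<in>h ` (children C `` {g}). val' y) = (\<Sum>y\<in>children C `` {g}. val y)"
      using C[of g] by (simp_all add: prod.reindex[OF inj'] sum.reindex[OF inj'])
        (auto intro!: prod.cong sum.cong val')
    then show "val' x = (case label (map_circuit h C) x of
        And \<Rightarrow> \<Prod>y\<in>children (map_circuit h C) `` {x}. val' y
      | Or \<Rightarrow> \<Sum>y\<in>children (map_circuit h C) `` {x}. val' y
      | l \<Rightarrow> of_bool (true_label w l))"
      using val[OF g(1)] val'[OF g(1)] unfolding g(2) label_map_circuit[OF g(1)]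
      by (simp add: children_image_map_circuit[OF g(1)] cong: gate.case_cong)
  qed (rule assms)+
  also have "\<dots> = num_proof_trees C w"
    using wf by (simp add: val' val_def trees_at_def num_proof_trees_def wf_circuit_def)
  finally show ?thesis .
qed

end

section \<open>Assembling uniform families\<close>

text \<open>The label conditions include membership in the gates because \<open>label\<close> is
  arbitrary on other tuples. The edge condition reads its source from the first \<open>D\<close>
  variables and its target from the next \<open>D\<close>.\<close>

lemma fo_uniformI:
  fixes C :: "nat \<Rightarrow> nat list circuit"
  assumes D: "D > 0"
    and wf: "\<And>n. wf_circuit n (C n)"
    and gates: "\<And>n. n > 0 \<Longrightarrow> gates (C n) \<subseteq> tuples n D"
    and U: "fo (\<lambda>w v. map v [0..<D] \<in> gates (C (length w)))"
    and E: "fo (\<lambda>w v. (map v [0..<D], map v [D..<D + D]) \<in> children (C (length w)))"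
    and lAnd: "fo (\<lambda>w v. map v [0..<D] \<in> gates (C (length w)) \<and>
      label (C (length w)) (map v [0..<D]) = And)"
    and lOr: "fo (\<lambda>w v. map v [0..<D] \<in> gates (C (length w)) \<and>
      label (C (length w)) (map v [0..<D]) = Or)"
    and lB: "fo (\<lambda>w v. map v [0..<D] \<in> gates (C (length w)) \<and>
      true_label w (label (C (length w)) (map v [0..<D])))"
    and R: "fo (\<lambda>w v. map v [0..<D] = out_gate (C (length w)))"
  shows "fo_uniform C"
proof -
  define is_fml where "is_fml P \<phi> \<longleftrightarrow> wf_fml string_vocab [] \<phi> \<and> fvars \<phi> \<subseteq> {..<D} \<and>
      (\<forall>w x. w \<noteq> [] \<longrightarrow> x \<in> tuples (length w) D \<longrightarrow> sat (string_struc w) [] ((!) x) \<phi> = P w x)" for P \<phi>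
  have formula: "\<exists>\<phi>. is_fml P \<phi>" if P: "fo (\<lambda>w v. P w (map v [0..<D]))" for P
  proof (rule fo_formula[OF P D])
    fix w and v v' :: "nat \<Rightarrow> nat"
    assume "\<And>i. i < D \<Longrightarrow> v i = v' i"
    then have "map v [0..<D] = map v' [0..<D]" by simp
    then show "P w (map v [0..<D]) = P w (map v' [0..<D])" by (simp only:)
  next
    fix \<phi> assume \<phi>: "wf_fml string_vocab [] \<phi>" "fvars \<phi> \<subseteq> {..<D}"
      "\<And>w x. w \<noteq> [] \<Longrightarrow> x \<in> tuples (length w) D \<Longrightarrow>
         sat (string_struc w) [] ((!) x) \<phi> = P w (map ((!) x) [0..<D])"
    have "map ((!) x) [0..<D] = x" if "x \<in> tuples n D" for x n
      using that map_nth[of x] by (simp add: tuples_def)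
    with \<phi> show ?thesis unfolding is_fml_def by (intro exI[of _ \<phi>]) simp
  qed
  obtain \<phi>U where U': "is_fml (\<lambda>w x. x \<in> gates (C (length w))) \<phi>U"
    using formula[OF U] by blast
  obtain \<phi>A where A': "is_fml (\<lambda>w x. x \<in> gates (C (length w)) \<and> label (C (length w)) x = And) \<phi>A"
    using formula[OF lAnd] by blast
  obtain \<phi>O where O': "is_fml (\<lambda>w x. x \<in> gates (C (length w)) \<and> label (C (length w)) x = Or) \<phi>O"
    using formula[OF lOr] by blast
  obtain \<phi>B where B': "is_fml (\<lambda>w x. x \<in> gates (C (length w)) \<and>
      true_label w (label (C (length w)) x)) \<phi>B"
    using formula[OF lB] by blast
  obtain \<phi>R where R': "is_fml (\<lambda>w x. x = out_gate (C (length w))) \<phi>R"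
    using formula[OF R] by blast
  obtain \<phi>E where E': "wf_fml string_vocab [] \<phi>E" "fvars \<phi>E \<subseteq> {..<D + D}"
    "\<And>w z. w \<noteq> [] \<Longrightarrow> z \<in> tuples (length w) (D + D) \<Longrightarrow> sat (string_struc w) [] ((!) z) \<phi>E =
       ((map ((!) z) [0..<D], map ((!) z) [D..<D + D]) \<in> children (C (length w)))"
  proof (rule fo_formula[OF E, of "D + D"])
    fix w :: "bool list" and v v' :: "nat \<Rightarrow> nat"
    assume "\<And>i. i < D + D \<Longrightarrow> v i = v' i"
    then have "map v [0..<D] = map v' [0..<D]" "map v [D..<D + D] = map v' [D..<D + D]"
      by simp_all
    then show "((map v [0..<D], map v [D..<D + D]) \<in> children (C (length w))) =
      ((map v' [0..<D], map v' [D..<D + D]) \<in> children (C (length w)))" by (simp only:)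
  qed (use D in auto)
  have E'': "sat (string_struc w) [] ((!) (x @ y)) \<phi>E = ((x, y) \<in> children (C (length w)))"
    if "w \<noteq> []" "x \<in> tuples (length w) D" "y \<in> tuples (length w) D" for w x y
  proof -
    have "x @ y \<in> tuples (length w) (D + D)" using that by (auto simp: tuples_def)
    moreover have "map ((!) (x @ y)) [0..<D] = x" "map ((!) (x @ y)) [D..<D + D] = y"
      using that by (auto simp: tuples_def intro!: nth_equalityI simp: nth_append)
    ultimately show ?thesis using E'(3)[OF that(1)] by simp
  qed
  define I where "I = \<lparr>dim = D, fmlU = \<phi>U, fmlE = \<phi>E, fmlAnd = \<phi>A, fmlOr = \<phi>O, fmlB = \<phi>B, fmlR = \<phi>R\<rparr>"
  have "wf_interp string_vocab I"
    using U' A' O' B' R' E'(1,2) by (simp add: is_fml_def wf_interp_def I_def mult_2)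
  moreover have "interpret_struc I (string_struc w) = circuit_struc (C (length w)) w" if w: "w \<noteq> []" for w
  proof -
    have size: "usize (string_struc w) = length w" by (simp add: string_struc_def)
    have g: "gates (C (length w)) \<subseteq> tuples (length w) D" using gates w by simp
    have sel: "{x \<in> X. sat (string_struc w) [] ((!) x) \<phi>} = {x \<in> X. P w x}"
      if "is_fml P \<phi>" "X \<subseteq> tuples (length w) D" for P \<phi> X
      using that w unfolding is_fml_def by blast
    have univ: "interp_univ I (string_struc w) = gates (C (length w))"
      using sel[OF U' order_refl] g by (auto simp: interp_univ_def I_def size)
    have ch: "children (C (length w)) \<subseteq> gates (C (length w)) \<times> gates (C (length w))"
      "out_gate (C (length w)) \<in> gates (C (length w))"
      using wf[of "length w"] by (auto simp: wf_circuit_def)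
    have "{(x, y) \<in> gates (C (length w)) \<times> gates (C (length w)). sat (string_struc w) [] ((!) (x @ y)) \<phi>E}
      = children (C (length w))"
      using E''[OF w] g ch(1) by blast
    moreover have "{x \<in> gates (C (length w)). x = out_gate (C (length w))} = {out_gate (C (length w))}"
      using ch(2) by blast
    ultimately show ?thesis
      unfolding interpret_struc_def circuit_struc_def univ
      using sel[OF A' g] sel[OF O' g] sel[OF B' g] sel[OF R' g]
      by (simp add: I_def cong: conj_cong)
  qed
  ultimately show ?thesis unfolding fo_uniform_def by blast
qed

text \<open>
  Abstract gates are pairs of a tag and a tuple. They become tuples of fixed length by writing the
  tag as a unit vector and padding with zeros; this needs a universe with at least two elements.
\<close>

definition tag_code :: "nat \<Rightarrow> nat \<Rightarrow> nat \<times> nat list \<Rightarrow> nat list" where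
  "tag_code N Q = (\<lambda>(\<tau>, xs). map (\<lambda>i. of_bool (i = \<tau>)) [0..<N] @ xs @ replicate (Q - length xs) 0)"

definition is_tag_code :: "nat \<Rightarrow> nat \<Rightarrow> nat \<Rightarrow> nat \<Rightarrow> nat \<Rightarrow> (nat \<Rightarrow> nat) \<Rightarrow> bool" where
  "is_tag_code N Q l \<tau> b v \<longleftrightarrow>
     (\<forall>i<N. v (b + i) = of_bool (i = \<tau>)) \<and> (\<forall>i<Q. l \<le> i \<longrightarrow> v (b + N + i) = 0)"

lemma fo_is_tag_code: "fo (\<lambda>w v. is_tag_code N Q l \<tau> b v)"
  unfolding is_tag_code_def by (intro fo_conj fo_finite_all fo_imp fo_const fo_eq_const)

text \<open>Separates the tag and the padding, a fixed pattern of zeros and ones, from the payload,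
  a segment of the variables.\<close>

lemma eq_tag_code_iff:
  assumes "length xs \<le> Q"
  shows "map v [b..<b + (N + Q)] = tag_code N Q (\<tau>, xs) \<longleftrightarrow>
    is_tag_code N Q (length xs) \<tau> b v \<and> xs = map v [b + N..<b + N + length xs]"
proof -
  let ?l = "length xs"
  have split: "[b..<b + (N + Q)] = [b..<b + N] @ [b + N..<b + N + ?l] @ [b + N + ?l..<b + N + Q]"
    using assms upt_add_eq_append[of b "b + N" Q] upt_add_eq_append[of "b + N" "b + N + ?l" "Q - ?l"]
    by (simp add: add.assoc)
  have 1: "map v [b..<b + N] = map (\<lambda>i. of_bool (i = \<tau>)) [0..<N] \<longleftrightarrow> (\<forall>i<N. v (b + i) = of_bool (i = \<tau>))"
    by (auto simp: list_eq_iff_nth_eq)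
  have 2: "map v [b + N + ?l..<b + N + Q] = replicate (Q - ?l) 0 \<longleftrightarrow>
    (\<forall>i<Q. ?l \<le> i \<longrightarrow> v (b + N + i) = 0)"
  proof -
    have "(\<forall>i<Q - ?l. v (b + N + ?l + i) = 0) \<longleftrightarrow> (\<forall>i<Q. ?l \<le> i \<longrightarrow> v (b + N + i) = 0)"
    proof (intro iffI allI impI)
      fix i assume "\<forall>i<Q - ?l. v (b + N + ?l + i) = 0" "i < Q" "?l \<le> i"
      then show "v (b + N + i) = 0" by (auto dest!: spec[of _ "i - ?l"] simp: add.assoc)
    next
      fix i assume "\<forall>i<Q. ?l \<le> i \<longrightarrow> v (b + N + i) = 0" "i < Q - ?l"
      then show "v (b + N + ?l + i) = 0" by (auto dest!: spec[of _ "?l + i"] simp: add.assoc)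
    qed
    then show ?thesis by (auto simp: list_eq_iff_nth_eq)
  qed
  have "map v [b..<b + (N + Q)] = tag_code N Q (\<tau>, xs) \<longleftrightarrow>
    map v [b..<b + N] = map (\<lambda>i. of_bool (i = \<tau>)) [0..<N] \<and>
    map v [b + N..<b + N + ?l] = xs \<and> map v [b + N + ?l..<b + N + Q] = replicate (Q - ?l) 0"
    unfolding split tag_code_def by (simp del: upt_Suc)
  then show ?thesis unfolding 1 2 is_tag_code_def by auto
qed

lemma length_tag_code: "length xs \<le> Q \<Longrightarrow> length (tag_code N Q (\<tau>, xs)) = N + Q"
  by (simp add: tag_code_def)

lemma inj_on_tag_code:
  "inj_on (tag_code N Q) {(\<tau>, xs). \<tau> < N \<and> length xs = l \<tau>}"
proof (rule inj_onI, clarify)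
  fix \<tau> \<sigma> :: nat and xs ys :: "nat list"
  assume *: "\<tau> < N" "length xs = l \<tau>" "\<sigma> < N" "length ys = l \<sigma>"
    and eq: "tag_code N Q (\<tau>, xs) = tag_code N Q (\<sigma>, ys)"
  have "tag_code N Q (\<tau>, xs) ! \<tau> = 1" using *(1) by (simp add: tag_code_def nth_append)
  moreover have "tag_code N Q (\<sigma>, ys) ! \<tau> = of_bool (\<tau> = \<sigma>)"
    using *(1) by (simp add: tag_code_def nth_append)
  ultimately have "of_bool (\<tau> = \<sigma>) = (1::nat)" unfolding eq by simp
  then have "\<tau> = \<sigma>" by (simp only: of_bool_eq_1_iff)
  then show "\<tau> = \<sigma> \<and> xs = ys" using eq * by (simp add: tag_code_def)
qed

section \<open>Circuits for words of length 0 and 1\<close>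

definition star_circuit :: "nat \<Rightarrow> nat list circuit" where
  "star_circuit k = \<lparr>gates = insert [0] ((\<lambda>i. [Suc i]) ` {..<k}),
     children = {[0]} \<times> (\<lambda>i. [Suc i]) ` {..<k},
     label = (\<lambda>x. if x = [0] then Or else Const True), out_gate = [0]\<rparr>"

lemma ranked_star_circuit: "ranked (star_circuit k) (\<lambda>x. of_bool (x = [0]))"
  by (auto simp: ranked_def star_circuit_def)

lemma wf_star_circuit: "wf_circuit n (star_circuit k)"
  using ranked_acyclic[OF ranked_star_circuit[of k]]
  by (auto simp: wf_circuit_def star_circuit_def)

text \<open>The value on the empty word may be any number \<open>k\<close>; an \<open>Or\<close> of
  \<open>k\<close> true leaves attains it.\<close>

lemma num_proof_trees_star_circuit: "num_proof_trees (star_circuit k) w = k"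
proof -
  let ?S = "(\<lambda>i. [Suc i]) ` {..<k}" and ?val = "\<lambda>x. if x = [0] then k else 1"
  have "inj_on (\<lambda>i. [Suc i]) {..<k}" by (auto intro: inj_onI)
  then have "card ?S = k" by (simp add: card_image)
  moreover have "(\<Sum>y\<in>?S. ?val y) = (\<Sum>y\<in>?S. 1)" by (intro sum.cong) auto
  ultimately have sum: "(\<Sum>y\<in>?S. ?val y) = k" by simp
  have "num_proof_trees (star_circuit k) w = ?val (out_gate (star_circuit k))"
  proof (rule num_proof_trees_eq_value[OF wf_star_circuit ranked_star_circuit])
    fix g
    have "children (star_circuit k) `` {[0]} = ?S" by (auto simp: star_circuit_def)
    then show "?val g = (case label (star_circuit k) g of
        And \<Rightarrow> \<Prod>y\<in>children (star_circuit k) `` {g}. ?val y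
      | Or \<Rightarrow> \<Sum>y\<in>children (star_circuit k) `` {g}. ?val y
      | l \<Rightarrow> of_bool (true_label w l))"
      using sum by (cases "g = [0]") (simp_all add: star_circuit_def)
  qed
  then show ?thesis by (simp add: star_circuit_def)
qed

text \<open>Over a universe of one element there is just one tuple of each length, hence room for
  one gate only.\<close>

definition single_gate_circuit :: "'g \<Rightarrow> gate \<Rightarrow> 'g circuit" where
  "single_gate_circuit g l = \<lparr>gates = {g}, children = {}, label = (\<lambda>_. l), out_gate = g\<rparr>"

lemma ranked_single_gate_circuit: "ranked (single_gate_circuit g l) (\<lambda>_. 0)"
  by (simp add: ranked_def single_gate_circuit_def)

lemma wf_single_gate_circuit:
  "(\<And>i. l \<in> {Input i, NegInput i} \<Longrightarrow> i < n) \<Longrightarrow> wf_circuit n (single_gate_circuit g l)"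
  by (auto simp: wf_circuit_def single_gate_circuit_def acyclic_def)

lemma num_proof_trees_single_gate_circuit:
  assumes "l \<notin> {And, Or}"
  shows "num_proof_trees (single_gate_circuit g l) w = of_bool (true_label w l)"
proof -
  have "trees_at (single_gate_circuit g l) w g = (if true_label w l then {{[g]}} else {})"
    using trees_at_leaf[of "single_gate_circuit g l" g w] assms
    by (simp add: single_gate_circuit_def)
  moreover have "(single_gate_circuit g l)\<lparr>out_gate := g\<rparr> = single_gate_circuit g l"
    by (simp add: single_gate_circuit_def)
  ultimately show ?thesis by (simp add: num_proof_trees_def trees_at_def)
qed

text \<open>Splits an edge between codes into two memberships in images of sets of gates, linked by
  the source \<open>x\<close>, so that source and target can be decoded separately.\<close>

lemma mem_map_prod_image_iff:
  "(a, b) \<in> map_prod h h ` R \<longleftrightarrow>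
    (\<exists>x. a \<in> h ` {y. y = x \<and> (\<exists>z. (y, z) \<in> R)} \<and> b \<in> h ` {y. (x, y) \<in> R})"
proof
  assume "(a, b) \<in> map_prod h h ` R"
  then obtain x y where "(x, y) \<in> R" "a = h x" "b = h y" by auto
  then show "\<exists>x. a \<in> h ` {y. y = x \<and> (\<exists>z. (y, z) \<in> R)} \<and> b \<in> h ` {y. (x, y) \<in> R}" by blast
qed force

text \<open>Reduces the task to tagged gates and words of length at least 2. For length 1 the
  circuit is a single leaf, which explains the bound \<open>f w \<le> 1\<close>; \<open>f []\<close>
  is arbitrary.\<close>

lemma fo_uniform_sharp_AC0I:
  fixes A :: "nat \<Rightarrow> (nat \<times> nat list) circuit" and arity :: "nat \<Rightarrow> nat"
  assumes gates: "\<And>n. n \<ge> 2 \<Longrightarrow> gates (A n) \<subseteq> {(\<tau>, xs). \<tau> < N \<and> xs \<in> tuples n (arity \<tau>)}"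
    and wf: "\<And>n. n \<ge> 2 \<Longrightarrow> wf_circuit n (A n)"
    and ranked: "\<And>n. n \<ge> 2 \<Longrightarrow> ranked (A n) (\<lambda>(\<tau>, xs). rk \<tau>)"
    and out: "\<And>n. n \<ge> 2 \<Longrightarrow> out_gate (A n) = (0, [])" "N > 0" "arity 0 = 0"
    and foU: "\<And>\<tau> a. \<tau> < N \<Longrightarrow> fo (\<lambda>w v. (\<tau>, map v [a..<a + arity \<tau>]) \<in> gates (A (length w)))"
    and foE: "\<And>\<tau> \<sigma> a b. \<tau> < N \<Longrightarrow> \<sigma> < N \<Longrightarrow>
      fo (\<lambda>w v. ((\<tau>, map v [a..<a + arity \<tau>]), (\<sigma>, map v [b..<b + arity \<sigma>])) \<in> children (A (length w)))"
    and label: "\<And>n \<tau> xs. n \<ge> 2 \<Longrightarrow> (\<tau>, xs) \<in> gates (A n) \<Longrightarrow>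
      (label (A n) (\<tau>, xs) = And \<longleftrightarrow> \<tau> \<in> ands) \<and> (label (A n) (\<tau>, xs) = Or \<longleftrightarrow> \<tau> \<in> ors)"
    and foB: "\<And>\<tau> a. \<tau> < N \<Longrightarrow> fo (\<lambda>w v. (\<tau>, map v [a..<a + arity \<tau>]) \<in> gates (A (length w)) \<and>
      true_label w (label (A (length w)) (\<tau>, map v [a..<a + arity \<tau>])))"
    and val: "\<And>w. length w \<ge> 2 \<Longrightarrow> f w = num_proof_trees (A (length w)) w"
    and small: "\<And>w. length w = 1 \<Longrightarrow> f w \<le> 1"
  shows "f \<in> fo_uniform_sharp_AC0"
proof -
  define Q where "Q = (\<Sum>\<tau><N. arity \<tau>)"
  define D where "D = N + Q"
  define h where "h = tag_code N Q"
  have arity: "arity \<tau> \<le> Q" if "\<tau> < N" for \<tau>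
    unfolding Q_def using that by (intro member_le_sum) auto
  have gatesD: "\<tau> < N" "length xs = arity \<tau>" "set xs \<subseteq> {..<n}"
    if "n \<ge> 2" "(\<tau>, xs) \<in> gates (A n)" for n \<tau> xs
    using gates[OF that(1)] that(2) by (auto simp: tuples_def)
  \<comment> \<open>The four cases are the four Boolean functions of one input bit.\<close>
  define l1 where "l1 = (if f [True] \<ge> 1 \<and> f [False] \<ge> 1 then Const True
    else if f [True] \<ge> 1 then Input 0 else if f [False] \<ge> 1 then NegInput 0 else Const False)"
  define C where "C n = (if n = 0 then star_circuit (f []) else if n = 1
    then single_gate_circuit (replicate D 0) l1 else map_circuit h (A n))" for n
  have C: "C 0 = star_circuit (f [])" "C 1 = single_gate_circuit (replicate D 0) l1"
    "\<And>n. n \<ge> 2 \<Longrightarrow> C n = map_circuit h (A n)"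
    "C (Suc 0) = single_gate_circuit (replicate D 0) l1"
    by (simp_all add: C_def)
  have n_cases: "n = 0 \<or> n = 1 \<or> n \<ge> 2" for n :: nat by auto
  have D: "D > 0" using out by (simp add: D_def)
  have inj: "inj_on h (gates (A n))" if "n \<ge> 2" for n
    unfolding h_def by (rule inj_on_subset[OF inj_on_tag_code[of N Q arity]]) (use gatesD[OF that] in auto)
  have wfC: "wf_circuit n (C n)" for n
    using n_cases[of n] wf_map_circuit[OF inj wf ranked, of n] C
    by (auto simp: wf_star_circuit l1_def intro!: wf_single_gate_circuit split: if_splits)
  have l1: "true_label w l1 \<longleftrightarrow> f w \<ge> 1" "l1 \<notin> {And, Or}" if "length w = 1" for w
  proof -
    have "w = [True] \<or> w = [False]" using that by (cases w) auto
    then show "true_label w l1 \<longleftrightarrow> f w \<ge> 1" "l1 \<notin> {And, Or}" by (auto simp: l1_def)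
  qed
  have fC: "f w = num_proof_trees (C (length w)) w" for w
  proof -
    consider "w = []" | "length w = 1" | "length w \<ge> 2" using n_cases[of "length w"] by auto
    then show ?thesis
    proof cases
      case 2
      then show ?thesis using l1[OF 2] small[OF 2]
        unfolding 2 C(2) by (cases "true_label w l1") (auto simp: num_proof_trees_single_gate_circuit)
    next
      case 3
      then show ?thesis
        using num_proof_trees_map_circuit[OF inj wf ranked, of "length w" w] val C(3) by simp
    qed (simp add: C num_proof_trees_star_circuit)
  qed
  have gatesC: "gates (C n) \<subseteq> tuples n D" if "n > 0" for n
  proof (cases "n = 1")
    case False
    then have n: "n \<ge> 2" using that by simp
    have "tag_code N Q (\<tau>, xs) \<in> tuples n D" if "(\<tau>, xs) \<in> gates (A n)" for \<tau> xs
      using gatesD[OF n that] arity[of \<tau>] n length_tag_code[of xs Q N \<tau>]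
      unfolding tuples_def D_def tag_code_def by (auto simp: of_bool_def)
    then show ?thesis by (auto simp: C(3)[OF n] h_def)
  qed (auto simp: C single_gate_circuit_def tuples_def)
  \<comment> \<open>A block of \<open>D\<close> variables is decoded by a disjunction over the
    finitely many tags. The tag fixes the arity and with it the variables that hold the
    tuple.\<close>
  have code: "map v [b..<b + D] \<in> h ` X \<longleftrightarrow> (\<exists>\<tau><N. is_tag_code N Q (arity \<tau>) \<tau> b v \<and>
      (\<tau>, map v [b + N..<b + N + arity \<tau>]) \<in> X)"
    if X: "\<And>\<tau> xs. (\<tau>, xs) \<in> X \<Longrightarrow> \<tau> < N \<and> length xs = arity \<tau>" for X b and v :: "nat \<Rightarrow> nat"
  proof
    assume "map v [b..<b + D] \<in> h ` X"
    then obtain \<tau> xs where *: "(\<tau>, xs) \<in> X" "map v [b..<b + D] = h (\<tau>, xs)" by auto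
    moreover have "length xs \<le> Q" using X[OF *(1)] arity by auto
    ultimately have "is_tag_code N Q (length xs) \<tau> b v" "xs = map v [b + N..<b + N + length xs]"
      unfolding D_def h_def by (simp_all only: eq_tag_code_iff)
    then show "\<exists>\<tau><N. is_tag_code N Q (arity \<tau>) \<tau> b v \<and> (\<tau>, map v [b + N..<b + N + arity \<tau>]) \<in> X"
      using X[OF *(1)] *(1) by metis
  next
    assume "\<exists>\<tau><N. is_tag_code N Q (arity \<tau>) \<tau> b v \<and> (\<tau>, map v [b + N..<b + N + arity \<tau>]) \<in> X"
    then obtain \<tau> where *: "\<tau> < N" "is_tag_code N Q (arity \<tau>) \<tau> b v"
      "(\<tau>, map v [b + N..<b + N + arity \<tau>]) \<in> X" by blast
    then have "map v [b..<b + D] = h (\<tau>, map v [b + N..<b + N + arity \<tau>])"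
      unfolding D_def h_def using arity by (subst eq_tag_code_iff) auto
    then show "map v [b..<b + D] \<in> h ` X" using * by auto
  qed
  \<comment> \<open>One scheme for all properties of single gates: \<open>P1\<close> answers for
    words of length 1, and \<open>P'\<close> states the property on abstract gates for longer
    words.\<close>
  have foC: "fo (\<lambda>w v. map v [b..<b + D] \<in> gates (C (length w)) \<and> P w (map v [b..<b + D]))"
    if "\<And>\<tau> a. \<tau> < N \<Longrightarrow> fo (\<lambda>w v. (\<tau>, map v [a..<a + arity \<tau>]) \<in> gates (A (length w)) \<and>
        P' w (\<tau>, map v [a..<a + arity \<tau>]))"
      and P1: "fo (\<lambda>w v. P1 w)"
      and P: "\<And>w. length w = 1 \<Longrightarrow> P w (replicate D 0) \<longleftrightarrow> P1 w"
        "\<And>w g. length w \<ge> 2 \<Longrightarrow> g \<in> gates (A (length w)) \<Longrightarrow> P w (h g) \<longleftrightarrow> P' w g"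
    for b P P' P1
  proof -
    have "fo (\<lambda>w v. if length w = 1 then P1 w else
      \<exists>\<tau><N. is_tag_code N Q (arity \<tau>) \<tau> b v \<and>
        (\<tau>, map v [b + N..<b + N + arity \<tau>]) \<in> gates (A (length w)) \<and>
        P' w (\<tau>, map v [b + N..<b + N + arity \<tau>]))"
      by (intro fo_if fo_length_eq fo_finite_ex fo_conj[OF fo_is_tag_code] that(1) P1)
    then show ?thesis
    proof (rule fo_cong)
      fix w :: "bool list" and v :: "nat \<Rightarrow> nat"
      assume "w \<noteq> []" and v: "\<And>i. v i < length w"
      show "(map v [b..<b + D] \<in> gates (C (length w)) \<and> P w (map v [b..<b + D])) =
        (if length w = 1 then P1 w else
      \<exists>\<tau><N. is_tag_code N Q (arity \<tau>) \<tau> b v \<and>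
        (\<tau>, map v [b + N..<b + N + arity \<tau>]) \<in> gates (A (length w)) \<and>
        P' w (\<tau>, map v [b + N..<b + N + arity \<tau>]))"
      proof (cases "length w = 1")
        case True
        then have "map v [b..<b + D] = replicate D 0"
          using v by (auto intro!: nth_equalityI)
        then show ?thesis using True P(1) by (simp add: C single_gate_circuit_def)
      next
        case False
        then have n: "length w \<ge> 2" using n_cases[of "length w"] \<open>w \<noteq> []\<close> by auto
        have "map v [b..<b + D] \<in> gates (C (length w)) \<and> P w (map v [b..<b + D]) \<longleftrightarrow>
          map v [b..<b + D] \<in> h ` {g \<in> gates (A (length w)). P' w g}"
          unfolding C(3)[OF n] using P(2)[OF n] by auto
        also have "\<dots> \<longleftrightarrow> (\<exists>\<tau><N. is_tag_code N Q (arity \<tau>) \<tau> b v \<and>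
          (\<tau>, map v [b + N..<b + N + arity \<tau>]) \<in> {g \<in> gates (A (length w)). P' w g})"
          by (rule code) (use gatesD[OF n] in auto)
        finally show ?thesis using False by simp
      qed
    qed
  qed
  have "fo_uniform C"
  proof (rule fo_uniformI[OF D wfC gatesC])
    have "fo (\<lambda>w v. map v [0..<0 + D] \<in> gates (C (length w)) \<and> True)"
      by (rule foC[of "\<lambda>w g. True" "\<lambda>w. True"]) (auto intro: foU fo_const)
    then show "fo (\<lambda>w v. map v [0..<D] \<in> gates (C (length w)))" by simp
    have lab: "label (map_circuit h (A n)) (h g) = label (A n) g" if "n \<ge> 2" "g \<in> gates (A n)" for n g
      using label_map_circuit[OF inj wf] that by simp
    have "fo (\<lambda>w v. map v [0..<0 + D] \<in> gates (C (length w)) \<and>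
      label (C (length w)) (map v [0..<0 + D]) = And)"
    proof (rule foC[of "\<lambda>w g. fst g \<in> ands" "\<lambda>w. False"])
      fix w :: "bool list" and g assume n: "length w \<ge> 2" and g: "g \<in> gates (A (length w))"
      show "label (C (length w)) (h g) = And \<longleftrightarrow> fst g \<in> ands"
        using label[OF n, of "fst g" "snd g"] lab[OF n g] g C(3)[OF n] by simp
    next
      fix w :: "bool list" assume "length w = 1"
      then show "label (C (length w)) (replicate D 0) = And \<longleftrightarrow> False"
        using l1(2) C(2) by (auto simp: single_gate_circuit_def)
    qed (auto intro!: fo_conj foU fo_const)
    then show "fo (\<lambda>w v. map v [0..<D] \<in> gates (C (length w)) \<and>
      label (C (length w)) (map v [0..<D]) = And)" by simp
    have "fo (\<lambda>w v. map v [0..<0 + D] \<in> gates (C (length w)) \<and>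
      label (C (length w)) (map v [0..<0 + D]) = Or)"
    proof (rule foC[of "\<lambda>w g. fst g \<in> ors" "\<lambda>w. False"])
      fix w :: "bool list" and g assume n: "length w \<ge> 2" and g: "g \<in> gates (A (length w))"
      show "label (C (length w)) (h g) = Or \<longleftrightarrow> fst g \<in> ors"
        using label[OF n, of "fst g" "snd g"] lab[OF n g] g C(3)[OF n] by simp
    next
      fix w :: "bool list" assume "length w = 1"
      then show "label (C (length w)) (replicate D 0) = Or \<longleftrightarrow> False"
        using l1(2) C(2) by (auto simp: single_gate_circuit_def)
    qed (auto intro!: fo_conj foU fo_const)
    then show "fo (\<lambda>w v. map v [0..<D] \<in> gates (C (length w)) \<and>
      label (C (length w)) (map v [0..<D]) = Or)" by simp
    have fo1: "fo (\<lambda>w v. if (\<exists>z<length w. z = 0 \<and> w ! z) then f [True] \<ge> 1 else f [False] \<ge> 1)"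
      by (intro fo_if fo_intros)
    have "fo (\<lambda>w v. map v [0..<0 + D] \<in> gates (C (length w)) \<and>
      true_label w (label (C (length w)) (map v [0..<0 + D])))"
    proof (rule foC[OF foB fo1])
      fix w :: "bool list" and g assume n: "length w \<ge> 2" and g: "g \<in> gates (A (length w))"
      show "true_label w (label (C (length w)) (h g)) \<longleftrightarrow> true_label w (label (A (length w)) g)"
        using lab[OF n g] C(3)[OF n] by simp
    next
      fix w :: "bool list" assume w: "length w = 1"
      then have "w = [True] \<or> w = [False]" by (cases w) auto
      then show "true_label w (label (C (length w)) (replicate D 0)) =
        (if \<exists>z<length w. z = 0 \<and> w ! z then 1 \<le> f [True] else 1 \<le> f [False])"
        using l1(1)[OF w] C(2) by (auto simp: single_gate_circuit_def)
    qed
    then show "fo (\<lambda>w v. map v [0..<D] \<in> gates (C (length w)) \<and>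
      true_label w (label (C (length w)) (map v [0..<D])))" by simp
    have "fo (\<lambda>w v. map v [0..<0 + D] \<in> gates (C (length w)) \<and>
      map v [0..<0 + D] = out_gate (C (length w)))"
    proof (rule foC[of "\<lambda>w g. fst g = 0" "\<lambda>w. True"])
      fix w :: "bool list" and g assume n: "length w \<ge> 2" and g: "g \<in> gates (A (length w))"
      have "(0, []) \<in> gates (A (length w))" using wf[OF n] out(1)[OF n] by (auto simp: wf_circuit_def)
      then have "h g = h (0, []) \<longleftrightarrow> g = (0, [])" using inj_on_eq_iff[OF inj[OF n] g] by simp
      also have "\<dots> \<longleftrightarrow> fst g = 0" using gatesD(2)[OF n, of "fst g" "snd g"] g out(3) by (cases g) auto
      finally show "h g = out_gate (C (length w)) \<longleftrightarrow> fst g = 0" using C(3)[OF n] out(1)[OF n] by simp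
    qed (auto intro!: fo_conj foU fo_const simp: C single_gate_circuit_def)
    then show "fo (\<lambda>w v. map v [0..<D] = out_gate (C (length w)))"
      by (rule fo_cong) (use wfC in \<open>auto simp: wf_circuit_def\<close>)
    have "fo (\<lambda>w v. length w \<noteq> 1 \<and> (\<exists>\<tau><N. \<exists>\<sigma><N. is_tag_code N Q (arity \<tau>) \<tau> 0 v \<and>
      is_tag_code N Q (arity \<sigma>) \<sigma> D v \<and> ((\<tau>, map v [N..<N + arity \<tau>]),
        (\<sigma>, map v [D + N..<D + N + arity \<sigma>])) \<in> children (A (length w))))"
      by (intro fo_conj fo_not fo_length_eq fo_finite_ex fo_is_tag_code foE)
    then show "fo (\<lambda>w v. (map v [0..<D], map v [D..<D + D]) \<in> children (C (length w)))"
    proof (rule fo_cong)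
      fix w :: "bool list" and v :: "nat \<Rightarrow> nat"
      assume "w \<noteq> []"
      show "((map v [0..<D], map v [D..<D + D]) \<in> children (C (length w))) =
        (length w \<noteq> 1 \<and> (\<exists>\<tau><N. \<exists>\<sigma><N. is_tag_code N Q (arity \<tau>) \<tau> 0 v \<and>
      is_tag_code N Q (arity \<sigma>) \<sigma> D v \<and> ((\<tau>, map v [N..<N + arity \<tau>]),
        (\<sigma>, map v [D + N..<D + N + arity \<sigma>])) \<in> children (A (length w))))"
      proof (cases "length w = 1")
        case False
        then have n: "length w \<ge> 2" using n_cases[of "length w"] \<open>w \<noteq> []\<close> by auto
        have sub: "children (A (length w)) \<subseteq> gates (A (length w)) \<times> gates (A (length w))"
          using wf[OF n] by (simp add: wf_circuit_def)
        have "(map v [0..<D], map v [D..<D + D]) \<in> children (C (length w)) \<longleftrightarrow>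
          (\<exists>x. map v [0..<0 + D] \<in> h ` {y. y = x \<and> (\<exists>z. (y, z) \<in> children (A (length w)))} \<and>
             map v [D..<D + D] \<in> h ` {y. (x, y) \<in> children (A (length w))})"
          unfolding C(3)[OF n] map_circuit_simps mem_map_prod_image_iff by simp
        also have "\<dots> \<longleftrightarrow> (\<exists>x. (\<exists>\<tau><N. is_tag_code N Q (arity \<tau>) \<tau> 0 v \<and>
            (\<tau>, map v [0 + N..<0 + N + arity \<tau>]) \<in> {y. y = x \<and> (\<exists>z. (y, z) \<in> children (A (length w)))}) \<and>
          (\<exists>\<sigma><N. is_tag_code N Q (arity \<sigma>) \<sigma> D v \<and>
            (\<sigma>, map v [D + N..<D + N + arity \<sigma>]) \<in> {y. (x, y) \<in> children (A (length w))}))"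
        proof (rule ex_cong1, rule arg_cong2[where f = "(\<and>)"])
          fix x
          show "map v [0..<0 + D] \<in> h ` {y. y = x \<and> (\<exists>z. (y, z) \<in> children (A (length w)))} \<longleftrightarrow>
            (\<exists>\<tau><N. is_tag_code N Q (arity \<tau>) \<tau> 0 v \<and>
              (\<tau>, map v [0 + N..<0 + N + arity \<tau>]) \<in> {y. y = x \<and> (\<exists>z. (y, z) \<in> children (A (length w)))})"
            by (rule code) (use gatesD[OF n] sub in blast)
          show "map v [D..<D + D] \<in> h ` {y. (x, y) \<in> children (A (length w))} \<longleftrightarrow>
            (\<exists>\<sigma><N. is_tag_code N Q (arity \<sigma>) \<sigma> D v \<and>
              (\<sigma>, map v [D + N..<D + N + arity \<sigma>]) \<in> {y. (x, y) \<in> children (A (length w))})"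
            by (rule code) (use gatesD[OF n] sub in blast)
        qed
        finally show ?thesis using False by auto
      qed (simp add: C single_gate_circuit_def)
    qed
  qed
  moreover have "\<exists>d. \<forall>n. circuit_depth (C n) \<le> d"
  proof (intro exI allI)
    fix n :: nat
    consider "n = 0" | "n = 1" | "n \<ge> 2" using n_cases[of n] by auto
    \<comment> \<open>The output gate of the tagged circuits has rank \<open>rk 0\<close>; the
      summand \<open>1\<close> covers the star used for \<open>n = 0\<close>.\<close>
    then show "circuit_depth (C n) \<le> rk 0 + 1"
    proof cases
      case 1
      then show ?thesis using ranked_circuit_depth[OF ranked_star_circuit[of "f []"]]
        by (simp add: C star_circuit_def)
    next
      case 2
      then show ?thesis using ranked_circuit_depth[OF ranked_single_gate_circuit[of "replicate D (0::nat)" l1]]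
        unfolding C(2) 2 by simp
    next
      case 3
      have "(0, []) \<in> gates (A n)" using wf[OF 3] out(1)[OF 3] by (auto simp: wf_circuit_def)
      then show ?thesis
        using ranked_circuit_depth[OF ranked_map_circuit[OF inj wf ranked, of n]] 3 inj[OF 3] out(1)[OF 3]
        unfolding C(3)[OF 3] by simp
    qed
  qed
  moreover have "\<exists>c e. \<forall>n. circuit_size (C n) \<le> c * n ^ e + c"
  proof (intro exI allI)
    fix n :: nat
    \<comment> \<open>At \<open>n = 0\<close> the power vanishes, so the additive constant has to
      bound the star. For other \<open>n\<close> the gates are \<open>D\<close>-tuples.\<close>
    let ?c = "1 + circuit_size (C 0)"
    show "circuit_size (C n) \<le> ?c * n ^ D + ?c"
    proof (cases "n = 0")
      case False
      have "tuples n D = {xs. set xs \<subseteq> {..<n} \<and> length xs = D}" by (auto simp: tuples_def)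
      then have "finite (tuples n D)" "card (tuples n D) = n ^ D"
        by (simp_all add: finite_lists_length_eq card_lists_length_eq)
      then have "circuit_size (C n) \<le> n ^ D"
        unfolding circuit_size_def using card_mono[of "tuples n D" "gates (C n)"] gatesC[of n] False
        by simp
      then show ?thesis by (simp add: algebra_simps)
    qed simp
  qed
  ultimately show ?thesis
    unfolding fo_uniform_sharp_AC0_def using wfC fC by blast
qed

section \<open>Positions in the encoding of a structure\<close>

lemma length_concat_map: "length (concat (map f [0..<k])) = (\<Sum>i<k. length (f i))"
  by (induction k) auto

lemma nth_concat_map:
  assumes "R < k" "r < length (f R)"
  shows "concat (map f [0..<k]) ! ((\<Sum>i<R. length (f i)) + r) = f R ! r"
  using assms
proof (induction k)
  case (Suc k)
  show ?case
  proof (cases "R = k")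
    case True
    then show ?thesis using Suc.prems length_concat_map[of f k] by (simp add: nth_append)
  next
    case False
    then have R: "R < k" using Suc.prems by simp
    have "(\<Sum>i<R. length (f i)) + r < (\<Sum>i<Suc R. length (f i))" using Suc.prems by simp
    also have "\<dots> \<le> (\<Sum>i<k. length (f i))" using R by (intro sum_mono2) auto
    finally show ?thesis using Suc.IH[OF R Suc.prems(2)] by (simp add: nth_append length_concat_map)
  qed
qed simp

lemma prefix_sum_index:
  fixes l :: "nat \<Rightarrow> nat"
  shows "p < (\<Sum>i<k. l i) \<Longrightarrow> \<exists>R<k. \<exists>r<l R. p = (\<Sum>i<R. l i) + r"
proof (induction k)
  case (Suc k)
  show ?case
  proof (cases "p < (\<Sum>i<k. l i)")
    case True
    then show ?thesis using Suc.IH by (meson less_SucI)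
  next
    case False
    then show ?thesis using Suc.prems
      by (intro exI[of _ k] conjI exI[of _ "p - (\<Sum>i<k. l i)"]) auto
  qed
qed simp

text \<open>The tuple read as a numeral in base \<open>m\<close>, which is its index in
  lexicographic order.\<close>

fun rank :: "nat \<Rightarrow> nat list \<Rightarrow> nat" where
  "rank m [] = 0"
| "rank m (x # xs) = x * m ^ length xs + rank m xs"

lemma product_lists_replicate_Suc:
  "product_lists (replicate (Suc a) [0..<m]) =
     concat (map (\<lambda>x. map ((#) x) (product_lists (replicate a [0..<m]))) [0..<m])"
  by simp

lemma length_product_lists_replicate: "length (product_lists (replicate a [0..<m])) = m ^ a"
  by (induction a) (simp_all add: length_concat sum_list_triv comp_def)

text \<open>The tuples of length \<open>Suc a\<close> with first entry \<open>x\<close> form a block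
  of length \<open>m ^ a\<close> that starts at \<open>x * m ^ a\<close>.\<close>

lemma nth_rank:
  assumes "xs \<in> tuples m a"
  shows "rank m xs < m ^ a \<and> product_lists (replicate a [0..<m]) ! rank m xs = xs"
  using assms
proof (induction a arbitrary: xs)
  case 0
  then show ?case by (simp add: tuples_def)
next
  case (Suc a)
  then obtain x ys where xs: "xs = x # ys" "x < m" "ys \<in> tuples m a" "length ys = a"
    by (cases xs) (auto simp: tuples_def)
  let ?P = "product_lists (replicate a [0..<m])"
  note IH = Suc.IH[OF xs(3)]
  have "x * m ^ a + rank m ys < Suc x * m ^ a" using IH by simp
  also have "\<dots> \<le> m * m ^ a" using xs by (intro mult_le_mono1) simp
  finally have "rank m xs < m ^ Suc a" using xs by simp
  moreover have "concat (map (\<lambda>x. map ((#) x) ?P) [0..<m]) ! ((\<Sum>i<x. length (map ((#) i) ?P)) + rank m ys)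
      = map ((#) x) ?P ! rank m ys"
    by (rule nth_concat_map) (use xs IH in \<open>simp_all add: length_product_lists_replicate\<close>)
  then have "product_lists (replicate (Suc a) [0..<m]) ! rank m xs = xs"
    unfolding product_lists_replicate_Suc using xs IH by (simp add: length_product_lists_replicate)
  ultimately show ?case by blast
qed

lemma finite_tuples: "finite (tuples n a)" and card_tuples: "card (tuples n a) = n ^ a"
proof -
  have "tuples n a = {xs. set xs \<subseteq> {..<n} \<and> length xs = a}" by (auto simp: tuples_def)
  then show "finite (tuples n a)" "card (tuples n a) = n ^ a"
    by (simp_all add: finite_lists_length_eq card_lists_length_eq)
qed

text \<open>Surjectivity by counting: \<open>rank\<close> is injective by \<open>nth_rank\<close>,
  and both sets have \<open>m ^ a\<close> elements.\<close>

lemma rank_image: "rank m ` tuples m a = {..<m ^ a}"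
proof (rule card_subset_eq)
  show "rank m ` tuples m a \<subseteq> {..<m ^ a}" using nth_rank by auto
  have "inj_on (rank m) (tuples m a)" by (rule inj_onI) (metis nth_rank)
  then show "card (rank m ` tuples m a) = card {..<m ^ a}" by (simp add: card_image card_tuples)
qed simp

definition bit_length :: "nat \<Rightarrow> nat" where
  "bit_length m = nat \<lceil>log 2 (real m)\<rceil>"

text \<open>Eliminates the real logarithm: the rounded-up value is the least \<open>L\<close> with
  \<open>m \<le> 2 ^ L\<close>.\<close>

lemma bit_length_le_iff: "m \<ge> 1 \<Longrightarrow> bit_length m \<le> L \<longleftrightarrow> m \<le> 2 ^ L"
proof -
  assume m: "m \<ge> 1"
  have "bit_length m \<le> L \<longleftrightarrow> log 2 (real m) \<le> real L"
    unfolding bit_length_def by (simp add: nat_le_iff ceiling_le_iff)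
  also have "\<dots> \<longleftrightarrow> real m \<le> 2 powr real L" using m by (subst log_le_iff) auto
  also have "\<dots> \<longleftrightarrow> m \<le> 2 ^ L" by (simp add: powr_realpow flip: of_nat_le_iff)
  finally show ?thesis .
qed

lemma bit_length_mono: "1 \<le> m \<Longrightarrow> m \<le> m' \<Longrightarrow> bit_length m \<le> bit_length m'"
  using bit_length_le_iff[of m' "bit_length m'"] bit_length_le_iff[of m "bit_length m'"] by simp

lemma less_power_bit_length: "c < m \<Longrightarrow> c < 2 ^ bit_length m"
  using bit_length_le_iff[of m "bit_length m"] by simp

section \<open>Layout of the encoding\<close>

definition offset :: "vocab \<Rightarrow> nat \<Rightarrow> nat \<Rightarrow> nat" where
  "offset \<sigma> m R = (\<Sum>i<R. m ^ (rel_ars \<sigma> ! i))"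

definition rel_len :: "vocab \<Rightarrow> nat \<Rightarrow> nat" where
  "rel_len \<sigma> m = (if rel_ars \<sigma> = [] then m else offset \<sigma> m (length (rel_ars \<sigma>)))"

definition enc_len :: "vocab \<Rightarrow> nat \<Rightarrow> nat" where
  "enc_len \<sigma> m = rel_len \<sigma> m + num_csts \<sigma> * bit_length m"

definition rel_pos :: "vocab \<Rightarrow> nat \<Rightarrow> nat \<Rightarrow> nat list \<Rightarrow> nat" where
  "rel_pos \<sigma> m R xs = offset \<sigma> m R + rank m xs"

text \<open>Digits are stored with the most significant one first, hence the reversal of
  \<open>i\<close>.\<close>

definition cst_pos :: "vocab \<Rightarrow> nat \<Rightarrow> nat \<Rightarrow> nat \<Rightarrow> nat" where
  "cst_pos \<sigma> m j i = rel_len \<sigma> m + j * bit_length m + (bit_length m - 1 - i)"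

context
  fixes \<sigma> :: vocab and A :: struc
begin

definition rel_part :: "bool list" where
  "rel_part = (if rel_ars \<sigma> = [] then replicate (usize A) False
      else concat (map (\<lambda>i. map (rel_of A i) (product_lists (replicate (rel_ars \<sigma> ! i) [0..<usize A])))
                       [0..<length (rel_ars \<sigma>)]))"

definition cst_part :: "bool list" where
  "cst_part = concat (map (\<lambda>j. bin_digits (bit_length (usize A)) (cst_of A j)) [0..<num_csts \<sigma>])"

lemma enc_parts: "enc \<sigma> A = rel_part @ cst_part"
  by (simp add: enc_def rel_part_def cst_part_def bit_length_def)

lemma length_rel_part: "length rel_part = rel_len \<sigma> (usize A)"
  by (simp add: rel_part_def rel_len_def offset_def length_concat_map length_product_lists_replicate
      del: map_concat)

lemma length_bin_digits: "length (bin_digits L c) = L"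
  by (simp add: bin_digits_def)

lemma length_enc: "length (enc \<sigma> A) = enc_len \<sigma> (usize A)"
  by (simp add: enc_parts length_rel_part enc_len_def cst_part_def length_concat_map length_bin_digits)

lemma rel_pos_less:
  assumes "R < length (rel_ars \<sigma>)" "xs \<in> tuples m (rel_ars \<sigma> ! R)"
  shows "rel_pos \<sigma> m R xs < rel_len \<sigma> m"
proof -
  have "rel_pos \<sigma> m R xs < offset \<sigma> m (Suc R)"
    using nth_rank[OF assms(2)] by (simp add: rel_pos_def offset_def)
  also have "\<dots> \<le> offset \<sigma> m (length (rel_ars \<sigma>))"
    unfolding offset_def using assms(1) by (intro sum_mono2) auto
  finally show ?thesis using assms(1) by (auto simp: rel_len_def)
qed

lemma nth_enc_rel:
  assumes R: "R < length (rel_ars \<sigma>)" and xs: "xs \<in> tuples (usize A) (rel_ars \<sigma> ! R)"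
  shows "enc \<sigma> A ! rel_pos \<sigma> (usize A) R xs = rel_of A R xs"
proof -
  let ?f = "\<lambda>i. map (rel_of A i) (product_lists (replicate (rel_ars \<sigma> ! i) [0..<usize A]))"
  have len: "length (?f i) = usize A ^ (rel_ars \<sigma> ! i)" for i
    by (simp add: length_product_lists_replicate)
  have "enc \<sigma> A ! rel_pos \<sigma> (usize A) R xs = rel_part ! rel_pos \<sigma> (usize A) R xs"
    using rel_pos_less[OF R xs] by (simp add: enc_parts nth_append length_rel_part)
  also have "\<dots> = concat (map ?f [0..<length (rel_ars \<sigma>)]) ! ((\<Sum>i<R. length (?f i)) + rank (usize A) xs)"
    using R by (auto simp: rel_part_def rel_pos_def offset_def length_product_lists_replicate)
  also have "\<dots> = ?f R ! rank (usize A) xs"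
    by (rule nth_concat_map) (use R nth_rank[OF xs] len in auto)
  also have "\<dots> = rel_of A R xs"
    using nth_rank[OF xs] by (simp add: length_product_lists_replicate)
  finally show ?thesis .
qed

lemma nth_enc_cst_offset:
  assumes j: "j < num_csts \<sigma>" and r: "r < bit_length (usize A)"
  shows "enc \<sigma> A ! (rel_len \<sigma> (usize A) + j * bit_length (usize A) + r) =
    bit (cst_of A j) (bit_length (usize A) - 1 - r)"
proof -
  let ?L = "bit_length (usize A)"
  have "enc \<sigma> A ! (rel_len \<sigma> (usize A) + j * ?L + r) = cst_part ! (j * ?L + r)"
    by (simp add: enc_parts nth_append length_rel_part add.assoc)
  also have "\<dots> = bin_digits ?L (cst_of A j) ! r"
    using nth_concat_map[OF j, of r "\<lambda>j. bin_digits ?L (cst_of A j)"] r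
    by (simp add: cst_part_def length_bin_digits)
  also have "\<dots> = bit (cst_of A j) (?L - 1 - r)"
    using r by (simp add: bin_digits_def rev_nth)
  finally show ?thesis .
qed

lemma nth_enc_cst:
  assumes "j < num_csts \<sigma>" "i < bit_length (usize A)"
  shows "enc \<sigma> A ! cst_pos \<sigma> (usize A) j i = bit (cst_of A j) i"
  using nth_enc_cst_offset[OF assms(1), of "bit_length (usize A) - 1 - i"] assms(2)
  by (simp add: cst_pos_def)

lemma nth_enc_no_rel:
  assumes "rel_ars \<sigma> = []" "p < usize A"
  shows "\<not> enc \<sigma> A ! p"
  using assms by (simp add: enc_parts nth_append length_rel_part rel_len_def rel_part_def)

text \<open>Every position of the encoding is a relation tuple, a digit of a constant, or padding.
  This recognizes encodings among the words that satisfy the literals of a guess.\<close>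

lemma eq_encI:
  assumes len: "length w = enc_len \<sigma> (usize A)"
    and rel: "\<And>R xs. R < length (rel_ars \<sigma>) \<Longrightarrow> xs \<in> tuples (usize A) (rel_ars \<sigma> ! R) \<Longrightarrow>
      w ! rel_pos \<sigma> (usize A) R xs = rel_of A R xs"
    and cst: "\<And>j i. j < num_csts \<sigma> \<Longrightarrow> i < bit_length (usize A) \<Longrightarrow>
      w ! cst_pos \<sigma> (usize A) j i = bit (cst_of A j) i"
    and no_rel: "\<And>p. rel_ars \<sigma> = [] \<Longrightarrow> p < usize A \<Longrightarrow> \<not> w ! p"
  shows "w = enc \<sigma> A"
proof (rule nth_equalityI)
  show "length w = length (enc \<sigma> A)" by (simp add: len length_enc)
  let ?m = "usize A"
  let ?L = "bit_length ?m"
  fix p assume p: "p < length w"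
  consider "p < rel_len \<sigma> ?m" "rel_ars \<sigma> = []" | "p < rel_len \<sigma> ?m" "rel_ars \<sigma> \<noteq> []"
    | "rel_len \<sigma> ?m \<le> p" by linarith
  then show "w ! p = enc \<sigma> A ! p"
  proof cases
    case 1
    then show ?thesis using no_rel[of p] nth_enc_no_rel[of p] by (simp add: rel_len_def)
  next
    case 2
    then have "p < (\<Sum>i<length (rel_ars \<sigma>). ?m ^ (rel_ars \<sigma> ! i))"
      by (simp add: rel_len_def offset_def)
    then obtain R r where R: "R < length (rel_ars \<sigma>)" "r < ?m ^ (rel_ars \<sigma> ! R)"
      "p = offset \<sigma> ?m R + r"
      unfolding offset_def using prefix_sum_index by blast
    then obtain xs where "xs \<in> tuples ?m (rel_ars \<sigma> ! R)" "r = rank ?m xs"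
      using rank_image[of ?m "rel_ars \<sigma> ! R"] by (metis imageE lessThan_iff)
    then show ?thesis using rel nth_enc_rel R by (simp add: rel_pos_def)
  next
    case 3
    then have "p - rel_len \<sigma> ?m < (\<Sum>i<num_csts \<sigma>. ?L)" using p len by (simp add: enc_len_def)
    then obtain j r where jr: "j < num_csts \<sigma>" "r < ?L" "p - rel_len \<sigma> ?m = (\<Sum>i<j. ?L) + r"
      using prefix_sum_index by blast
    then have pos: "p = cst_pos \<sigma> ?m j (?L - 1 - r)" using 3 by (simp add: cst_pos_def)
    have "?L - 1 - r < ?L" using jr by simp
    then show ?thesis using cst[OF jr(1)] nth_enc_cst[OF jr(1)] unfolding pos by simp
  qed
qed

end

text \<open>Strictness comes from positive arities or, without relation symbols, from the
  padding.\<close>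

lemma rel_len_strict_mono:
  assumes "wf_vocab \<sigma>" "m < m'" shows "rel_len \<sigma> m < rel_len \<sigma> m'"
proof (cases "rel_ars \<sigma> = []")
  case False
  have "m ^ (rel_ars \<sigma> ! i) < m' ^ (rel_ars \<sigma> ! i)" if "i < length (rel_ars \<sigma>)" for i
    using assms that unfolding wf_vocab_def by (intro power_strict_mono) (auto simp: Suc_le_eq)
  then show ?thesis using False unfolding rel_len_def offset_def
    by (simp, intro sum_strict_mono) auto
qed (use assms in \<open>simp add: rel_len_def\<close>)

lemma rel_len_ge: "wf_vocab \<sigma> \<Longrightarrow> m \<le> rel_len \<sigma> m"
proof (induction m)
  case (Suc m)
  then show ?case using rel_len_strict_mono[OF Suc.prems, of m "Suc m"] by simp
qed simp

lemma enc_len_ge: "wf_vocab \<sigma> \<Longrightarrow> m \<le> enc_len \<sigma> m"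
  using rel_len_ge[of \<sigma> m] by (simp add: enc_len_def)

text \<open>Thanks to this a circuit, which knows the input length only, knows the size of the
  structure.\<close>

lemma enc_len_inj:
  assumes "wf_vocab \<sigma>" "1 \<le> m" "1 \<le> m'" "enc_len \<sigma> m = enc_len \<sigma> m'"
  shows "m = m'"
proof -
  have less: "enc_len \<sigma> a < enc_len \<sigma> b" if "1 \<le> a" "a < b" for a b
    using rel_len_strict_mono[OF assms(1) that(2)] bit_length_mono[of a b] that
    unfolding enc_len_def by (intro add_less_le_mono mult_le_mono2) auto
  show ?thesis using less[of m m'] less[of m' m] assms by (metis less_irrefl linorder_neqE_nat)
qed

section \<open>Definability of lengths and positions\<close>

lemma fo_term_rank:
  assumes "\<And>x. x \<in> set xs \<Longrightarrow> fo_term (f x)" "fo_term m"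
  shows "fo_term (\<lambda>w v. rank (m w v) (map (\<lambda>x. f x w v) xs))"
  using assms by (induction xs) (auto intro!: fo_term_intros)

lemma fo_term_offset: "fo_term m \<Longrightarrow> fo_term (\<lambda>w v. offset \<sigma> (m w v) R)"
  unfolding offset_def by (intro fo_term_intros)

lemma fo_term_rel_len: "fo_term m \<Longrightarrow> fo_term (\<lambda>w v. rel_len \<sigma> (m w v))"
  unfolding rel_len_def by (cases "rel_ars \<sigma> = []") (auto intro: fo_term_offset)

text \<open>The digits needed for a universe of size \<open>Suc m\<close> are those of its largest
  element \<open>m\<close>. In this form the bit length is definable from BIT.\<close>

lemma bit_length_Suc_le_iff: "bit_length (Suc m) \<le> L \<longleftrightarrow> (\<forall>b. bit m b \<longrightarrow> b < L)"
proof -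
  have "bit_length (Suc m) \<le> L \<longleftrightarrow> m < 2 ^ L" by (simp add: bit_length_le_iff Suc_le_eq)
  also have "\<dots> \<longleftrightarrow> (\<forall>b. bit m b \<longrightarrow> b < L)"
  proof
    assume m: "m < 2 ^ L"
    show "\<forall>b. bit m b \<longrightarrow> b < L"
      using m by (metis bit_take_bit_iff take_bit_nat_eq_self)
  next
    assume "\<forall>b. bit m b \<longrightarrow> b < L"
    then have "take_bit L m = m" by (intro bit_eqI) (auto simp: bit_take_bit_iff)
    then show "m < 2 ^ L" by (metis take_bit_nat_less_exp)
  qed
  finally show ?thesis .
qed

lemma fo_term_bit_length: "fo_term (\<lambda>w v. bit_length (Suc (v i)))"
  unfolding fo_term_def
proof
  have "fo (\<lambda>w v. (\<forall>b<length w. bit (v (Suc i)) b \<longrightarrow> b < v 0) \<and>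
    (\<forall>u<length w. u < v 0 \<longrightarrow> (\<exists>b<length w. u \<le> b \<and> bit (v (Suc i)) b)))"
    by (intro fo_intros)
  then show "fo (\<lambda>w v. bit_length (Suc (v (Suc i))) = v 0)"
  proof (rule fo_cong)
    fix w :: "bool list" and v :: "nat \<Rightarrow> nat"
    assume v: "\<And>i. v i < length w"
    have b: "b < length w" if "bit (v (Suc i)) b" for b
      using nat_bit_imp_less[OF that] v[of "Suc i"] by simp
    have "bit_length (Suc (v (Suc i))) = v 0 \<longleftrightarrow> bit_length (Suc (v (Suc i))) \<le> v 0 \<and>
      (\<forall>u<v 0. \<not> bit_length (Suc (v (Suc i))) \<le> u)"
      by (metis le_antisym not_le order_refl)
    also have "\<dots> \<longleftrightarrow> (\<forall>b<length w. bit (v (Suc i)) b \<longrightarrow> b < v 0) \<and>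
      (\<forall>u<length w. u < v 0 \<longrightarrow> (\<exists>b<length w. u \<le> b \<and> bit (v (Suc i)) b))"
      unfolding bit_length_Suc_le_iff using b v[of 0] by (meson less_trans not_le)
    finally show "(bit_length (Suc (v (Suc i))) = v 0) = \<dots>" .
  qed
  show "fo (\<lambda>w v. bit_length (Suc (v i)) = length w)"
  proof (rule fo_cong[OF fo_const[of False]])
    fix w :: "bool list" and v :: "nat \<Rightarrow> nat"
    assume v: "\<And>i. v i < length w"
    have "bit_length (Suc (v i)) \<le> v i"
      unfolding bit_length_Suc_le_iff using nat_bit_imp_less by blast
    then show "bit_length (Suc (v i)) = length w \<longleftrightarrow> False" using v[of i] by simp
  qed
qed

text \<open>Here a term takes the length itself as its value, the case provided for in
  \<open>fo_term\<close>. The size is written \<open>Suc (v i)\<close> because it can equal the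
  length and then is not an element.\<close>

lemma fo_enc_len: "fo (\<lambda>w v. enc_len \<sigma> (Suc (v i)) = length w)"
  unfolding enc_len_def
  by (intro fo_term_eq_length fo_term_add fo_term_mult fo_term_const fo_term_rel_len
      fo_term_bit_length fo_term_Suc fo_term_var)

section \<open>Quantifier-free formulas and guesses\<close>

fun subterms :: "trm \<Rightarrow> trm set" where
  "subterms (FunVar i ts) = insert (FunVar i ts) (\<Union>t\<in>set ts. subterms t)"
| "subterms t = {t}"

text \<open>
  With \<open>k\<close> function variables, the atom \<open>Rel R ts\<close> is treated as the term \<open>FunVar (k + R) ts\<close>
  with value \<open>0\<close> or \<open>1\<close>.
\<close>

fun atom_terms :: "nat \<Rightarrow> fml \<Rightarrow> trm set" where
  "atom_terms k (Rel R ts) = insert (FunVar (k + R) ts) (\<Union>t\<in>set ts. subterms t)"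
| "atom_terms k (Eql s t) = subterms s \<union> subterms t"
| "atom_terms k (Leq s t) = subterms s \<union> subterms t"
| "atom_terms k (BIT s t) = subterms s \<union> subterms t"
| "atom_terms k (Neg \<phi>) = atom_terms k \<phi>"
| "atom_terms k (Conj \<phi> \<psi>) = atom_terms k \<phi> \<union> atom_terms k \<psi>"
| "atom_terms k (Disj \<phi> \<psi>) = atom_terms k \<phi> \<union> atom_terms k \<psi>"
| "atom_terms k (Ex x \<phi>) = atom_terms k \<phi>"
| "atom_terms k (All x \<phi>) = atom_terms k \<phi>"

fun qf_val :: "nat \<Rightarrow> (trm \<Rightarrow> nat) \<Rightarrow> fml \<Rightarrow> bool" where
  "qf_val k e (Rel R ts) \<longleftrightarrow> e (FunVar (k + R) ts) = 1"
| "qf_val k e (Eql s t) \<longleftrightarrow> e s = e t"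
| "qf_val k e (Leq s t) \<longleftrightarrow> e s \<le> e t"
| "qf_val k e (BIT s t) \<longleftrightarrow> bit (e t) (e s)"
| "qf_val k e (Neg \<phi>) \<longleftrightarrow> \<not> qf_val k e \<phi>"
| "qf_val k e (Conj \<phi> \<psi>) \<longleftrightarrow> qf_val k e \<phi> \<and> qf_val k e \<psi>"
| "qf_val k e (Disj \<phi> \<psi>) \<longleftrightarrow> qf_val k e \<phi> \<or> qf_val k e \<psi>"
| "qf_val k e (Ex x \<phi>) \<longleftrightarrow> False"
| "qf_val k e (All x \<phi>) \<longleftrightarrow> False"

lemma self_in_subterms: "t \<in> subterms t"
  by (cases t) auto

lemma finite_subterms: "finite (subterms t)"
  by (induction t) auto

lemma subterms_closed: "FunVar i ts \<in> subterms t \<Longrightarrow> set ts \<subseteq> subterms t"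
  by (induction t) (use self_in_subterms in fastforce)+

lemma wf_subterms: "wf_trm \<sigma> ars t \<Longrightarrow> s \<in> subterms t \<Longrightarrow> wf_trm \<sigma> ars s"
  by (induction t) auto

lemma tvars_subterms: "s \<in> subterms t \<Longrightarrow> tvars s \<subseteq> tvars t"
  by (induction t) auto

lemma finite_atom_terms: "finite (atom_terms k \<phi>)"
  by (induction \<phi>) (auto simp: finite_subterms)

lemma atom_terms_closed: "FunVar i ts \<in> atom_terms k \<phi> \<Longrightarrow> set ts \<subseteq> atom_terms k \<phi>"
proof (induction \<phi>)
  case (Rel R us)
  then consider "i = k + R" "ts = us" | u where "u \<in> set us" "FunVar i ts \<in> subterms u" by auto
  then show ?case
  proof cases
    case 1
    then show ?thesis using self_in_subterms by auto
  next
    case 2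
    then show ?thesis using subterms_closed[OF 2(2)] by auto
  qed
qed (use subterms_closed in auto)

lemma atom_terms_wf:
  assumes "wf_fml \<sigma> ars \<phi>" "t \<in> atom_terms (length ars) \<phi>"
  shows "wf_trm \<sigma> ars t \<or> (\<exists>R ts. t = FunVar (length ars + R) ts \<and> R < length (rel_ars \<sigma>) \<and>
    length ts = rel_ars \<sigma> ! R \<and> (\<forall>s\<in>set ts. wf_trm \<sigma> ars s))"
  using assms by (induction \<phi>) (auto dest: wf_subterms)

lemma atom_terms_tvars:
  "quantifier_free \<phi> \<Longrightarrow> t \<in> atom_terms k \<phi> \<Longrightarrow> tvars t \<subseteq> fvars \<phi>"
  by (induction \<phi>) (auto dest!: tvars_subterms)

lemma qf_val_cong:
  assumes "\<And>t. t \<in> atom_terms k \<phi> \<Longrightarrow> e t = e' t"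
  shows "qf_val k e \<phi> = qf_val k e' \<phi>"
  using assms by (induction \<phi>) (auto simp: self_in_subterms)

text \<open>The characteristic functions of the relations follow the function variables, in
  accordance with the index \<open>k + R\<close> in \<open>atom_terms\<close>.\<close>

definition add_rels :: "vocab \<Rightarrow> struc \<Rightarrow> (nat list \<Rightarrow> nat) list \<Rightarrow> (nat list \<Rightarrow> nat) list" where
  "add_rels \<sigma> A fs = fs @ map (\<lambda>R xs. of_bool (rel_of A R xs)) [0..<length (rel_ars \<sigma>)]"

lemma nth_add_rels:
  "i < length fs \<Longrightarrow> add_rels \<sigma> A fs ! i = fs ! i"
  "R < length (rel_ars \<sigma>) \<Longrightarrow>
    add_rels \<sigma> A fs ! (length fs + R) = (\<lambda>xs. of_bool (rel_of A R xs))"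
  by (simp_all add: add_rels_def nth_append)

lemma eval_add_rels:
  assumes "length fs = length ars" "wf_trm \<sigma> ars t"
  shows "eval_trm A (add_rels \<sigma> A fs) v t = eval_trm A fs v t"
  using assms(2)
proof (induction t)
  case (FunVar i ts)
  then have "map (eval_trm A (add_rels \<sigma> A fs) v) ts = map (eval_trm A fs v) ts" by auto
  then show ?case using FunVar.prems assms(1) by (simp add: nth_add_rels cong: map_cong)
qed auto

text \<open>From here on only the values of finitely many terms matter, not the functions behind
  them.\<close>

lemma sat_eq_qf_val:
  assumes "length fs = length ars" "wf_fml \<sigma> ars \<phi>" "quantifier_free \<phi>"
  shows "sat A fs v \<phi> = qf_val (length ars) (eval_trm A (add_rels \<sigma> A fs) v) \<phi>"
  using assms(2,3)
proof (induction \<phi>)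
  case (Rel R ts)
  then have "map (eval_trm A (add_rels \<sigma> A fs) v) ts = map (eval_trm A fs v) ts"
    using eval_add_rels[OF assms(1)] by auto
  moreover have "add_rels \<sigma> A fs ! (length ars + R) = (\<lambda>xs. of_bool (rel_of A R xs))"
    using nth_add_rels(2)[of R \<sigma> A fs] Rel.prems assms(1) by simp
  ultimately show ?case by (simp del: map_eq_conv)
qed (simp_all add: eval_add_rels[OF assms(1)])

lemma card_lists_nth:
  assumes "\<And>i. i < k \<Longrightarrow> finite (S i)"
  shows "finite {fs. length fs = k \<and> (\<forall>i<k. fs ! i \<in> S i)} \<and>
    card {fs. length fs = k \<and> (\<forall>i<k. fs ! i \<in> S i)} = (\<Prod>i<k. card (S i))"
  using assms
proof (induction k)
  case 0
  have "{fs. length fs = 0 \<and> (\<forall>i<0. fs ! i \<in> S i)} = {[]}" by auto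
  then show ?case by simp
next
  case (Suc k)
  let ?L = "\<lambda>k. {fs. length fs = k \<and> (\<forall>i<k. fs ! i \<in> S i)}"
  have "?L (Suc k) = (\<lambda>(fs, f). fs @ [f]) ` (?L k \<times> S k)"
  proof (intro equalityI subsetI)
    fix fs assume fs: "fs \<in> ?L (Suc k)"
    then have "fs = butlast fs @ [last fs]" by (metis (mono_tags) append_butlast_last_id length_0_conv mem_Collect_eq nat.distinct(1))
    moreover have "butlast fs \<in> ?L k" using fs by (auto simp: nth_butlast)
    moreover have "last fs \<in> S k" using fs by (cases "fs = []") (auto simp: last_conv_nth)
    ultimately show "fs \<in> (\<lambda>(fs, f). fs @ [f]) ` (?L k \<times> S k)" by force
  qed (auto simp: nth_append less_Suc_eq)
  moreover have "inj_on (\<lambda>(fs, f). fs @ [f]) (?L k \<times> S k)" by (auto intro: inj_onI)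
  ultimately show ?case using Suc by (simp add: card_image card_cartesian_product)
qed

lemma card_prescribed_functions:
  assumes "finite X"
  shows "card (\<Pi>\<^sub>E y\<in>X. if q y then {c y} else {..<m}) = m ^ card {y \<in> X. \<not> q y}"
proof -
  have "card (\<Pi>\<^sub>E y\<in>X. if q y then {c y} else {..<m}) = (\<Prod>y\<in>X. if q y then 1 else m)"
    unfolding card_PiE[OF assms] by (intro prod.cong) auto
  also have "\<dots> = m ^ card {y \<in> X. \<not> q y}"
    using assms by (simp add: prod.If_cases Int_def)
  finally show ?thesis .
qed

section \<open>Satisfying assignments grouped by guess\<close>

locale qf_query =
  fixes \<sigma> :: vocab and ars :: "nat list" and l :: nat and \<phi> :: fml
  assumes wf_vocab: "wf_vocab \<sigma>" and wf_fml: "wf_fml \<sigma> ars \<phi>"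
    and qf: "quantifier_free \<phi>" and fvars: "fvars \<phi> \<subseteq> {..<l}"
begin

abbreviation k :: nat where "k \<equiv> length ars"

text \<open>All individual variables are included so that a guess determines them even if the
  formula omits them, and all constants so that it prescribes every constant block of the
  encoding.\<close>

definition terms :: "trm set" where
  "terms = atom_terms k \<phi> \<union> Var ` {..<l} \<union> Cst ` {..<num_csts \<sigma>}"

lemma finite_terms: "finite terms"
  by (simp add: terms_def finite_atom_terms)

lemma terms_closed: "FunVar i ts \<in> terms \<Longrightarrow> set ts \<subseteq> terms"
  unfolding terms_def using atom_terms_closed by blast

lemma terms_wf: "t \<in> terms \<Longrightarrow> wf_trm \<sigma> ars t \<or> (\<exists>R ts. t = FunVar (k + R) ts \<and> R < length (rel_ars \<sigma>) \<and>
    length ts = rel_ars \<sigma> ! R \<and> (\<forall>s\<in>set ts. wf_trm \<sigma> ars s))"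
  using atom_terms_wf[OF wf_fml, of t] by (auto simp: terms_def)

lemma rel_term:
  assumes "FunVar (k + R) ts \<in> terms"
  shows "R < length (rel_ars \<sigma>)" "length ts = rel_ars \<sigma> ! R" "\<And>s. s \<in> set ts \<Longrightarrow> wf_trm \<sigma> ars s"
    "\<not> wf_trm \<sigma> ars (FunVar (k + R) ts)"
  using terms_wf[OF assms] by auto

lemma fun_term:
  assumes "FunVar i ts \<in> terms" "i < k"
  shows "wf_trm \<sigma> ars (FunVar i ts)" "length ts = ars ! i" "\<And>s. s \<in> set ts \<Longrightarrow> wf_trm \<sigma> ars s"
  using terms_wf[OF assms(1)] assms(2) by auto

lemma var_term: "Var x \<in> terms \<Longrightarrow> x < l"
  using atom_terms_tvars[OF qf, of "Var x" k] fvars by (auto simp: terms_def)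

lemma cst_term: "Cst j \<in> terms \<Longrightarrow> j < num_csts \<sigma>"
  using terms_wf[of "Cst j"] by auto

definition queried :: "(trm \<Rightarrow> nat) \<Rightarrow> nat \<Rightarrow> nat list \<Rightarrow> bool" where
  "queried e i ys \<longleftrightarrow> (\<exists>t\<in>terms. \<exists>ts. t = FunVar i ts \<and> ys = map e ts)"

text \<open>The conditions on a guess that do not involve the structure. Equal arguments must have
  equal values only for function variables; relation atoms are tied to a relation by
  \<open>fits\<close>.\<close>

definition good :: "nat \<Rightarrow> (trm \<Rightarrow> nat) \<Rightarrow> bool" where
  "good m e \<longleftrightarrow> (\<forall>t\<in>terms. e t < (if wf_trm \<sigma> ars t then m else 2)) \<and> (MinT \<in> terms \<longrightarrow> e MinT = 0) \<and>
     (\<forall>t\<in>terms. \<forall>t'\<in>terms. \<forall>i ts ts'. i < k \<and> t = FunVar i ts \<and> t' = FunVar i ts' \<longrightarrow>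
        map e ts = map e ts' \<longrightarrow> e t = e t') \<and>
     qf_val k e \<phi>"

lemma goodD:
  assumes "good m e"
  shows "t \<in> terms \<Longrightarrow> e t < (if wf_trm \<sigma> ars t then m else 2)"
    "MinT \<in> terms \<Longrightarrow> e MinT = 0"
    "FunVar i ts \<in> terms \<Longrightarrow> FunVar i ts' \<in> terms \<Longrightarrow> i < k \<Longrightarrow> map e ts = map e ts' \<Longrightarrow>
       e (FunVar i ts) = e (FunVar i ts')"
    "qf_val k e \<phi>"
  using assms unfolding good_def by blast+

definition fits :: "struc \<Rightarrow> (trm \<Rightarrow> nat) \<Rightarrow> bool" where
  "fits A e \<longleftrightarrow> (\<forall>R ts. FunVar (k + R) ts \<in> terms \<longrightarrow>
       e (FunVar (k + R) ts) = of_bool (rel_of A R (map e ts))) \<and>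
     (\<forall>j<num_csts \<sigma>. e (Cst j) = cst_of A j)"

lemma map_cong_terms:
  "FunVar i ts \<in> terms \<Longrightarrow> (\<And>t. t \<in> terms \<Longrightarrow> e t = e' t) \<Longrightarrow> map e ts = map e' ts"
  using terms_closed[of i ts] by (intro map_cong) auto

lemma good_cong:
  assumes eq: "\<And>t. t \<in> terms \<Longrightarrow> e t = e' t" and "good m e"
  shows "good m e'"
proof -
  have maps: "map e ts = map e' ts" if "FunVar i ts \<in> terms" for i ts
    using map_cong_terms[OF that eq] .
  show ?thesis
    unfolding good_def
  proof (intro conjI ballI allI impI)
    fix t assume "t \<in> terms"
    then show "e' t < (if wf_trm \<sigma> ars t then m else 2)"
      using goodD(1)[OF assms(2), of t] eq[of t] by simp
  next
    assume "MinT \<in> terms"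
    then show "e' MinT = 0" using goodD(2)[OF assms(2)] eq[of MinT] by simp
  next
    fix t t' i ts ts'
    assume *: "t \<in> terms" "t' \<in> terms" "i < k \<and> t = FunVar i ts \<and> t' = FunVar i ts'"
      "map e' ts = map e' ts'"
    then have "map e ts = map e ts'" using maps[of i ts] maps[of i ts'] by simp
    then have "e t = e t'" using goodD(3)[OF assms(2), of i ts ts'] * by simp
    then show "e' t = e' t'" using eq[of t] eq[of t'] * by simp
  next
    have "qf_val k e \<phi> = qf_val k e' \<phi>" using eq by (intro qf_val_cong) (simp add: terms_def)
    then show "qf_val k e' \<phi>" using goodD(4)[OF assms(2)] by simp
  qed
qed

lemma fits_cong:
  assumes eq: "\<And>t. t \<in> terms \<Longrightarrow> e t = e' t" and "fits A e"
  shows "fits A e'"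
proof -
  have "e' (FunVar (k + R) ts) = of_bool (rel_of A R (map e' ts))" if "FunVar (k + R) ts \<in> terms" for R ts
  proof -
    have maps: "map e ts = map e' ts" using map_cong_terms[OF that eq] .
    have "e (FunVar (k + R) ts) = of_bool (rel_of A R (map e ts))"
      using assms(2) that by (simp add: fits_def)
    then show ?thesis unfolding eq[OF that] maps .
  qed
  moreover have "e' (Cst j) = cst_of A j" if "j < num_csts \<sigma>" for j
    using assms(2) eq[of "Cst j"] that unfolding fits_def terms_def by simp
  ultimately show ?thesis unfolding fits_def by blast
qed

definition assignments :: "nat \<Rightarrow> ((nat list \<Rightarrow> nat) list \<times> nat list) set" where
  "assignments m = {(fs, cs). length fs = k \<and> (\<forall>i<k. fs ! i \<in> tuples m (ars ! i) \<rightarrow>\<^sub>E {..<m}) \<and>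
     cs \<in> tuples m l}"

abbreviation value_of :: "struc \<Rightarrow> (nat list \<Rightarrow> nat) list \<Rightarrow> nat list \<Rightarrow> trm \<Rightarrow> nat" where
  "value_of A fs cs \<equiv> eval_trm A (add_rels \<sigma> A fs) ((!) cs)"

lemma value_of_rel:
  assumes "length fs = k" "FunVar (k + R) ts \<in> terms"
  shows "value_of A fs cs (FunVar (k + R) ts) = of_bool (rel_of A R (map (value_of A fs cs) ts))"
  using rel_term[OF assms(2)] assms(1) by (simp add: add_rels_def nth_append)

lemma value_of_fun:
  assumes "length fs = k" "i < k"
  shows "value_of A fs cs (FunVar i ts) = (fs ! i) (map (value_of A fs cs) ts)"
  using assms by (simp add: add_rels_def nth_append)

lemma value_of_less:
  assumes A: "A \<in> STRUC \<sigma>" and as: "(fs, cs) \<in> assignments (usize A)"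
    and "wf_trm \<sigma> ars t" "t \<in> terms"
  shows "value_of A fs cs t < usize A"
  using assms(3,4)
proof (induction t)
  case (Var x)
  then have "cs ! x \<in> set cs" "set cs \<subseteq> {..<usize A}"
    using as var_term[of x] by (auto simp: assignments_def tuples_def)
  then have "cs ! x \<in> {..<usize A}" by blast
  then show ?case by simp
next
  case (FunVar i ts)
  have fs: "length fs = k" "i < k" "fs ! i \<in> tuples (usize A) (ars ! i) \<rightarrow>\<^sub>E {..<usize A}"
    using as FunVar.prems by (auto simp: assignments_def)
  have "set ts \<subseteq> terms" using FunVar.prems terms_closed by blast
  then have "map (value_of A fs cs) ts \<in> tuples (usize A) (ars ! i)"
    using FunVar by (auto simp: tuples_def)
  then show ?case using fs PiE_mem[OF fs(3)] unfolding value_of_fun[OF fs(1,2)] by blast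
qed (use A in \<open>auto simp: STRUC_def\<close>)

lemma good_value_of:
  assumes A: "A \<in> STRUC \<sigma>" and as: "(fs, cs) \<in> assignments (usize A)" and "sat A fs ((!) cs) \<phi>"
  shows "good (usize A) (value_of A fs cs)" "fits A (value_of A fs cs)"
proof -
  have len: "length fs = k" using as by (simp add: assignments_def)
  have "qf_val k (value_of A fs cs) \<phi>" using assms(3) sat_eq_qf_val[OF len wf_fml qf] by simp
  moreover have "value_of A fs cs t < (if wf_trm \<sigma> ars t then usize A else 2)" if t: "t \<in> terms" for t
  proof (cases "wf_trm \<sigma> ars t")
    case False
    then obtain R ts where "t = FunVar (k + R) ts" using terms_wf[OF t] by blast
    then show ?thesis using False value_of_rel[OF len, of R ts] t by simp
  qed (use value_of_less[OF A as _ t] in simp)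
  ultimately show "good (usize A) (value_of A fs cs)"
    unfolding good_def using value_of_fun[OF len] by auto
  show "fits A (value_of A fs cs)"
    unfolding fits_def using value_of_rel[OF len] by simp
qed

text \<open>By induction on terms: once the arguments have their guessed values, only the value of
  the function at these arguments is in question. The condition on \<open>fs\<close> thus becomes a
  list of prescribed values at fixed arguments.\<close>

lemma value_of_eq_iff:
  assumes len: "length fs = k" and "good (usize A) e" "fits A e"
  shows "(\<forall>t\<in>terms. value_of A fs cs t = e t) \<longleftrightarrow>
    (\<forall>j<l. cs ! j = e (Var j)) \<and>
    (\<forall>i ts. i < k \<longrightarrow> FunVar i ts \<in> terms \<longrightarrow> (fs ! i) (map e ts) = e (FunVar i ts))" (is "?L \<longleftrightarrow> ?R")
proof
  assume L: ?L
  have "cs ! j = e (Var j)" if "j < l" for j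
    using bspec[OF L, of "Var j"] that by (simp add: terms_def)
  moreover have "(fs ! i) (map e ts) = e (FunVar i ts)" if "i < k" "FunVar i ts \<in> terms" for i ts
  proof -
    have eq: "map (value_of A fs cs) ts = map e ts" using map_cong_terms[OF that(2)] L by blast
    show ?thesis using bspec[OF L that(2)] unfolding value_of_fun[OF len that(1)] eq .
  qed
  ultimately show ?R by blast
next
  assume R: ?R
  have "value_of A fs cs t = e t" if "t \<in> terms" for t
    using that
  proof (induction t)
    case (Var x)
    then show ?case using R var_term by simp
  next
    case (Cst j)
    then show ?case using assms(3) cst_term by (simp add: fits_def)
  next
    case MinT
    then show ?case using assms(2) by (simp add: good_def)
  next
    case (FunVar i ts)
    have "set ts \<subseteq> terms" using FunVar.prems terms_closed by blast
    then have eq: "map (value_of A fs cs) ts = map e ts" using FunVar.IH by auto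
    show ?case
    proof (cases "i < k")
      case True
      then show ?thesis unfolding value_of_fun[OF len True] eq using R FunVar.prems by blast
    next
      case False
      then obtain R where i: "i = k + R" by (metis le_iff_add not_le)
      have "value_of A fs cs (FunVar i ts) = of_bool (rel_of A R (map e ts))"
        using value_of_rel[OF len FunVar.prems[unfolded i], of A cs] unfolding eq i .
      also have "\<dots> = e (FunVar i ts)"
        unfolding i using assms(3) FunVar.prems i unfolding fits_def by simp
      finally show ?thesis .
    qed
  qed
  then show ?L by blast
qed

definition realizations :: "struc \<Rightarrow> (trm \<Rightarrow> nat) \<Rightarrow> ((nat list \<Rightarrow> nat) list \<times> nat list) set" where
  "realizations A e = {(fs, cs) \<in> assignments (usize A). \<forall>t\<in>terms. value_of A fs cs t = e t}"

definition unqueried :: "nat \<Rightarrow> (trm \<Rightarrow> nat) \<Rightarrow> nat \<Rightarrow> nat list set" where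
  "unqueried m e i = {ys \<in> tuples m (ars ! i). \<not> queried e i ys}"

text \<open>The individual variables are fixed by the guess; each function is prescribed at the
  queried arguments and has \<open>m\<close> free choices at every other one.\<close>

lemma card_realizations:
  assumes good: "good (usize A) e" and fits: "fits A e"
  shows "finite (realizations A e) \<and> card (realizations A e) = (\<Prod>i<k. usize A ^ card (unqueried (usize A) e i))"
proof -
  let ?m = "usize A"
  \<comment> \<open>Several terms may query the same argument; by consistency of a good guess the
    choice among them is immaterial.\<close>
  define answer where "answer i ys = e (SOME t. t \<in> terms \<and> (\<exists>ts. t = FunVar i ts \<and> ys = map e ts))" for i ys
  have answer: "answer i (map e ts) = e (FunVar i ts)" if "i < k" "FunVar i ts \<in> terms" for i ts
  proof -
    let ?P = "\<lambda>t. t \<in> terms \<and> (\<exists>us. t = FunVar i us \<and> map e ts = map e us)"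
    have "?P (SOME t. ?P t)" by (rule someI[of ?P "FunVar i ts"]) (use that in auto)
    then obtain us where us: "(SOME t. ?P t) = FunVar i us" "FunVar i us \<in> terms" "map e ts = map e us"
      by auto
    have "answer i (map e ts) = e (FunVar i us)" unfolding answer_def us(1) ..
    then show ?thesis using goodD(3)[OF good that(2) us(2) that(1) us(3)] by simp
  qed
  have in_tuples: "map e ts \<in> tuples ?m (ars ! i)" and less: "e (FunVar i ts) < ?m"
    if "i < k" "FunVar i ts \<in> terms" for i ts
  proof -
    have "e t < ?m" if "wf_trm \<sigma> ars t" "t \<in> terms" for t using goodD(1)[OF good that(2)] that by simp
    then show "map e ts \<in> tuples ?m (ars ! i)" "e (FunVar i ts) < ?m"
      using fun_term[OF that(2,1)] terms_closed[OF that(2)] that(2) by (auto simp: tuples_def)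
  qed
  define S where "S i = (\<Pi>\<^sub>E ys\<in>tuples ?m (ars ! i). if queried e i ys then {answer i ys} else {..<?m})" for i
  define cs0 where "cs0 = map (\<lambda>j. e (Var j)) [0..<l]"
  have cs0: "cs0 \<in> tuples ?m l"
    using goodD(1)[OF good, of "Var _"] by (auto simp: cs0_def tuples_def terms_def)
  have S: "f \<in> S i \<longleftrightarrow> f \<in> tuples ?m (ars ! i) \<rightarrow>\<^sub>E {..<?m} \<and>
      (\<forall>ts. FunVar i ts \<in> terms \<longrightarrow> f (map e ts) = e (FunVar i ts))" if i: "i < k" for f i
  proof
    assume f: "f \<in> S i"
    note mem = PiE_mem[OF f[unfolded S_def]]
    have "f ys < ?m" if ys: "ys \<in> tuples ?m (ars ! i)" for ys
    proof (cases "queried e i ys")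
      case True
      then obtain ts where ts: "FunVar i ts \<in> terms" "ys = map e ts" by (auto simp: queried_def)
      have "f ys = answer i ys" using mem[OF ys] True by simp
      then show ?thesis unfolding ts(2) answer[OF i ts(1)] using less[OF i ts(1)] by simp
    next
      case False
      then show ?thesis using mem[OF ys] by simp
    qed
    moreover have "f (map e ts) = e (FunVar i ts)" if ts: "FunVar i ts \<in> terms" for ts
    proof -
      have "queried e i (map e ts)" using ts by (auto simp: queried_def)
      then have "f (map e ts) = answer i (map e ts)" using mem[OF in_tuples[OF i ts]] by simp
      then show ?thesis unfolding answer[OF i ts] .
    qed
    ultimately show "f \<in> tuples ?m (ars ! i) \<rightarrow>\<^sub>E {..<?m} \<and>
      (\<forall>ts. FunVar i ts \<in> terms \<longrightarrow> f (map e ts) = e (FunVar i ts))"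
      using f unfolding S_def by (auto simp: PiE_iff)
  next
    assume f: "f \<in> tuples ?m (ars ! i) \<rightarrow>\<^sub>E {..<?m} \<and>
      (\<forall>ts. FunVar i ts \<in> terms \<longrightarrow> f (map e ts) = e (FunVar i ts))"
    have "f ys = answer i ys" if "queried e i ys" for ys
      using that f answer[OF i] by (auto simp: queried_def)
    then show "f \<in> S i" using f unfolding S_def by (auto simp: PiE_iff)
  qed
  have "realizations A e = {fs. length fs = k \<and> (\<forall>i<k. fs ! i \<in> S i)} \<times> {cs0}"
  proof (intro equalityI subsetI, goal_cases)
    case (1 x)
    then obtain fs cs where x: "x = (fs, cs)" "(fs, cs) \<in> assignments ?m"
      "\<forall>t\<in>terms. value_of A fs cs t = e t" by (auto simp: realizations_def)
    have len: "length fs = k" using x by (simp add: assignments_def)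
    note R = value_of_eq_iff[OF len good fits, of cs, THEN iffD1, OF x(3)]
    have "cs = cs0" using x(2) R by (auto simp: assignments_def tuples_def cs0_def intro!: nth_equalityI)
    then show ?case using x(1,2) R S len by (simp add: assignments_def)
  next
    case (2 x)
    then obtain fs where x: "x = (fs, cs0)" "length fs = k" "\<forall>i<k. fs ! i \<in> S i" by auto
    have "\<forall>t\<in>terms. value_of A fs cs0 t = e t"
      unfolding value_of_eq_iff[OF x(2) good fits] using x(3) S by (simp add: cs0_def)
    then show ?case using x S cs0 by (simp add: realizations_def assignments_def)
  qed
  moreover have fin: "finite (S i)" for i
    unfolding S_def by (intro finite_PiE) (auto simp: finite_tuples)
  moreover have "card (S i) = ?m ^ card (unqueried ?m e i)" for i
    unfolding S_def unqueried_def by (rule card_prescribed_functions) (rule finite_tuples)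
  ultimately show ?thesis
    using card_lists_nth[of k S] by (simp add: card_cartesian_product)
qed

section \<open>Guesses as tuples of values\<close>

definition K :: nat where "K = card terms"

definition idx :: "trm \<Rightarrow> nat" where
  "idx = (SOME h. bij_betw h terms {0..<K})"

lemma idx: "bij_betw idx terms {0..<K}"
  unfolding idx_def K_def using ex_bij_betw_finite_nat[OF finite_terms] by (rule someI_ex)

lemma idx_less: "t \<in> terms \<Longrightarrow> idx t < K"
  using idx by (auto simp: bij_betw_def)

definition guess :: "nat list \<Rightarrow> trm \<Rightarrow> nat" where
  "guess xs t = xs ! idx t"

lemma guess_surj: "\<exists>xs. length xs = K \<and> (\<forall>t\<in>terms. guess xs t = e t)"
proof (intro exI conjI ballI)
  let ?xs = "map (\<lambda>i. e (inv_into terms idx i)) [0..<K]"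
  show "length ?xs = K" by simp
  fix t assume "t \<in> terms"
  then show "guess ?xs t = e t"
    using idx_less[of t] idx by (simp add: guess_def bij_betw_def)
qed

lemma guess_inj:
  assumes "length xs = K" "length ys = K" "\<And>t. t \<in> terms \<Longrightarrow> guess xs t = guess ys t"
  shows "xs = ys"
proof (rule nth_equalityI)
  fix i assume "i < length xs"
  then have "i \<in> idx ` terms" using idx assms by (simp add: bij_betw_def)
  then show "xs ! i = ys ! i" using assms(3) by (auto simp: guess_def)
qed (simp add: assms)

definition good_guesses :: "nat \<Rightarrow> nat list set" where
  "good_guesses m = {xs. length xs = K \<and> good m (guess xs)}"

text \<open>The maximum with \<open>2\<close> is there because relation atoms take the values
  \<open>0\<close> and \<open>1\<close> even when \<open>m = 1\<close>.\<close>

lemma good_guesses_subset: "good_guesses m \<subseteq> tuples (max m 2) K"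
proof
  fix xs assume xs: "xs \<in> good_guesses m"
  have "xs ! i < max m 2" if i: "i < K" for i
  proof -
    have "i \<in> idx ` terms" using i idx by (simp add: bij_betw_def)
    then obtain t where "t \<in> terms" "i = idx t" by blast
    then show ?thesis using xs goodD(1)[of m "guess xs" t] unfolding good_guesses_def guess_def
      by (auto split: if_splits)
  qed
  then show "xs \<in> tuples (max m 2) K"
    using xs by (auto simp: good_guesses_def tuples_def in_set_conv_nth)
qed

lemma finite_good_guesses: "finite (good_guesses m)"
  using good_guesses_subset finite_tuples by (rule finite_subset)

text \<open>Every satisfying assignment realizes exactly one guess, its own term values, so the
  realizations of the good guesses that fit partition the set being counted.\<close>

lemma sat_count_eq:
  assumes A: "A \<in> STRUC \<sigma>"
  shows "sat_count A ars l \<phi> =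
    (\<Sum>xs\<in>good_guesses (usize A). of_bool (fits A (guess xs)) *
       (\<Prod>i<k. usize A ^ card (unqueried (usize A) (guess xs) i)))"
proof -
  let ?m = "usize A"
  let ?G = "{xs \<in> good_guesses ?m. fits A (guess xs)}"
  have "{(fs, cs). length fs = length ars \<and>
     (\<forall>i<length ars. fs ! i \<in> tuples (usize A) (ars ! i) \<rightarrow>\<^sub>E {..<usize A}) \<and>
     cs \<in> tuples (usize A) l \<and> sat A fs ((!) cs) \<phi>} =
     {(fs, cs) \<in> assignments ?m. sat A fs ((!) cs) \<phi>}"
    by (auto simp: assignments_def)
  also have "\<dots> = (\<Union>xs\<in>?G. realizations A (guess xs))"
  proof (intro equalityI subsetI, goal_cases)
    case (1 x)
    then obtain fs cs where x: "x = (fs, cs)" "(fs, cs) \<in> assignments ?m" "sat A fs ((!) cs) \<phi>" by auto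
    obtain xs where xs: "length xs = K" "\<And>t. t \<in> terms \<Longrightarrow> guess xs t = value_of A fs cs t"
      using guess_surj[of "value_of A fs cs"] by blast
    have "good ?m (guess xs)" "fits A (guess xs)"
      using good_cong[OF xs(2)[symmetric]] fits_cong[OF xs(2)[symmetric]] good_value_of[OF A x(2,3)] by auto
    moreover have "x \<in> realizations A (guess xs)" using x xs(2) by (simp add: realizations_def)
    ultimately show ?case using xs(1) by (auto simp: good_guesses_def)
  next
    case (2 x)
    then obtain xs fs cs where x: "x = (fs, cs)" "(fs, cs) \<in> assignments ?m" "xs \<in> ?G"
      "\<And>t. t \<in> terms \<Longrightarrow> value_of A fs cs t = guess xs t" by (auto simp: realizations_def)
    have len: "length fs = k" using x(2) by (simp add: assignments_def)
    have "qf_val k (guess xs) \<phi>" using x(3) by (simp add: good_guesses_def good_def)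
    moreover have "qf_val k (guess xs) \<phi> = qf_val k (value_of A fs cs) \<phi>"
      using x(4) by (intro qf_val_cong) (simp add: terms_def)
    ultimately show ?case using x(1,2) sat_eq_qf_val[OF len wf_fml qf] by simp
  qed
  finally have "sat_count A ars l \<phi> = card (\<Union>xs\<in>?G. realizations A (guess xs))"
    unfolding sat_count_def by (rule arg_cong)
  also have "\<dots> = (\<Sum>xs\<in>?G. card (realizations A (guess xs)))"
  proof (rule card_UN_disjoint)
    show "finite ?G" by (rule finite_subset[OF _ finite_good_guesses]) auto
    show "\<forall>xs\<in>?G. finite (realizations A (guess xs))"
      using card_realizations by (auto simp: good_guesses_def)
    show "\<forall>xs\<in>?G. \<forall>ys\<in>?G. xs \<noteq> ys \<longrightarrow> realizations A (guess xs) \<inter> realizations A (guess ys) = {}"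
    proof (intro ballI impI)
      fix xs ys assume *: "xs \<in> ?G" "ys \<in> ?G" "xs \<noteq> ys"
      then obtain t where "t \<in> terms" "guess xs t \<noteq> guess ys t"
        using guess_inj[of xs ys] by (auto simp: good_guesses_def)
      then show "realizations A (guess xs) \<inter> realizations A (guess ys) = {}"
        unfolding realizations_def by fastforce
    qed
  qed
  also have "\<dots> = (\<Sum>xs\<in>?G. \<Prod>i<k. ?m ^ card (unqueried ?m (guess xs) i))"
    using card_realizations by (intro sum.cong) (auto simp: good_guesses_def)
  also have "\<dots> = (\<Sum>xs\<in>good_guesses ?m. of_bool (fits A (guess xs)) *
       (\<Prod>i<k. ?m ^ card (unqueried ?m (guess xs) i)))"
    by (rule sum.mono_neutral_cong_left) (auto simp: finite_good_guesses)
  finally show ?thesis .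
qed

end

section \<open>The circuit of a quantifier-free formula\<close>

lemma fo_map_eq: "fo (\<lambda>w v. map (\<lambda>x. v (f x)) xs = map (\<lambda>y. v (g y)) ys)"
proof (induction xs arbitrary: ys)
  case Nil
  show ?case by (rule fo_cong[OF fo_const[of "ys = []"]]) auto
next
  case (Cons x xs)
  show ?case
  proof (cases ys)
    case Nil
    show ?thesis by (rule fo_cong[OF fo_const[of False]]) (simp add: Nil)
  next
    case (Cons y zs)
    show ?thesis unfolding Cons list.map list.inject by (intro fo_conj fo_eq_var Cons.IH)
  qed
qed

lemma fo_less_Suc: "fo (\<lambda>w v. v i < Suc (v j))"
  by (simp only: less_Suc_eq_le fo_le)

lemma fo_less_two: "fo (\<lambda>w v. v i < 2)"
proof -
  have "fo (\<lambda>w v. v i = 0 \<or> v i = 1)" by (intro fo_disj fo_eq_const)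
  then show ?thesis by (rule fo_cong) auto
qed

lemma fo_qf_val: "fo (\<lambda>w v. qf_val k (\<lambda>t. v (h t)) \<phi>)"
  by (induction \<phi>) (simp_all only: qf_val.simps, (intro fo_intros fo_eq_const; assumption)+)

context qf_query
begin

section \<open>Structure sizes and required input bits\<close>

definition sized :: "nat \<Rightarrow> nat \<Rightarrow> bool" where
  "sized n m \<longleftrightarrow> 1 \<le> m \<and> enc_len \<sigma> m = n"

lemma sized_unique: "sized n m \<Longrightarrow> sized n m' \<Longrightarrow> m = m'"
  using enc_len_inj[OF wf_vocab] by (auto simp: sized_def)

lemma sized_le: "sized n m \<Longrightarrow> m \<le> n"
  using enc_len_ge[OF wf_vocab] by (auto simp: sized_def)

lemma fo_sized: "fo (\<lambda>w v. sized (length w) (Suc (v i)))"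
  unfolding sized_def by (rule fo_cong[OF fo_enc_len]) simp

text \<open>A size lies between \<open>1\<close> and the length of the word, so it is the successor
  of an element.\<close>

lemma fo_ex_sized:
  assumes "fo (\<lambda>w v. sized (length w) (Suc (v 0)) \<and> P w (\<lambda>i. v (Suc i)) (Suc (v 0)))"
  shows "fo (\<lambda>w v. \<exists>m. sized (length w) m \<and> P w v m)"
proof -
  have "fo (\<lambda>w v. \<exists>d<length w. sized (length w) (Suc d) \<and> P w v (Suc d))"
    by (intro fo_ex assms)
  then show ?thesis
  proof (rule fo_cong)
    fix w :: "bool list" and v :: "nat \<Rightarrow> nat"
    have "\<exists>d<length w. m = Suc d" if "sized (length w) m" for m
      using sized_le[OF that] that by (intro exI[of _ "m - 1"]) (auto simp: sized_def)
    then show "(\<exists>m. sized (length w) m \<and> P w v m) =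
      (\<exists>d<length w. sized (length w) (Suc d) \<and> P w v (Suc d))" by metis
  qed
qed

text \<open>Input bit \<open>p\<close> must be \<open>b\<close> if the guess is right. The bits
  concerned are those of the relation tuples queried, all digits of constants and the padding;
  relation tuples that are not queried stay unconstrained.\<close>

definition required :: "nat \<Rightarrow> (trm \<Rightarrow> nat) \<Rightarrow> nat \<Rightarrow> nat \<Rightarrow> bool" where
  "required m e p b \<longleftrightarrow>
     (\<exists>t\<in>terms. \<exists>R ts. t = FunVar (k + R) ts \<and> p = rel_pos \<sigma> m R (map e ts) \<and> b = e t) \<or>
     (\<exists>j<num_csts \<sigma>. \<exists>i<bit_length m. p = cst_pos \<sigma> m j i \<and> b = of_bool (bit (e (Cst j)) i)) \<or>
     (rel_ars \<sigma> = [] \<and> p < m \<and> b = 0)"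

lemma required_cong:
  assumes eq: "\<And>t. t \<in> terms \<Longrightarrow> e t = e' t"
  shows "required m e p b = required m e' p b"
proof -
  have "(\<exists>R ts. t = FunVar (k + R) ts \<and> p = rel_pos \<sigma> m R (map e ts) \<and> b = e t) =
    (\<exists>R ts. t = FunVar (k + R) ts \<and> p = rel_pos \<sigma> m R (map e' ts) \<and> b = e' t)" if t: "t \<in> terms" for t
  proof (intro ex_cong1 conj_cong refl)
    fix R ts assume "t = FunVar (k + R) ts"
    then have "map e ts = map e' ts" using map_cong_terms[of "k + R" ts e e'] eq t by blast
    then show "(p = rel_pos \<sigma> m R (map e ts)) = (p = rel_pos \<sigma> m R (map e' ts))" by (simp only:)
    show "(b = e t) = (b = e' t)" using eq[OF t] by simp
  qed
  moreover have "e (Cst j) = e' (Cst j)" if "j < num_csts \<sigma>" for j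
    using that by (intro eq) (simp add: terms_def)
  ultimately show ?thesis unfolding required_def by (simp cong: conj_cong)
qed

lemma queried_cong:
  assumes eq: "\<And>t. t \<in> terms \<Longrightarrow> e t = e' t"
  shows "queried e i ys = queried e' i ys"
proof -
  have "(\<exists>ts. t = FunVar i ts \<and> ys = map e ts) = (\<exists>ts. t = FunVar i ts \<and> ys = map e' ts)"
    if t: "t \<in> terms" for t
  proof (intro ex_cong1 conj_cong refl)
    fix ts assume "t = FunVar i ts"
    then have "map e ts = map e' ts" using map_cong_terms[of i ts e e'] eq t by blast
    then show "(ys = map e ts) = (ys = map e' ts)" by (simp only:)
  qed
  then show ?thesis unfolding queried_def by simp
qed

text \<open>Quantification over terms runs over a fixed finite set and becomes a finite conjunction;
  only comparisons of their values enter the formula.\<close>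

lemma fo_good: "fo (\<lambda>w v. good (Suc (v j)) (\<lambda>t. v (h t)))"
  unfolding good_def
proof (intro fo_conj fo_Ball finite_terms fo_qf_val)
  fix t
  show "fo (\<lambda>w v. v (h t) < (if wf_trm \<sigma> ars t then Suc (v j) else 2))"
    by (cases "wf_trm \<sigma> ars t") (simp_all add: fo_less_two fo_less_Suc del: less_Suc_eq_le)
next
  show "fo (\<lambda>w v. MinT \<in> terms \<longrightarrow> v (h MinT) = 0)" by (intro fo_intros)
next
  fix t t'
  show "fo (\<lambda>w v. \<forall>i ts ts'. i < k \<and> t = FunVar i ts \<and> t' = FunVar i ts' \<longrightarrow>
    map (\<lambda>t. v (h t)) ts = map (\<lambda>t. v (h t)) ts' \<longrightarrow> v (h t) = v (h t'))"
  proof (cases "\<exists>i ts ts'. i < k \<and> t = FunVar i ts \<and> t' = FunVar i ts'")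
    case True
    then obtain i ts ts' where *: "i < k" "t = FunVar i ts" "t' = FunVar i ts'" by blast
    have "fo (\<lambda>w v. map (\<lambda>t. v (h t)) ts = map (\<lambda>t. v (h t)) ts' \<longrightarrow> v (h t) = v (h t'))"
      by (intro fo_imp fo_map_eq fo_eq_var)
    then show ?thesis by (rule fo_cong) (use * in auto)
  next
    case False
    show ?thesis by (rule fo_cong[OF fo_const[of True]]) (use False in auto)
  qed
qed

lemma fo_queried: "fo (\<lambda>w v. queried (\<lambda>t. v (h t)) i (map v [b..<c]))"
  unfolding queried_def
proof (intro fo_Bex finite_terms)
  fix t
  show "fo (\<lambda>w v. \<exists>ts. t = FunVar i ts \<and> map v [b..<c] = map (\<lambda>t. v (h t)) ts)"
  proof (cases "\<exists>ts. t = FunVar i ts")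
    case True
    then obtain ts where t: "t = FunVar i ts" by blast
    have "fo (\<lambda>w v. map (\<lambda>x. v x) [b..<c] = map (\<lambda>t. v (h t)) ts)" by (rule fo_map_eq)
    then show ?thesis by (rule fo_cong) (use t in auto)
  next
    case False
    show ?thesis by (rule fo_cong[OF fo_const[of False]]) (use False in auto)
  qed
qed

lemma fo_required:
  "fo (\<lambda>w v. sized (length w) (Suc (v j)) \<and> required (Suc (v j)) (\<lambda>t. v (h t)) (v p) (v b))"
proof -
  let ?A = "\<lambda>v. \<exists>t\<in>terms. \<exists>R ts. t = FunVar (k + R) ts \<and>
    v p = rel_pos \<sigma> (Suc (v j)) R (map (\<lambda>t. v (h t)) ts) \<and> v b = v (h t)"
  \<comment> \<open>The truncated subtraction in \<open>cst_pos\<close> is turned into an equation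
    with the end of block \<open>c\<close>. This end may be the length itself, hence an equality of
    the kind in \<open>fo_term_eq_term\<close>, with its bound.\<close>
  let ?B = "\<lambda>w v. \<exists>c<num_csts \<sigma>. \<exists>L<length w. bit_length (Suc (v j)) = L \<and> (\<exists>i<length w. i < L \<and>
    (Suc (v p + i) = rel_len \<sigma> (Suc (v j)) + c * L + L \<and>
      rel_len \<sigma> (Suc (v j)) + c * L + L \<le> length w) \<and>
    (if bit (v (h (Cst c))) i then v b = 1 else v b = 0))"
  let ?C = "\<lambda>v. rel_ars \<sigma> = [] \<and> v p < Suc (v j) \<and> v b = 0"
  have A: "fo (\<lambda>w v. ?A v)"
  proof (intro fo_Bex finite_terms)
    fix t
    show "fo (\<lambda>w v. \<exists>R ts. t = FunVar (k + R) ts \<and>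
      v p = rel_pos \<sigma> (Suc (v j)) R (map (\<lambda>t. v (h t)) ts) \<and> v b = v (h t))"
    proof (cases "\<exists>R ts. t = FunVar (k + R) ts")
      case True
      then obtain R ts where t: "t = FunVar (k + R) ts" by blast
      have "fo (\<lambda>w v. v p = rel_pos \<sigma> (Suc (v j)) R (map (\<lambda>t. v (h t)) ts) \<and> v b = v (h t))"
        unfolding rel_pos_def
        by (intro fo_conj fo_var_eq_term fo_term_add fo_term_offset fo_term_rank fo_term_Suc fo_term_var fo_eq_var)
      then show ?thesis by (rule fo_cong) (use t in auto)
    next
      case False
      show ?thesis by (rule fo_cong[OF fo_const[of False]]) (use False in auto)
    qed
  qed
  have B: "fo (\<lambda>w v. ?B w v)"
    by (intro fo_finite_ex fo_ex fo_conj fo_if fo_less fo_bit fo_eq_const fo_term_eq_term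
        fo_term_eq_var fo_term_bit_length fo_term_add fo_term_mult fo_term_Suc fo_term_var
        fo_term_const fo_term_rel_len)
  have C: "fo (\<lambda>w v. ?C v)" by (intro fo_conj fo_const fo_less_Suc fo_eq_const)
  have "fo (\<lambda>w v. sized (length w) (Suc (v j)) \<and> (?A v \<or> ?B w v \<or> ?C v))"
    by (intro fo_conj fo_disj fo_sized A B C)
  then show ?thesis
  proof (rule fo_cong)
    fix w :: "bool list" and v :: "nat \<Rightarrow> nat"
    assume v: "\<And>i. v i < length w"
    let ?m = "Suc (v j)"
    let ?L = "bit_length ?m"
    show "(sized (length w) ?m \<and> required ?m (\<lambda>t. v (h t)) (v p) (v b)) =
      (sized (length w) ?m \<and> (?A v \<or> ?B w v \<or> ?C v))"
    proof (rule conj_cong[OF refl])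
      assume "sized (length w) ?m"
      then have n: "length w = rel_len \<sigma> ?m + num_csts \<sigma> * ?L" by (simp add: sized_def enc_len_def)
      have "?L \<le> v j" unfolding bit_length_Suc_le_iff using nat_bit_imp_less by blast
      then have L: "?L < length w" using v[of j] by simp
      have "(\<exists>i<?L. v p = cst_pos \<sigma> ?m c i \<and> v b = of_bool (bit (v (h (Cst c))) i)) =
        (\<exists>L<length w. ?L = L \<and> (\<exists>i<length w. i < L \<and>
    (Suc (v p + i) = rel_len \<sigma> (Suc (v j)) + c * L + L \<and>
      rel_len \<sigma> (Suc (v j)) + c * L + L \<le> length w) \<and>
    (if bit (v (h (Cst c))) i then v b = 1 else v b = 0)))" if c: "c < num_csts \<sigma>" for c
      proof -
        have "Suc c * ?L \<le> num_csts \<sigma> * ?L" using c by (intro mult_le_mono1) simp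
        then have le: "rel_len \<sigma> ?m + c * ?L + ?L \<le> length w" using n by simp
        have pos: "v p = cst_pos \<sigma> ?m c i \<longleftrightarrow> Suc (v p + i) = rel_len \<sigma> ?m + c * ?L + ?L" if "i < ?L" for i
          using that by (auto simp: cst_pos_def)
        show ?thesis
        proof (intro iffI, goal_cases)
          case 1
          then obtain i where "i < ?L" "v p = cst_pos \<sigma> ?m c i" "v b = of_bool (bit (v (h (Cst c))) i)"
            by blast
          then show ?case using L le pos[of i]
            by (intro exI[of _ ?L] conjI exI[of _ i]) auto
        next
          case 2
          then obtain i where "i < ?L" "Suc (v p + i) = rel_len \<sigma> ?m + c * ?L + ?L"
            "if bit (v (h (Cst c))) i then v b = 1 else v b = 0" by blast
          then show ?case using pos[of i] by (intro exI[of _ i]) (auto split: if_splits)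
        qed
      qed
      then show "required ?m (\<lambda>t. v (h t)) (v p) (v b) = (?A v \<or> ?B w v \<or> ?C v)"
        unfolding required_def by (simp cong: conj_cong)
    qed
  qed
qed

definition arity :: "nat \<Rightarrow> nat" where
  "arity \<tau> = (if \<tau> = 0 then 0 else if \<tau> = 1 then K else if \<tau> = 2 then 2
    else if \<tau> = 3 then 1 else ars ! (\<tau> - 4))"

text \<open>
  Tag 0 is the output gate, an \<open>Or\<close> over the good guesses (tag 1). The gate of a guess is the
  conjunction of all input literals \<open>[p, b]\<close> (tag 2) that it requires and of one \<open>Or\<close> gate
  (tag \<open>4 + i\<close>) with \<open>m\<close> true leaves (tag 3) for each argument of the function variable \<open>i\<close>
  whose value the guess leaves open.
\<close>

definition is_gate :: "nat \<Rightarrow> nat \<Rightarrow> nat list \<Rightarrow> bool" where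
  "is_gate n \<tau> xs \<longleftrightarrow> \<tau> < 4 + k \<and> xs \<in> tuples n (arity \<tau>) \<and>
     (\<tau> = 1 \<longrightarrow> (\<exists>m. sized n m \<and> good m (guess xs))) \<and>
     (\<tau> = 2 \<longrightarrow> xs ! 1 < 2) \<and>
     (\<tau> \<ge> 3 \<longrightarrow> (\<exists>m. sized n m \<and> (\<forall>x\<in>set xs. x < m)))"

definition is_edge :: "nat \<Rightarrow> nat \<Rightarrow> nat list \<Rightarrow> nat \<Rightarrow> nat list \<Rightarrow> bool" where
  "is_edge n \<tau> xs \<tau>' ys \<longleftrightarrow>
     \<tau> = 0 \<and> \<tau>' = 1 \<or>
     \<tau> = 1 \<and> \<tau>' = 2 \<and> (\<exists>m. sized n m \<and> required m (guess xs) (ys ! 0) (ys ! 1)) \<or>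
     \<tau> = 1 \<and> \<tau>' \<ge> 4 \<and> \<not> queried (guess xs) (\<tau>' - 4) ys \<or>
     \<tau> \<ge> 4 \<and> \<tau>' = 3"

definition query_circuit :: "nat \<Rightarrow> (nat \<times> nat list) circuit" where
  "query_circuit n = \<lparr>gates = {(\<tau>, xs). is_gate n \<tau> xs},
     children = {((\<tau>, xs), (\<tau>', ys)). is_gate n \<tau> xs \<and> is_gate n \<tau>' ys \<and> is_edge n \<tau> xs \<tau>' ys},
     label = (\<lambda>(\<tau>, xs). if \<tau> = 1 then And
       else if \<tau> = 2 then (if xs ! 1 = 1 then Input (xs ! 0) else NegInput (xs ! 0))
       else if \<tau> = 3 then Const True else Or),
     out_gate = (0, [])\<rparr>"

definition tag_rank :: "nat \<Rightarrow> nat" where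
  "tag_rank \<tau> = (if \<tau> = 0 then 3 else if \<tau> = 1 then 2 else if \<tau> \<ge> 4 then 1 else 0)"

lemma ranked_query_circuit: "ranked (query_circuit n) (\<lambda>(\<tau>, xs). tag_rank \<tau>)"
  by (auto simp: ranked_def query_circuit_def is_edge_def tag_rank_def)

lemma wf_query_circuit: "wf_circuit n (query_circuit n)"
  unfolding wf_circuit_def
proof (intro conjI)
  have "gates (query_circuit n) \<subseteq> (SIGMA \<tau>:{..<4 + k}. tuples n (arity \<tau>))"
    by (auto simp: query_circuit_def is_gate_def)
  then show "finite (gates (query_circuit n))"
    by (rule finite_subset) (auto simp: finite_tuples)
  show "acyclic (children (query_circuit n))" by (rule ranked_acyclic[OF ranked_query_circuit])
  show "out_gate (query_circuit n) \<in> gates (query_circuit n)"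
    by (simp add: query_circuit_def is_gate_def arity_def tuples_def)
  show "\<forall>g\<in>gates (query_circuit n). \<forall>i. label (query_circuit n) g \<in> {Input i, NegInput i} \<longrightarrow> i < n"
    by (auto simp: query_circuit_def is_gate_def arity_def tuples_def subset_eq split: if_splits)
qed (auto simp: query_circuit_def is_edge_def split: if_splits)

lemma guess_map: "t \<in> terms \<Longrightarrow> guess (map v [a..<a + K]) t = v (a + idx t)"
  using idx_less by (simp add: guess_def)

lemma fo_is_gate: "\<tau> < 4 + k \<Longrightarrow> fo (\<lambda>w v. is_gate (length w) \<tau> (map v [a..<a + arity \<tau>]))"
proof -
  assume \<tau>: "\<tau> < 4 + k"
  have "fo (\<lambda>w v. (\<tau> = 1 \<longrightarrow> (\<exists>m. sized (length w) m \<and> good m (\<lambda>t. v (a + idx t)))) \<and>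
     (\<tau> = 2 \<longrightarrow> v (a + 1) < 2) \<and>
     (\<tau> \<ge> 3 \<longrightarrow> (\<exists>m. sized (length w) m \<and> (\<forall>x\<in>{a..<a + arity \<tau>}. v x < m))))"
    by (intro fo_conj fo_imp fo_const fo_less_two fo_ex_sized fo_sized fo_good fo_Ball
        fo_less_Suc finite_atLeastLessThan)
  then show ?thesis
  proof (rule fo_cong)
    fix w :: "bool list" and v :: "nat \<Rightarrow> nat"
    assume v: "\<And>i. v i < length w"
    have "good m (guess (map v [a..<a + K])) = good m (\<lambda>t. v (a + idx t))" for m
      using good_cong[of "guess (map v [a..<a + K])" "\<lambda>t. v (a + idx t)" m]
        good_cong[of "\<lambda>t. v (a + idx t)" "guess (map v [a..<a + K])" m] guess_map[of _ v a] by auto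
    moreover have "map v [a..<a + arity \<tau>] \<in> tuples (length w) (arity \<tau>)"
      using v by (auto simp: tuples_def)
    ultimately show "is_gate (length w) \<tau> (map v [a..<a + arity \<tau>]) =
      ((\<tau> = 1 \<longrightarrow> (\<exists>m. sized (length w) m \<and> good m (\<lambda>t. v (a + idx t)))) \<and>
     (\<tau> = 2 \<longrightarrow> v (a + 1) < 2) \<and>
     (\<tau> \<ge> 3 \<longrightarrow> (\<exists>m. sized (length w) m \<and> (\<forall>x\<in>{a..<a + arity \<tau>}. v x < m))))"
      using \<tau> unfolding is_gate_def by (auto simp: arity_def)
  qed
qed

lemma fo_is_edge:
  "fo (\<lambda>w v. is_edge (length w) \<tau> (map v [a..<a + arity \<tau>]) \<tau>' (map v [b..<b + arity \<tau>']))"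
proof -
  have required: "fo (\<lambda>w v. \<exists>m. sized (length w) m \<and> required m (\<lambda>t. v (a + idx t)) (v b) (v (b + 1)))"
    by (rule fo_ex_sized, rule fo_required)
  have "fo (\<lambda>w v. (\<tau> = 0 \<and> \<tau>' = 1) \<or>
     ((\<tau> = 1 \<and> \<tau>' = 2) \<and> (\<exists>m. sized (length w) m \<and> required m (\<lambda>t. v (a + idx t)) (v b) (v (b + 1)))) \<or>
     ((\<tau> = 1 \<and> \<tau>' \<ge> 4) \<and> \<not> queried (\<lambda>t. v (a + idx t)) (\<tau>' - 4) (map v [b..<b + arity \<tau>'])) \<or>
     (\<tau> \<ge> 4 \<and> \<tau>' = 3))"
    by (intro fo_disj fo_conj fo_not fo_const required fo_queried)
  then show ?thesis
  proof (rule fo_cong)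
    fix w :: "bool list" and v :: "nat \<Rightarrow> nat"
    have "required m (guess (map v [a..<a + K])) = required m (\<lambda>t. v (a + idx t))" for m
      using required_cong[of "guess (map v [a..<a + K])" "\<lambda>t. v (a + idx t)"] guess_map[of _ v a]
      by (intro ext) auto
    moreover have "queried (guess (map v [a..<a + K])) = queried (\<lambda>t. v (a + idx t))"
      using queried_cong[of "guess (map v [a..<a + K])" "\<lambda>t. v (a + idx t)"] guess_map[of _ v a]
      by (intro ext) auto
    ultimately show "is_edge (length w) \<tau> (map v [a..<a + arity \<tau>]) \<tau>' (map v [b..<b + arity \<tau>']) =
      ((\<tau> = 0 \<and> \<tau>' = 1) \<or>
     ((\<tau> = 1 \<and> \<tau>' = 2) \<and> (\<exists>m. sized (length w) m \<and> required m (\<lambda>t. v (a + idx t)) (v b) (v (b + 1)))) \<or>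
     ((\<tau> = 1 \<and> \<tau>' \<ge> 4) \<and> \<not> queried (\<lambda>t. v (a + idx t)) (\<tau>' - 4) (map v [b..<b + arity \<tau>'])) \<or>
     (\<tau> \<ge> 4 \<and> \<tau>' = 3))"
      unfolding is_edge_def by (auto simp: arity_def)
  qed
qed

end

lemma prod_of_bool: "finite X \<Longrightarrow> (\<Prod>x\<in>X. of_bool (P x)) = (of_bool (\<forall>x\<in>X. P x) :: nat)"
  by (induction X rule: finite_induct) auto

context qf_query
begin

section \<open>The value of the circuit\<close>

definition literals_hold :: "bool list \<Rightarrow> nat \<Rightarrow> (trm \<Rightarrow> nat) \<Rightarrow> bool" where
  "literals_hold w m e \<longleftrightarrow>
     (\<forall>p<length w. \<forall>b<2. required m e p b \<longrightarrow> w ! p = (b = 1))"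

lemma literals_holdD:
  "literals_hold w m e \<Longrightarrow> required m e p b \<Longrightarrow> p < length w \<Longrightarrow> b < 2 \<Longrightarrow> w ! p = (b = 1)"
  unfolding literals_hold_def by blast

text \<open>Length at least 2 ensures that the truth values \<open>0\<close> and \<open>1\<close> of
  relation atoms are elements of the universe.\<close>

lemma is_gate_guess:
  assumes "sized n m" "n \<ge> 2"
  shows "is_gate n 1 xs \<longleftrightarrow> xs \<in> good_guesses m"
proof
  assume "is_gate n 1 xs"
  then obtain m' where "sized n m'" "good m' (guess xs)" "length xs = K"
    by (auto simp: is_gate_def arity_def tuples_def)
  then show "xs \<in> good_guesses m" using sized_unique[OF assms(1)] by (auto simp: good_guesses_def)
next
  assume xs: "xs \<in> good_guesses m"
  then have "xs \<in> tuples (max m 2) K" using good_guesses_subset by blast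
  then have "xs \<in> tuples n K" using sized_le[OF assms(1)] assms(2) by (auto simp: tuples_def)
  then show "is_gate n 1 xs" using xs assms(1) by (auto simp: is_gate_def arity_def good_guesses_def)
qed

lemma is_gate_fun:
  assumes "sized n m"
  shows "is_gate n (4 + i) ys \<longleftrightarrow> i < k \<and> ys \<in> tuples m (ars ! i)"
proof
  assume g: "is_gate n (4 + i) ys"
  then obtain m' where "sized n m'" "\<forall>x\<in>set ys. x < m'" by (auto simp: is_gate_def)
  then show "i < k \<and> ys \<in> tuples m (ars ! i)"
    using g sized_unique[OF assms, of m'] by (auto simp: is_gate_def arity_def tuples_def)
next
  assume i: "i < k \<and> ys \<in> tuples m (ars ! i)"
  then have "ys \<in> tuples n (ars ! i)" using sized_le[OF assms] by (auto simp: tuples_def)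
  then show "is_gate n (4 + i) ys"
    using i assms unfolding is_gate_def arity_def tuples_def by auto
qed

lemma is_gate_leaf:
  assumes "sized n m"
  shows "is_gate n 3 ys \<longleftrightarrow> (\<exists>c<m. ys = [c])"
proof
  assume g: "is_gate n 3 ys"
  then obtain m' where "sized n m'" "\<forall>x\<in>set ys. x < m'" by (auto simp: is_gate_def)
  then show "\<exists>c<m. ys = [c]"
    using g sized_unique[OF assms, of m'] by (auto simp: is_gate_def arity_def tuples_def length_Suc_conv)
qed (use assms sized_le[OF assms] in \<open>auto simp: is_gate_def arity_def tuples_def\<close>)

lemma is_gate_literal: "is_gate n 2 ys \<longleftrightarrow> (\<exists>p<n. \<exists>b<n. b < 2 \<and> ys = [p, b])"
  by (auto simp: is_gate_def arity_def tuples_def length_Suc_conv numeral_2_eq_2)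

definition guess_value :: "bool list \<Rightarrow> nat \<Rightarrow> nat list \<Rightarrow> nat" where
  "guess_value w m xs = of_bool (literals_hold w m (guess xs)) *
     (\<Prod>i<k. m ^ card (unqueried m (guess xs) i))"

lemma children_query_circuit:
  "children (query_circuit n) `` {(\<tau>, xs)} =
    {(\<tau>', ys). is_gate n \<tau> xs \<and> is_gate n \<tau>' ys \<and> is_edge n \<tau> xs \<tau>' ys}"
  by (auto simp: query_circuit_def)

lemma children_output: "children (query_circuit n) `` {(0, [])} = Pair 1 ` {xs. is_gate n 1 xs}"
  unfolding children_query_circuit
  by (auto simp: is_edge_def is_gate_def arity_def tuples_def)

text \<open>The outer sum has at most one term. Its form also covers lengths that belong to no
  structure, where the output gate has no children.\<close>

lemma num_proof_trees_query_circuit: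
  assumes w: "length w \<ge> 2"
  shows "num_proof_trees (query_circuit (length w)) w =
    (\<Sum>m | sized (length w) m. \<Sum>xs\<in>good_guesses m. guess_value w m xs)"
proof (cases "\<exists>m. sized (length w) m")
  case False
  let ?n = "length w"
  have "children (query_circuit ?n) `` {(0, [])} = {}"
    unfolding children_output using False by (auto simp: is_gate_def)
  moreover have "label (query_circuit ?n) (0, []) = Or" "out_gate (query_circuit ?n) = (0, [])"
    by (simp_all add: query_circuit_def)
  ultimately have "card (trees_at (query_circuit ?n) w (out_gate (query_circuit ?n))) = 0"
    by (simp add: trees_at_Or)
  then show ?thesis using False by (simp add: trees_at_def num_proof_trees_def)
next
  case True
  let ?n = "length w"
  obtain m where m: "sized ?n m" using True by blast
  have single: "{m. sized ?n m} = {m}" using m sized_unique by blast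
  \<comment> \<open>The expected number of proof trees at each gate, tag by tag.\<close>
  define val where "val = (\<lambda>(\<tau>, xs). if \<tau> = 0 then \<Sum>xs\<in>good_guesses m. guess_value w m xs
    else if \<tau> = 1 then guess_value w m xs
    else if \<tau> = 2 then of_bool (w ! (xs ! 0) = (xs ! 1 = 1)) else if \<tau> = (3::nat) then 1 else m)"
  have "num_proof_trees (query_circuit ?n) w = val (out_gate (query_circuit ?n))"
  proof (rule num_proof_trees_eq_value[OF wf_query_circuit ranked_query_circuit])
    fix g assume "g \<in> gates (query_circuit ?n)"
    then obtain \<tau> xs where g: "g = (\<tau>, xs)" "is_gate ?n \<tau> xs" by (auto simp: query_circuit_def)
    let ?Y = "children (query_circuit ?n) `` {(\<tau>, xs)}"
    consider "\<tau> = 0" | "\<tau> = 1" | "\<tau> = 2" | "\<tau> = 3" | "\<tau> \<ge> 4" by linarith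
    then show "val g = (case label (query_circuit ?n) g of
        And \<Rightarrow> \<Prod>y\<in>children (query_circuit ?n) `` {g}. val y
      | Or \<Rightarrow> \<Sum>y\<in>children (query_circuit ?n) `` {g}. val y
      | l \<Rightarrow> of_bool (true_label w l))"
    proof cases
      case 1
      then have xs: "xs = []" using g by (simp add: is_gate_def arity_def tuples_def)
      have "(\<Sum>y\<in>?Y. val y) = (\<Sum>xs\<in>good_guesses m. guess_value w m xs)"
        unfolding 1 xs children_output is_gate_guess[OF m w]
        by (simp add: sum.reindex inj_on_def val_def)
      then show ?thesis using 1 by (simp add: g query_circuit_def val_def)
    next
      case 2
      let ?e = "guess xs"
      \<comment> \<open>Terms that require the same bit share a literal, which is harmless as its
        value is \<open>0\<close> or \<open>1\<close>. Contradictory requirements yield two opposite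
        literals and hence the value \<open>0\<close>.\<close>
      let ?lit = "(\<lambda>(p, b). (2::nat, [p, b])) ` {(p, b). p < ?n \<and> b < 2 \<and> required m ?e p b}"
      let ?fun = "(\<lambda>(i, ys). (4 + i, ys)) ` (SIGMA i:{..<k}. unqueried m ?e i)"
      have Y: "?Y = ?lit \<union> ?fun"
      proof (intro equalityI subsetI)
        fix y assume "y \<in> ?Y"
        then obtain \<tau>' ys where y: "y = (\<tau>', ys)" "is_gate ?n \<tau>' ys" "is_edge ?n 1 xs \<tau>' ys"
          using 2 by (auto simp: children_query_circuit)
        then consider m' where "\<tau>' = 2" "sized ?n m'" "required m' ?e (ys ! 0) (ys ! 1)"
          | "\<tau>' \<ge> 4" "\<not> queried ?e (\<tau>' - 4) ys" by (auto simp: is_edge_def)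
        then show "y \<in> ?lit \<union> ?fun"
        proof cases
          case 1
          then obtain p b where "p < ?n" "b < 2" "ys = [p, b]" using y(2) is_gate_literal by auto
          then have "y \<in> ?lit" using 1 y(1) sized_unique[OF m 1(2)] by force
          then show ?thesis by blast
        next
          case 2
          then obtain i where i: "\<tau>' = 4 + i" by (metis le_iff_add)
          then have "y = (\<lambda>(i, ys). (4 + i, ys)) (i, ys)" "i < k" "ys \<in> unqueried m ?e i"
            using y is_gate_fun[OF m] 2 by (auto simp: unqueried_def)
          then show ?thesis by blast
        qed
      next
        fix y assume "y \<in> ?lit \<union> ?fun"
        then show "y \<in> ?Y"
        proof
          assume "y \<in> ?lit"
          then obtain p b where pb: "p < ?n" "b < 2" "required m ?e p b" "y = (2, [p, b])" by auto
          have "is_gate ?n 2 [p, b]" using pb w by (auto simp: is_gate_literal)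
          then show ?thesis using pb g m 2 by (auto simp: children_query_circuit is_edge_def)
        next
          assume "y \<in> ?fun"
          then obtain i ys where iy: "i < k" "ys \<in> unqueried m ?e i" "y = (4 + i, ys)" by auto
          then have "is_gate ?n (4 + i) ys" using is_gate_fun[OF m] by (auto simp: unqueried_def)
          then show ?thesis
            using iy g 2 by (auto simp: children_query_circuit is_edge_def unqueried_def)
        qed
      qed
      have fin: "finite {(p, b). p < ?n \<and> b < 2 \<and> required m ?e p b}"
        by (rule finite_subset[of _ "{..<?n} \<times> {..<2}"]) auto
      have finS: "finite (SIGMA i:{..<k}. unqueried m ?e i)"
        by (intro finite_SigmaI) (auto simp: unqueried_def finite_tuples)
      have "(\<Prod>y\<in>?lit. val y) = (\<Prod>x\<in>{(p, b). p < ?n \<and> b < 2 \<and> required m ?e p b}.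
          of_bool (case x of (p, b) \<Rightarrow> w ! p = (b = 1)))"
        by (subst prod.reindex) (auto simp: inj_on_def val_def intro!: prod.cong)
      also have "\<dots> = of_bool (literals_hold w m ?e)"
        unfolding prod_of_bool[OF fin] literals_hold_def by auto
      finally have lit: "(\<Prod>y\<in>?lit. val y) = of_bool (literals_hold w m ?e)" .
      have "(\<Prod>y\<in>?fun. val y) = (\<Prod>y\<in>?fun. m)" by (intro prod.cong) (auto simp: val_def)
      also have "\<dots> = m ^ card (SIGMA i:{..<k}. unqueried m ?e i)"
        by (simp add: card_image inj_on_def)
      also have "\<dots> = (\<Prod>i<k. m ^ card (unqueried m ?e i))"
        by (subst card_SigmaI) (auto simp: unqueried_def finite_tuples power_sum)
      finally have "(\<Prod>y\<in>?Y. val y) = guess_value w m xs"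
        unfolding Y using fin finS lit by (subst prod.union_disjoint) (auto simp: guess_value_def)
      then show ?thesis using 2 by (simp add: g query_circuit_def val_def)
    next
      case 3
      then show ?thesis by (auto simp: g query_circuit_def val_def)
    next
      case 4
      then show ?thesis by (simp add: g query_circuit_def val_def)
    next
      case 5
      have "?Y = (\<lambda>c. (3, [c])) ` {..<m}"
        using 5 g(2) is_gate_leaf[OF m] by (auto simp: children_query_circuit is_edge_def)
      then have "(\<Sum>y\<in>?Y. val y) = m" by (simp add: sum.reindex inj_on_def val_def)
      then show ?thesis using 5 by (simp add: g query_circuit_def val_def)
    qed
  qed
  then show ?thesis unfolding single by (simp add: query_circuit_def val_def)
qed

lemma cst_pos_less:
  assumes "j < num_csts \<sigma>" "i < bit_length m"
  shows "cst_pos \<sigma> m j i < enc_len \<sigma> m"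
proof -
  have "j * bit_length m + (bit_length m - 1 - i) < Suc j * bit_length m" using assms(2) by simp
  also have "\<dots> \<le> num_csts \<sigma> * bit_length m" using assms(1) by (intro mult_le_mono1) simp
  finally show ?thesis by (simp add: cst_pos_def enc_len_def)
qed

lemma rel_term_args:
  assumes "good m e" "FunVar (k + R) ts \<in> terms"
  shows "map e ts \<in> tuples m (rel_ars \<sigma> ! R)"
proof -
  have "e s < m" if "s \<in> set ts" for s
    using goodD(1)[OF assms(1), of s] rel_term(3)[OF assms(2) that] terms_closed[OF assms(2)] that by auto
  then show ?thesis using rel_term(2)[OF assms(2)] by (auto simp: tuples_def)
qed

text \<open>The required bits give the relations at the queried tuples and all digits of the
  constants; the guessed and the actual constants are below \<open>2 ^ bit_length (usize A)\<close>,
  so equal digits make them equal.\<close>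

lemma literals_hold_enc_iff:
  assumes A: "A \<in> STRUC \<sigma>" and good: "good (usize A) e"
  shows "literals_hold (enc \<sigma> A) (usize A) e \<longleftrightarrow> fits A e"
proof
  let ?w = "enc \<sigma> A" and ?m = "usize A"
  assume hold: "literals_hold ?w ?m e"
  have "e (FunVar (k + R) ts) = of_bool (rel_of A R (map e ts))" if t: "FunVar (k + R) ts \<in> terms" for R ts
  proof -
    note R = rel_term(1)[OF t] and args = rel_term_args[OF good t]
    let ?p = "rel_pos \<sigma> ?m R (map e ts)"
    have "?p < length ?w" using rel_pos_less[OF R args] by (simp add: length_enc enc_len_def)
    moreover have b: "e (FunVar (k + R) ts) < 2" using goodD(1)[OF good t] rel_term(4)[OF t] by simp
    moreover have "required ?m e ?p (e (FunVar (k + R) ts))" unfolding required_def using t by blast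
    ultimately have "?w ! ?p = (e (FunVar (k + R) ts) = 1)" using hold by (simp add: literals_hold_def)
    then have "rel_of A R (map e ts) = (e (FunVar (k + R) ts) = 1)" using nth_enc_rel[OF R args] by simp
    then show ?thesis using b by (cases "rel_of A R (map e ts)") auto
  qed
  moreover have "e (Cst j) = cst_of A j" if j: "j < num_csts \<sigma>" for j
  proof (rule nat_bit_eqI_bounded)
    have "Cst j \<in> terms" using j by (simp add: terms_def)
    then have "e (Cst j) < ?m" using goodD(1)[OF good, of "Cst j"] j by simp
    then show "e (Cst j) < 2 ^ bit_length ?m" by (rule less_power_bit_length)
    show "cst_of A j < 2 ^ bit_length ?m" using A j by (auto simp: STRUC_def intro: less_power_bit_length)
    fix i assume i: "i < bit_length ?m"
    have "required ?m e (cst_pos \<sigma> ?m j i) (of_bool (bit (e (Cst j)) i))"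
      unfolding required_def using i j by blast
    moreover have "cst_pos \<sigma> ?m j i < length ?w" using cst_pos_less[OF j i] by (simp add: length_enc)
    ultimately have "?w ! cst_pos \<sigma> ?m j i = (of_bool (bit (e (Cst j)) i) = (1::nat))"
      by (intro literals_holdD[OF hold]) auto
    then show "bit (e (Cst j)) i = bit (cst_of A j) i" using nth_enc_cst[OF j i] by simp
  qed
  ultimately show "fits A e" unfolding fits_def by blast
next
  let ?w = "enc \<sigma> A" and ?m = "usize A"
  assume fits: "fits A e"
  have "?w ! p = (b = 1)" if "required ?m e p b" for p b
    using that unfolding required_def
  proof (elim disjE bexE exE conjE)
    fix t R ts assume t: "t \<in> terms" "t = FunVar (k + R) ts" "p = rel_pos \<sigma> ?m R (map e ts)" "b = e t"
    then have "FunVar (k + R) ts \<in> terms" by simp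
    note nth = nth_enc_rel[OF rel_term(1)[OF this] rel_term_args[OF good this]]
    have "b = of_bool (rel_of A R (map e ts))" using fits t by (simp add: fits_def)
    then show ?thesis using nth t(3) by simp
  next
    fix j i assume "j < num_csts \<sigma>" "i < bit_length ?m" "p = cst_pos \<sigma> ?m j i"
      "b = of_bool (bit (e (Cst j)) i)"
    then show ?thesis using fits nth_enc_cst[of j \<sigma> i A] by (simp add: fits_def)
  next
    assume "rel_ars \<sigma> = []" "p < ?m" "b = 0"
    then show ?thesis using nth_enc_no_rel[of \<sigma> p A] by simp
  qed
  then show "literals_hold ?w ?m e" unfolding literals_hold_def by blast
qed

text \<open>A structure is decoded by reading its relations off the word and its constants off the
  guess, whose values are below \<open>m\<close>. Consequently every guess contributes
  \<open>0\<close> on a word that is not an encoding.\<close>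

lemma literals_hold_imp_enc:
  assumes m: "sized (length w) m" and good: "good m e" and hold: "literals_hold w m e"
  shows "w \<in> enc \<sigma> ` STRUC \<sigma>"
proof -
  define A where "A = \<lparr>usize = m, rel_of = (\<lambda>R xs. w ! rel_pos \<sigma> m R xs), cst_of = (\<lambda>j. e (Cst j))\<rparr>"
  have len: "length w = enc_len \<sigma> m" and "1 \<le> m" using m by (auto simp: sized_def)
  have cst: "e (Cst j) < m" if "j < num_csts \<sigma>" for j
    using goodD(1)[OF good, of "Cst j"] that by (simp add: terms_def)
  have "w = enc \<sigma> A"
  proof (rule eq_encI)
    fix j i assume *: "j < num_csts \<sigma>" "i < bit_length (usize A)"
    then have i: "i < bit_length m" by (simp add: A_def)
    have "required m e (cst_pos \<sigma> m j i) (of_bool (bit (e (Cst j)) i))"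
      unfolding required_def using i * by blast
    moreover have "cst_pos \<sigma> m j i < length w" using cst_pos_less[OF *(1) i] by (simp add: len)
    ultimately have "w ! cst_pos \<sigma> m j i = (of_bool (bit (e (Cst j)) i) = (1::nat))"
      by (intro literals_holdD[OF hold]) auto
    then show "w ! cst_pos \<sigma> (usize A) j i = bit (cst_of A j) i" by (simp add: A_def)
  next
    fix p assume p: "rel_ars \<sigma> = []" "p < usize A"
    then have "required m e p 0" by (simp add: A_def required_def)
    moreover have "p < length w" using p sized_le[OF m] by (simp add: A_def)
    ultimately show "\<not> w ! p" using literals_holdD[OF hold] by fastforce
  qed (simp_all add: A_def len)
  moreover have "A \<in> STRUC \<sigma>" using cst \<open>1 \<le> m\<close> by (simp add: A_def STRUC_def)
  ultimately show ?thesis by blast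
qed

text \<open>Over one element there is only one assignment. This meets the bound that a single gate
  imposes at length 1.\<close>

lemma sat_count_le_one:
  assumes "usize A = 1" shows "sat_count A ars l \<phi> \<le> 1"
proof -
  have tup: "card (tuples 1 a) = 1" for a by (simp add: card_tuples)
  have fin: "finite (tuples 1 a \<rightarrow>\<^sub>E {..<1::nat})" for a by (intro finite_PiE) (auto simp: finite_tuples)
  have card_fun: "card (tuples 1 a \<rightarrow>\<^sub>E {..<1::nat}) = 1" for a
    using finite_tuples[of 1 a] by (simp add: card_PiE)
  let ?F = "{fs. length fs = k \<and> (\<forall>i<k. fs ! i \<in> tuples 1 (ars ! i) \<rightarrow>\<^sub>E {..<1::nat})}"
  have F: "finite ?F" "card ?F = 1"
    using card_lists_nth[of k "\<lambda>i. tuples 1 (ars ! i) \<rightarrow>\<^sub>E {..<1::nat}"] fin card_fun by auto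
  have "sat_count A ars l \<phi> \<le> card (?F \<times> tuples 1 l)"
    unfolding sat_count_def assms using F(1) finite_tuples by (intro card_mono) auto
  also have "\<dots> = 1" using F tup by (simp add: card_cartesian_product)
  finally show ?thesis .
qed

theorem in_fo_uniform_sharp_AC0:
  assumes enc: "\<And>A. A \<in> STRUC \<sigma> \<Longrightarrow> f (enc \<sigma> A) = sat_count A ars l \<phi>"
    and not_enc: "\<And>w. w \<noteq> [] \<Longrightarrow> w \<notin> enc \<sigma> ` STRUC \<sigma> \<Longrightarrow> f w = 0"
  shows "f \<in> fo_uniform_sharp_AC0"
proof (rule fo_uniform_sharp_AC0I[of query_circuit "4 + k" arity tag_rank "{1}" "insert 0 {4..}"])
  fix n :: nat
  show "gates (query_circuit n) \<subseteq> {(\<tau>, xs). \<tau> < 4 + k \<and> xs \<in> tuples n (arity \<tau>)}"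
    by (auto simp: query_circuit_def is_gate_def)
  show "out_gate (query_circuit n) = (0, [])" by (simp add: query_circuit_def)
  show "(label (query_circuit n) (\<tau>, xs) = And \<longleftrightarrow> \<tau> \<in> {1}) \<and>
    (label (query_circuit n) (\<tau>, xs) = Or \<longleftrightarrow> \<tau> \<in> insert 0 {4..})" for \<tau> xs
    by (auto simp: query_circuit_def)
next
  fix \<tau> a assume \<tau>: "\<tau> < 4 + k"
  then show "fo (\<lambda>w v. (\<tau>, map v [a..<a + arity \<tau>]) \<in> gates (query_circuit (length w)))"
    using fo_is_gate by (simp add: query_circuit_def)
  have "fo (\<lambda>w v. is_gate (length w) \<tau> (map v [a..<a + arity \<tau>]) \<and>
    (if \<tau> = 2 then (if v (a + 1) = 1 then w ! v a else \<not> w ! v a) else \<tau> = 3))"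
    by (intro fo_conj fo_is_gate[OF \<tau>] fo_if fo_eq_const fo_const fo_nth fo_not)
  then show "fo (\<lambda>w v. (\<tau>, map v [a..<a + arity \<tau>]) \<in> gates (query_circuit (length w)) \<and>
    true_label w (label (query_circuit (length w)) (\<tau>, map v [a..<a + arity \<tau>])))"
    by (rule fo_cong) (auto simp: query_circuit_def arity_def)
next
  fix \<tau> \<tau>' a b assume "\<tau> < 4 + k" "\<tau>' < 4 + k"
  then have "fo (\<lambda>w v. is_gate (length w) \<tau> (map v [a..<a + arity \<tau>]) \<and>
     is_gate (length w) \<tau>' (map v [b..<b + arity \<tau>']) \<and>
     is_edge (length w) \<tau> (map v [a..<a + arity \<tau>]) \<tau>' (map v [b..<b + arity \<tau>']))"
    by (intro fo_conj fo_is_gate fo_is_edge)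
  then show "fo (\<lambda>w v. ((\<tau>, map v [a..<a + arity \<tau>]), (\<tau>', map v [b..<b + arity \<tau>'])) \<in>
    children (query_circuit (length w)))"
    by (simp add: query_circuit_def)
next
  fix w :: "bool list" assume w: "length w \<ge> 2"
  have "f w = (\<Sum>m | sized (length w) m. \<Sum>xs\<in>good_guesses m. guess_value w m xs)"
  proof (cases "w \<in> enc \<sigma> ` STRUC \<sigma>")
    case True
    then obtain A where A: "A \<in> STRUC \<sigma>" "w = enc \<sigma> A" by blast
    then have m: "sized (length w) (usize A)" by (simp add: sized_def length_enc STRUC_def)
    then have "{m. sized (length w) m} = {usize A}" using sized_unique by blast
    moreover have "(\<Sum>xs\<in>good_guesses (usize A). guess_value w (usize A) xs) = sat_count A ars l \<phi>"
      unfolding sat_count_eq[OF A(1)] guess_value_def A(2)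
      using literals_hold_enc_iff[OF A(1)] by (intro sum.cong) (auto simp: good_guesses_def)
    ultimately show ?thesis using enc[OF A(1)] A(2) by simp
  next
    case False
    have "guess_value w m xs = 0" if "sized (length w) m" "xs \<in> good_guesses m" for m xs
      using literals_hold_imp_enc[OF that(1), of "guess xs"] that(2) False
      by (auto simp: guess_value_def good_guesses_def)
    moreover have "w \<noteq> []" using w by auto
    then have "f w = 0" using not_enc False by blast
    ultimately show ?thesis by simp
  qed
  then show "f w = num_proof_trees (query_circuit (length w)) w"
    using num_proof_trees_query_circuit[OF w] by simp
next
  fix w :: "bool list" assume w: "length w = 1"
  show "f w \<le> 1"
  proof (cases "w \<in> enc \<sigma> ` STRUC \<sigma>")
    case True
    then obtain A where A: "A \<in> STRUC \<sigma>" "w = enc \<sigma> A" by blast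
    then have "usize A \<le> 1" using enc_len_ge[OF wf_vocab, of "usize A"] w by (simp add: length_enc)
    then have "usize A = 1" using A(1) by (simp add: STRUC_def)
    then show ?thesis using sat_count_le_one enc[OF A(1)] A(2) by simp
  next
    case False
    moreover have "w \<noteq> []" using w by auto
    ultimately have "f w = 0" using not_enc by blast
    then show ?thesis by simp
  qed
qed (simp_all add: wf_query_circuit ranked_query_circuit arity_def)

end

theorem sharp_Sigma0_subset: "sharp_Sigma0 \<subseteq> fo_uniform_sharp_AC0"
proof
  fix f assume "f \<in> sharp_Sigma0"
  then obtain \<sigma> ars l \<phi> where *: "wf_vocab \<sigma>" "wf_fml \<sigma> ars \<phi>" "quantifier_free \<phi>" "fvars \<phi> \<subseteq> {..<l}"
    "\<forall>A\<in>STRUC \<sigma>. f (enc \<sigma> A) = sat_count A ars l \<phi>"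
    "\<forall>w. w \<noteq> [] \<and> w \<notin> enc \<sigma> ` STRUC \<sigma> \<longrightarrow> f w = 0"
    unfolding sharp_Sigma0_def by blast
  interpret qf_query \<sigma> ars l \<phi> by unfold_locales (use * in auto)
  show "f \<in> fo_uniform_sharp_AC0" by (rule in_fo_uniform_sharp_AC0) (use * in auto)
qed

section \<open>Strictness\<close>

definition all_ones :: "bool list \<Rightarrow> nat" where
  "all_ones w = of_bool (\<forall>i<length w. w ! i)"

definition and_circuit :: "nat \<Rightarrow> (nat \<times> nat list) circuit" where
  "and_circuit n = \<lparr>gates = insert (0, []) ((\<lambda>p. (1, [p])) ` {..<n}),
     children = {(0, [])} \<times> (\<lambda>p. (1, [p])) ` {..<n},
     label = (\<lambda>(\<tau>, xs). if \<tau> = 0 then And else Input (hd xs)), out_gate = (0, [])\<rparr>"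

lemma ranked_and_circuit: "ranked (and_circuit n) (\<lambda>(\<tau>, xs). 1 - \<tau>)"
  by (auto simp: ranked_def and_circuit_def)

lemma wf_and_circuit: "wf_circuit n (and_circuit n)"
  using ranked_acyclic[OF ranked_and_circuit]
  by (auto simp: wf_circuit_def and_circuit_def)

lemma num_proof_trees_and_circuit: "num_proof_trees (and_circuit (length w)) w = all_ones w"
proof -
  let ?C = "and_circuit (length w)"
  define val where "val = (\<lambda>(\<tau>, xs). if \<tau> = (0::nat) then all_ones w else of_bool (w ! hd xs))"
  have "num_proof_trees ?C w = val (out_gate ?C)"
  proof (rule num_proof_trees_eq_value[OF wf_and_circuit ranked_and_circuit])
    fix g assume "g \<in> gates ?C"
    then consider "g = (0, [])" | p where "g = (1, [p])" by (auto simp: and_circuit_def)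
    then show "val g = (case label ?C g of
        And \<Rightarrow> \<Prod>y\<in>children ?C `` {g}. val y
      | Or \<Rightarrow> \<Sum>y\<in>children ?C `` {g}. val y
      | l \<Rightarrow> of_bool (true_label w l))"
    proof cases
      case 1
      have "children ?C `` {(0, [])} = (\<lambda>p. (1, [p])) ` {..<length w}" by (auto simp: and_circuit_def)
      then have "(\<Prod>y\<in>children ?C `` {(0, [])}. val y) = (\<Prod>p\<in>{..<length w}. of_bool (w ! p))"
        by (simp add: prod.reindex inj_on_def val_def)
      also have "\<dots> = all_ones w" by (subst prod_of_bool) (auto simp: all_ones_def)
      finally show ?thesis using 1 by (simp add: and_circuit_def val_def)
    qed (simp add: and_circuit_def val_def)
  qed
  then show ?thesis by (simp add: and_circuit_def val_def)
qed

text \<open>Tag \<open>0\<close> is the output and tag \<open>1\<close> an input bit with its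
  position, so each tag is its own arity.\<close>

lemma all_ones_in_AC0: "all_ones \<in> fo_uniform_sharp_AC0"
proof (rule fo_uniform_sharp_AC0I[of and_circuit 2 "\<lambda>\<tau>. \<tau>" "\<lambda>\<tau>. 1 - \<tau>" "{0}" "{}"])
  fix n :: nat
  show "gates (and_circuit n) \<subseteq> {(\<tau>, xs). \<tau> < 2 \<and> xs \<in> tuples n \<tau>}"
    by (auto simp: and_circuit_def tuples_def)
  show "ranked (and_circuit n) (\<lambda>(\<tau>, xs). 1 - \<tau>)" by (rule ranked_and_circuit)
  show "out_gate (and_circuit n) = (0, [])" by (simp add: and_circuit_def)
  show "(label (and_circuit n) (\<tau>, xs) = And \<longleftrightarrow> \<tau> \<in> {0}) \<and>
    (label (and_circuit n) (\<tau>, xs) = Or \<longleftrightarrow> \<tau> \<in> {})" for \<tau> xs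
    by (auto simp: and_circuit_def)
next
  fix \<tau> a :: nat assume \<tau>: "\<tau> < 2"
  show "fo (\<lambda>w v. (\<tau>, map v [a..<a + \<tau>]) \<in> gates (and_circuit (length w)))"
    by (rule fo_cong[OF fo_const[of True]]) (use \<tau> in \<open>auto simp: and_circuit_def less_2_cases_iff\<close>)
  have "fo (\<lambda>w v. \<tau> = 1 \<and> w ! v a)" by (intro fo_intros)
  then show "fo (\<lambda>w v. (\<tau>, map v [a..<a + \<tau>]) \<in> gates (and_circuit (length w)) \<and>
    true_label w (label (and_circuit (length w)) (\<tau>, map v [a..<a + \<tau>])))"
    by (rule fo_cong) (use \<tau> in \<open>auto simp: and_circuit_def less_2_cases_iff\<close>)
next
  fix \<tau> \<tau>' a b :: nat assume \<tau>: "\<tau> < 2" "\<tau>' < 2"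
  show "fo (\<lambda>w v. ((\<tau>, map v [a..<a + \<tau>]), (\<tau>', map v [b..<b + \<tau>'])) \<in> children (and_circuit (length w)))"
    by (rule fo_cong[OF fo_const[of "\<tau> = 0 \<and> \<tau>' = 1"]])
      (use \<tau> in \<open>auto simp: and_circuit_def less_2_cases_iff\<close>)
next
  fix w :: "bool list"
  show "all_ones w \<le> 1" by (simp add: all_ones_def)
qed (simp_all add: wf_and_circuit num_proof_trees_and_circuit)

section \<open>Impossibility for quantifier-free formulas\<close>

context qf_query
begin

text \<open>Each product is made of powers of a positive size, so a good guess that fits always
  contributes.\<close>

lemma sat_count_pos_iff:
  assumes A: "A \<in> STRUC \<sigma>"
  shows "sat_count A ars l \<phi> > 0 \<longleftrightarrow> (\<exists>xs\<in>good_guesses (usize A). fits A (guess xs))"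
proof -
  have "(\<Prod>i<k. usize A ^ card (unqueried (usize A) (guess xs) i)) > 0" for xs
    using A by (intro prod_pos) (auto simp: STRUC_def)
  moreover have "0 < sum h (good_guesses (usize A)) \<longleftrightarrow> (\<exists>xs\<in>good_guesses (usize A). 0 < h xs)"
    for h :: "nat list \<Rightarrow> nat"
    using sum_eq_0_iff[OF finite_good_guesses, of h "usize A"] by (metis neq0_conv)
  ultimately show ?thesis unfolding sat_count_eq[OF A] by simp
qed

text \<open>A guess reads at most \<open>card terms\<close> tuples of a relation, so some tuple is irrelevant.\<close>

lemma irrelevant_tuple:
  assumes A: "A \<in> STRUC \<sigma>" and pos: "sat_count A ars l \<phi> > 0"
    and large: "card terms < usize A" and R: "R < length (rel_ars \<sigma>)"
  obtains ys where "ys \<in> tuples (usize A) (rel_ars \<sigma> ! R)"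
    "sat_count (A\<lparr>rel_of := \<lambda>R' xs. rel_of A R' xs \<and> \<not> (R' = R \<and> xs = ys)\<rparr>) ars l \<phi> > 0"
proof -
  let ?m = "usize A" and ?a = "rel_ars \<sigma> ! R"
  obtain gs where gs: "gs \<in> good_guesses ?m" "fits A (guess gs)"
    using pos sat_count_pos_iff[OF A] by blast
  let ?args = "\<lambda>t. case t of FunVar i ts \<Rightarrow> map (guess gs) ts | _ \<Rightarrow> []"
  \<comment> \<open>Positive arity gives at least \<open>usize A\<close> tuples, more than there are
    terms.\<close>
  have "?a \<ge> 1" using wf_vocab R by (auto simp: wf_vocab_def)
  then have "?m ^ 1 \<le> ?m ^ ?a" using large by (intro power_increasing) auto
  then have "card (?args ` terms) < card (tuples ?m ?a)"
    using card_image_le[OF finite_terms, of ?args] large by (simp add: card_tuples)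
  then have "\<not> tuples ?m ?a \<subseteq> ?args ` terms"
    using card_mono[of "?args ` terms" "tuples ?m ?a"] finite_terms by auto
  then obtain ys where ys: "ys \<in> tuples ?m ?a" "ys \<notin> ?args ` terms" by blast
  let ?A = "A\<lparr>rel_of := \<lambda>R' xs. rel_of A R' xs \<and> \<not> (R' = R \<and> xs = ys)\<rparr>"
  have "ys \<noteq> map (guess gs) ts" if "FunVar i ts \<in> terms" for i ts
    using ys(2) that by (force simp: image_iff)
  \<comment> \<open>The guess never looks at \<open>ys\<close>, so it still fits; being good does
    not involve the relations at all.\<close>
  then have "fits ?A (guess gs)" using gs(2) by (auto simp: fits_def)
  moreover have "?A \<in> STRUC \<sigma>" using A by (simp add: STRUC_def)
  ultimately have "sat_count ?A ars l \<phi> > 0" using sat_count_pos_iff[of ?A] gs(1) by auto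
  then show ?thesis using that ys(1) by blast
qed

lemma not_all_ones:
  assumes enc: "\<And>A. A \<in> STRUC \<sigma> \<Longrightarrow> all_ones (enc \<sigma> A) = sat_count A ars l \<phi>"
    and not_enc: "\<And>w. w \<noteq> [] \<Longrightarrow> w \<notin> enc \<sigma> ` STRUC \<sigma> \<Longrightarrow> all_ones w = 0"
  shows False
proof -
  \<comment> \<open>The least size to which \<open>irrelevant_tuple\<close> applies.\<close>
  define m where "m = Suc (card terms)"
  define w where "w = replicate (enc_len \<sigma> m) True"
  have "0 < enc_len \<sigma> m" using enc_len_ge[OF wf_vocab, of m] by (simp add: m_def)
  then have "w \<noteq> []" and ones: "all_ones w = 1" by (simp_all add: w_def all_ones_def)
  \<comment> \<open>The value on a nonempty word outside the range would be \<open>0\<close>, so the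
    all-ones word is an encoding.\<close>
  then have "w \<in> enc \<sigma> ` STRUC \<sigma>" using not_enc[of w] by fastforce
  then obtain A where A: "A \<in> STRUC \<sigma>" "w = enc \<sigma> A" by blast
  then have "enc_len \<sigma> (usize A) = enc_len \<sigma> m"
    using length_enc[of \<sigma> A] unfolding A(2)[symmetric] by (simp add: w_def)
  then have size: "usize A = m"
    using enc_len_inj[OF wf_vocab, of "usize A" m] A(1) by (simp add: m_def STRUC_def)
  \<comment> \<open>Without relation symbols the encoding would begin with a padding zero.\<close>
  have "rel_ars \<sigma> \<noteq> []"
    using nth_enc_no_rel[of \<sigma> 0 A] \<open>0 < enc_len \<sigma> m\<close> unfolding A(2)[symmetric]
    by (auto simp: w_def size m_def)
  then have R: "0 < length (rel_ars \<sigma>)" by simp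
  have "sat_count A ars l \<phi> > 0" using enc[OF A(1)] ones A(2) by simp
  then obtain ys where ys: "ys \<in> tuples (usize A) (rel_ars \<sigma> ! 0)"
    "sat_count (A\<lparr>rel_of := \<lambda>R' xs. rel_of A R' xs \<and> \<not> (R' = 0 \<and> xs = ys)\<rparr>) ars l \<phi> > 0"
    using irrelevant_tuple[OF A(1) _ _ R] size m_def by auto
  let ?A = "A\<lparr>rel_of := \<lambda>R' xs. rel_of A R' xs \<and> \<not> (R' = 0 \<and> xs = ys)\<rparr>"
  have "?A \<in> STRUC \<sigma>" using A by (simp add: STRUC_def)
  then have "all_ones (enc \<sigma> ?A) > 0" using enc ys(2) by simp
  \<comment> \<open>The deleted tuple leaves a zero in the encoding, although the count is still
    positive.\<close>
  moreover have "\<not> enc \<sigma> ?A ! rel_pos \<sigma> (usize ?A) 0 ys"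
    using nth_enc_rel[OF R, of ys ?A] ys(1) by simp
  moreover have "rel_pos \<sigma> (usize ?A) 0 ys < length (enc \<sigma> ?A)"
    using rel_pos_less[OF R ys(1)] by (simp add: length_enc enc_len_def)
  ultimately show False by (auto simp: all_ones_def split: if_splits)
qed

end

lemma all_ones_notin_sharp_Sigma0: "all_ones \<notin> sharp_Sigma0"
proof
  assume "all_ones \<in> sharp_Sigma0"
  then obtain \<sigma> ars l \<phi> where *: "wf_vocab \<sigma>" "wf_fml \<sigma> ars \<phi>" "quantifier_free \<phi>" "fvars \<phi> \<subseteq> {..<l}"
    "\<forall>A\<in>STRUC \<sigma>. all_ones (enc \<sigma> A) = sat_count A ars l \<phi>"
    "\<forall>w. w \<noteq> [] \<and> w \<notin> enc \<sigma> ` STRUC \<sigma> \<longrightarrow> all_ones w = 0"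
    unfolding sharp_Sigma0_def by blast
  interpret qf_query \<sigma> ars l \<phi> by unfold_locales (use * in auto)
  show False by (rule not_all_ones) (use * in auto)
qed

theorem theorem5:
  shows "sharp_Sigma0 \<subset> fo_uniform_sharp_AC0"
  using sharp_Sigma0_subset all_ones_in_AC0 all_ones_notin_sharp_Sigma0 by blast

end
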